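(* If a finite CW complex $X$ has a structure of cylindrically normal stellar stratified space (CNSSS), then $X$ is conically stratified, and hence $\mathrm{Exit}(X)$ is a quasi-category.
   Context: "A CW complex $X$ has a structure of CNSSS" means that the decomposition of $X$ into its open cells, with characteristic maps as stellar structures (so each $D_\lambda$ is a closed disk regarded as the cone on its boundary sphere with a suitable stratification), is part of a CNSSS structure as defined below. **Stratifications.** Posets carry the Alexandroff topology in which the open sets are the upward closed sets. A stratification of a space $X$ by a poset $\Lambda$ is an open continuous map $\pi:X\to\Lambda$ such that $\pi^{-1}(\lambda)$ is connected and locally closed for each $\lambda\in\operatorname{Im}\pi$. The face poset is $P(X)=\operatorname{Im}\pi$; the strata are $e_\lambda=\pi^{-1}(\lambda)$, and $\partial e_\lambda=\overline{e_\lambda}\setminus e_\lambda$. A morphism of stratified spaces $X\to Y$ is a continuous map $f$ with an order-preserving map $P(f):P(X)\to P(Y)$ such that $\pi_Yf=P(f)\pi_X$; it is strict if $f(e_\lambda)=e_{P(f)(\lambda)}$. A stratification is normal if $e_\mu\cap\overline{e_\lambda}\ne\emptyset$ implies $e_\mu\subset\overline{e_\lambda}$. **Cones and asters.** For a stratified space $S$ with face poset $\Lambda$, $\mathrm{cone}(S)=\{*\}\star S$ is the join with a point, with points $(1-t)*+ty$ ($0\le t\le1$), $S$ being identified with the points with $t=1$ (and $\mathrm{cone}(\emptyset)=\{*\}$). It is stratified by $\Lambda\times\{b<i\}\amalg\{*\}$ (product order on $\Lambda\times\{b,i\}$, $*<(\lambda,i)$ for all $\lambda$, $*$ unrelated to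 the $(\lambda,b)$) via $(1-t)*+ty\mapsto *$, $(\pi_S(y),i)$, $(\pi_S(y),b)$ for $t=0$, $0<t<1$, $t=1$. A subset $D\subset\mathrm{cone}(S)$ is an aster if $(1-t)*+ty\in D$ implies $(1-t')*+t'y\in D$ for all $0\le t'\le t$. Put $\partial D=S\cap D$, $\operatorname{Int}(D)=D\setminus\partial D$. **Stellar stratified spaces.** A stellar structure on a stratum $e_\lambda$ is a morphism of stratified spaces $\varphi_\lambda:D_\lambda\to\overline{e_\lambda}$, for an aster $D_\lambda\subset\mathrm{cone}(S_\lambda)$ on some stratified space $S_\lambda$, which is a quotient map and restricts to a homeomorphism $\operatorname{Int}(D_\lambda)\to e_\lambda$. A stellar stratified space is a space with a stratification and a stellar structure on each stratum, such that each $\partial e_\lambda$ is covered by strata indexed by $\{\mu\in P(X)\mid\mu<\lambda\}$. **CNSSS.** A CNSSS is a normal stellar stratified space equipped with a cylindrical structure, consisting of: a space $P_{\mu,\lambda}$ and a strict morphism of stratified spaces $b_{\mu,\lambda}:P_{\mu,\lambda}\times D_\mu\to\partial D_\lambda$ for each pair of strata $e_\mu\subset\partial e_\lambda$ (where $P_{\mu,\lambda}$ is regarded as having a single stratum), and a map $c_{\lambda_0,\lambda_1,\lambda_2}:P_{\lambda_1,\lambda_2}\times P_{\lambda_0,\lambda_1}\to P_{\lambda_0,\lambda_2}$ for each sequence $\overline{e_{\lambda_0}}\subset\overline{e_{\lambda_1}}\subset\overline{e_{\lambda_2}}$ (with $P_{\lambda,\lambda}$ a single point), such that (1) the restriction of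 $b_{\mu,\lambda}$ to $P_{\mu,\lambda}\times\operatorname{Int}(D_\mu)$ is a homeomorphism onto its image; (2) $\varphi_\lambda\circ b_{\mu,\lambda}=\varphi_\mu\circ\mathrm{pr}_2$; $b_{\lambda_1,\lambda_2}\circ(1\times b_{\lambda_0,\lambda_1})=b_{\lambda_0,\lambda_2}\circ(c_{\lambda_0,\lambda_1,\lambda_2}\times1)$; and $c_{\lambda_0,\lambda_1,\lambda_3}\circ(c_{\lambda_1,\lambda_2,\lambda_3}\times1)=c_{\lambda_0,\lambda_2,\lambda_3}\circ(1\times c_{\lambda_0,\lambda_1,\lambda_2})$; (3) $\partial D_\lambda=\bigcup_{e_\mu\subset\partial e_\lambda}b_{\mu,\lambda}(P_{\mu,\lambda}\times\operatorname{Int}(D_\mu))$ as a stratified space. **Conically stratified.** For a space $Y$ with a continuous map $Y\to\Lambda$, the open cone $\mathrm{cone}^\circ(Y)$ (the open subset $t<1$ of $\{*\}\star Y$, with $\mathrm{cone}^\circ(\emptyset)=\{*\}$) is stratified by $\Lambda$ with a new minimum $*$ adjoined: the apex goes to $*$, other points $(1-t)*+ty$ go to the image of $y$. A stratified space $\pi:X\to P(X)$ is conically stratified if for each $x\in X$ there are a $P(X)_{>\pi(x)}$-stratified space $Y$ (in the sense of Lurie: a space with a continuous map to $P(X)_{>\pi(x)}=\{\lambda\in P(X)\mid\lambda>\pi(x)\}$), a space $Z$, and an open embedding $Z\times\mathrm{cone}^\circ(Y)\to X$ of $P(X)$-stratified spaces whose image contains $x$. Here $Z\times\mathrm{cone}^\circ(Y)$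 is stratified by the projection to $\mathrm{cone}^\circ(Y)$, with $*$ identified with $\pi(x)$. **Exit paths.** Let $\underline\Delta^n$ be the geometric $n$-simplex and $\pi_{[n]}:\underline\Delta^n\to[n]=\{0<\cdots<n\}$, $\pi_{[n]}(t_0,\dots,t_n)=\max\{i\mid t_i\ne0\}$. $\mathrm{Exit}(X)$ is the simplicial subset of $\mathrm{Sing}(X)$ consisting of those $\sigma:\underline\Delta^n\to X$ for which there is an order-preserving map $\alpha:[n]\to P(X)$ with $\pi_X\circ\sigma=\alpha\circ\pi_{[n]}$. A quasi-category is a simplicial set with fillers for all inner horns. *)

theory Defs
  imports "HOL-Homology.Homology"
begin

section \<open>Stratified spaces\<close>

text \<open>The open sets of the Alexandroff topology are the upward closed sets.\<close>

definition alexandroff :: "'l::order topology" where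
  "alexandroff = topology (\<lambda>U. \<forall>x\<in>U. \<forall>y. x \<le> y \<longrightarrow> y \<in> U)"

lemma openin_alexandroff: "openin alexandroff U \<longleftrightarrow> (\<forall>x\<in>U. \<forall>y. x \<le> y \<longrightarrow> y \<in> U)"
proof -
  have "istopology (\<lambda>U::'a set. \<forall>x\<in>U. \<forall>y. x \<le> y \<longrightarrow> y \<in> U)"
    unfolding istopology_def by blast
  then show ?thesis
    by (simp add: alexandroff_def)
qed

lemma topspace_alexandroff [simp]: "topspace alexandroff = UNIV"
  unfolding topspace_def openin_alexandroff by blast

definition face_poset :: "'x topology \<Rightarrow> ('x \<Rightarrow> 'l) \<Rightarrow> 'l set" where
  "face_poset X \<pi> = \<pi> ` topspace X"

definition stratum :: "'x topology \<Rightarrow> ('x \<Rightarrow> 'l) \<Rightarrow> 'l \<Rightarrow> 'x set" where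
  "stratum X \<pi> l = {x \<in> topspace X. \<pi> x = l}"

definition strata :: "'x topology \<Rightarrow> ('x \<Rightarrow> 'l) \<Rightarrow> 'x set set" where
  "strata X \<pi> = stratum X \<pi> ` face_poset X \<pi>"

definition stratum_closure :: "'x topology \<Rightarrow> ('x \<Rightarrow> 'l) \<Rightarrow> 'l \<Rightarrow> 'x set" where
  "stratum_closure X \<pi> l = X closure_of stratum X \<pi> l"

definition stratum_boundary :: "'x topology \<Rightarrow> ('x \<Rightarrow> 'l) \<Rightarrow> 'l \<Rightarrow> 'x set" where
  "stratum_boundary X \<pi> l = stratum_closure X \<pi> l - stratum X \<pi> l"

definition locally_closedin :: "'x topology \<Rightarrow> 'x set \<Rightarrow> bool" where
  "locally_closedin X A \<longleftrightarrow> (\<exists>U C. openin X U \<and> closedin X C \<and> A = U \<inter> C)"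

definition stratification :: "'x topology \<Rightarrow> ('x \<Rightarrow> 'l::order) \<Rightarrow> bool" where
  "stratification X \<pi> \<longleftrightarrow>
     continuous_map X alexandroff \<pi> \<and> open_map X alexandroff \<pi> \<and>
     (\<forall>l \<in> face_poset X \<pi>. connectedin X (stratum X \<pi> l) \<and> locally_closedin X (stratum X \<pi> l))"

definition normal_stratification :: "'x topology \<Rightarrow> ('x \<Rightarrow> 'l::order) \<Rightarrow> bool" where
  "normal_stratification X \<pi> \<longleftrightarrow> stratification X \<pi> \<and>
     (\<forall>l \<in> face_poset X \<pi>. \<forall>m \<in> face_poset X \<pi>.
        stratum X \<pi> m \<inter> stratum_closure X \<pi> l \<noteq> {} \<longrightarrow> stratum X \<pi> m \<subseteq> stratum_closure X \<pi> l)"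

text \<open>
  The following two predicates only express the compatibility of a map with the maps to the
  posets. They are also applied to closures of strata, asters and products \<open>P \<times> D\<close>, all with
  the restricted or projected map to the poset; such a map is not required to be a
  \<^const>\<open>stratification\<close> again. (A closure of a stratum is stratified by its own
  face poset, not by an open subset of the ambient poset.)
  The map \<open>g\<close> between the face posets is determined by \<open>f\<close>.
\<close>

definition strat_morphism ::
  "'x topology \<Rightarrow> ('x \<Rightarrow> 'l::order) \<Rightarrow> 'y topology \<Rightarrow> ('y \<Rightarrow> 'm::order) \<Rightarrow> ('x \<Rightarrow> 'y) \<Rightarrow> bool" where
  "strat_morphism X \<pi>X Y \<pi>Y f \<longleftrightarrow> continuous_map X Y f \<and>
     (\<exists>g. g \<in> face_poset X \<pi>X \<rightarrow> face_poset Y \<pi>Y \<and> mono_on (face_poset X \<pi>X) g \<and>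
          (\<forall>x \<in> topspace X. \<pi>Y (f x) = g (\<pi>X x)))"

definition strict_strat_morphism ::
  "'x topology \<Rightarrow> ('x \<Rightarrow> 'l::order) \<Rightarrow> 'y topology \<Rightarrow> ('y \<Rightarrow> 'm::order) \<Rightarrow> ('x \<Rightarrow> 'y) \<Rightarrow> bool" where
  "strict_strat_morphism X \<pi>X Y \<pi>Y f \<longleftrightarrow> continuous_map X Y f \<and>
     (\<exists>g. g \<in> face_poset X \<pi>X \<rightarrow> face_poset Y \<pi>Y \<and> mono_on (face_poset X \<pi>X) g \<and>
          (\<forall>x \<in> topspace X. \<pi>Y (f x) = g (\<pi>X x)) \<and>
          (\<forall>l \<in> face_poset X \<pi>X. f ` stratum X \<pi>X l = stratum Y \<pi>Y (g l)))"

section \<open>Cones and asters\<close>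

text \<open>
  \<open>None\<close> is the apex and \<open>Some (t, y)\<close>, \<open>0 < t \<le> 1\<close>, is the point \<open>(1 - t)* + ty\<close>.
\<close>

type_synonym 's cone_point = "(real \<times> 's) option"

definition cone_pt :: "real \<Rightarrow> 's \<Rightarrow> 's cone_point" where
  "cone_pt t y = (if t = 0 then None else Some (t, y))"

definition cone_carrier :: "'s topology \<Rightarrow> 's cone_point set" where
  "cone_carrier S = insert None (Some ` ({0<..1} \<times> topspace S))"

lemma cone_pt_in_cone_carrier:
  "t \<in> {0..1} \<Longrightarrow> y \<in> topspace S \<Longrightarrow> cone_pt t y \<in> cone_carrier S"
  by (cases "t = 0") (auto simp: cone_pt_def cone_carrier_def)

text \<open>The quotient topology from \<open>[0,1] \<times> S\<close>. For empty \<open>S\<close> this is the one-point space.\<close>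

definition cone_topology :: "'s topology \<Rightarrow> 's cone_point topology" where
  "cone_topology S = topology (\<lambda>U. U \<subseteq> cone_carrier S \<and>
     openin (prod_topology (top_of_set {0..1}) S)
       {z \<in> {0..1} \<times> topspace S. case_prod cone_pt z \<in> U})"

lemma openin_cone_topology:
  "openin (cone_topology S) U \<longleftrightarrow> U \<subseteq> cone_carrier S \<and>
     openin (prod_topology (top_of_set {0..1}) S)
       {z \<in> {0..1} \<times> topspace S. case_prod cone_pt z \<in> U}"
proof -
  let ?T = "prod_topology (top_of_set {0..1::real}) S"
  let ?Q = "\<lambda>U. {z \<in> {0..1} \<times> topspace S. case_prod cone_pt z \<in> U}"
  have "istopology (\<lambda>U. U \<subseteq> cone_carrier S \<and> openin ?T (?Q U))"
    unfolding istopology_def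
  proof (intro conjI allI impI)
    fix U V
    assume U: "U \<subseteq> cone_carrier S \<and> openin ?T (?Q U)"
      and V: "V \<subseteq> cone_carrier S \<and> openin ?T (?Q V)"
    then show "U \<inter> V \<subseteq> cone_carrier S"
      by blast
    have "?Q (U \<inter> V) = ?Q U \<inter> ?Q V"
      by blast
    then show "openin ?T (?Q (U \<inter> V))"
      using U V by (simp add: openin_Int)
  next
    fix K
    assume K: "\<forall>U\<in>K. U \<subseteq> cone_carrier S \<and> openin ?T (?Q U)"
    then show "\<Union>K \<subseteq> cone_carrier S"
      by blast
    have "?Q (\<Union>K) = \<Union>(?Q ` K)"
      by blast
    then show "openin ?T (?Q (\<Union>K))"
      using K by auto
  qed
  then show ?thesis
    unfolding cone_topology_def by simp
qed

lemma topspace_cone_topology [simp]: "topspace (cone_topology S) = cone_carrier S"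
proof -
  have "{z \<in> {0..1} \<times> topspace S. case_prod cone_pt z \<in> cone_carrier S} = {0..1} \<times> topspace S"
    by (auto simp: cone_pt_in_cone_carrier)
  then have "openin (cone_topology S) (cone_carrier S)"
    using openin_topspace[of "prod_topology (top_of_set {0..1::real}) S"]
    by (simp add: openin_cone_topology)
  then have "cone_carrier S \<subseteq> topspace (cone_topology S)"
    by (rule openin_subset)
  moreover have "topspace (cone_topology S) \<subseteq> cone_carrier S"
    using openin_topspace[of "cone_topology S"] unfolding openin_cone_topology by (rule conjunct1)
  ultimately show ?thesis
    by blast
qed

lemma quotient_map_cone_pt:
  assumes "topspace S \<noteq> {}"
  shows "quotient_map (prod_topology (top_of_set {0..1}) S) (cone_topology S) (case_prod cone_pt)"
proof -
  have "case_prod cone_pt ` ({0..1} \<times> topspace S) = cone_carrier S"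
  proof
    show "case_prod cone_pt ` ({0..1} \<times> topspace S) \<subseteq> cone_carrier S"
      by (auto simp: cone_pt_in_cone_carrier)
    show "cone_carrier S \<subseteq> case_prod cone_pt ` ({0..1} \<times> topspace S)"
    proof
      fix x assume x: "x \<in> cone_carrier S"
      obtain y0 where y0: "y0 \<in> topspace S"
        using assms by blast
      show "x \<in> case_prod cone_pt ` ({0..1} \<times> topspace S)"
      proof (cases x)
        case None
        with y0 show ?thesis
          by (intro image_eqI[where x = "(0, y0)"]) (auto simp: cone_pt_def)
      next
        case (Some z)
        with x show ?thesis
          by (intro image_eqI[where x = z]) (auto simp: cone_pt_def cone_carrier_def)
      qed
    qed
  qed
  then show ?thesis
    by (simp add: quotient_map_def openin_cone_topology)
qed

text \<open>
  The poset \<open>\<Lambda> \<times> {b < i} \<amalg> {*}\<close>; \<open>Base l\<close> is \<open>(l, b)\<close>, \<open>Inner l\<close> is \<open>(l, i)\<close>, \<open>Apex\<close> is \<open>*\<close>.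
\<close>

datatype 'l cone_index = Apex | Base 'l | Inner 'l

instantiation cone_index :: (order) order
begin

fun less_eq_cone_index :: "'a cone_index \<Rightarrow> 'a cone_index \<Rightarrow> bool" where
  "Apex \<le> Apex \<longleftrightarrow> True"
| "Apex \<le> Inner l \<longleftrightarrow> True"
| "Apex \<le> Base l \<longleftrightarrow> False"
| "Base l \<le> Apex \<longleftrightarrow> False"
| "Base l \<le> Base m \<longleftrightarrow> l \<le> m"
| "Base l \<le> Inner m \<longleftrightarrow> l \<le> m"
| "Inner l \<le> Apex \<longleftrightarrow> False"
| "Inner l \<le> Base m \<longleftrightarrow> False"
| "Inner l \<le> Inner m \<longleftrightarrow> l \<le> m"

definition less_cone_index :: "'a cone_index \<Rightarrow> 'a cone_index \<Rightarrow> bool" where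
  "less_cone_index x y \<longleftrightarrow> x \<le> y \<and> \<not> y \<le> x"

instance
proof
  fix x y z :: "'a cone_index"
  show "x < y \<longleftrightarrow> x \<le> y \<and> \<not> y \<le> x"
    by (rule less_cone_index_def)
  show "x \<le> x"
    by (cases x) auto
  show "x \<le> y \<Longrightarrow> y \<le> z \<Longrightarrow> x \<le> z"
    by (cases x; cases y; cases z) auto
  show "x \<le> y \<Longrightarrow> y \<le> x \<Longrightarrow> x = y"
    by (cases x; cases y) auto
qed

end

fun cone_strat :: "('s \<Rightarrow> 'l) \<Rightarrow> 's cone_point \<Rightarrow> 'l cone_index" where
  "cone_strat \<pi> None = Apex"
| "cone_strat \<pi> (Some (t, y)) = (if t = 1 then Base (\<pi> y) else Inner (\<pi> y))"

definition aster :: "'s topology \<Rightarrow> 's cone_point set \<Rightarrow> bool" where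
  "aster S D \<longleftrightarrow> D \<subseteq> cone_carrier S \<and>
     (\<forall>y \<in> topspace S. \<forall>t \<in> {0..1}. cone_pt t y \<in> D \<longrightarrow> (\<forall>t' \<in> {0..t}. cone_pt t' y \<in> D))"

definition aster_boundary :: "'s cone_point set \<Rightarrow> 's cone_point set" where
  "aster_boundary D = {x \<in> D. \<exists>y. x = Some (1, y)}"

definition aster_interior :: "'s cone_point set \<Rightarrow> 's cone_point set" where
  "aster_interior D = D - aster_boundary D"

section \<open>Cylindrically normal stellar stratified spaces\<close>

definition stellar_structure ::
  "'x topology \<Rightarrow> ('x \<Rightarrow> 'l::order) \<Rightarrow> 'l \<Rightarrow> 's topology \<Rightarrow> ('s \<Rightarrow> 'm::order) \<Rightarrow>
   's cone_point set \<Rightarrow> ('s cone_point \<Rightarrow> 'x) \<Rightarrow> bool" where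
  "stellar_structure X \<pi> l S \<pi>S D \<phi> \<longleftrightarrow>
     stratification S \<pi>S \<and> aster S D \<and>
     strat_morphism (subtopology (cone_topology S) D) (cone_strat \<pi>S)
       (subtopology X (stratum_closure X \<pi> l)) \<pi> \<phi> \<and>
     quotient_map (subtopology (cone_topology S) D) (subtopology X (stratum_closure X \<pi> l)) \<phi> \<and>
     homeomorphic_map (subtopology (cone_topology S) (aster_interior D))
       (subtopology X (stratum X \<pi> l)) \<phi>"

text \<open>
  The spaces \<open>S l\<close> may all be taken over one type, and stratified by one poset type: a family
  of posets embeds into its disjoint union, each member being open and closed in it.
\<close>

locale stellar_stratified_space =
  fixes X :: "'x topology"
    and \<pi> :: "'x \<Rightarrow> 'l::order"
    and S :: "'l \<Rightarrow> 's topology"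
    and \<pi>S :: "'l \<Rightarrow> 's \<Rightarrow> 'm::order"
    and D :: "'l \<Rightarrow> 's cone_point set"
    and \<phi> :: "'l \<Rightarrow> 's cone_point \<Rightarrow> 'x"
  assumes stratified: "stratification X \<pi>"
    and stellar: "\<And>l. l \<in> face_poset X \<pi> \<Longrightarrow> stellar_structure X \<pi> l (S l) (\<pi>S l) (D l) (\<phi> l)"
    and boundary_covered: "\<And>l. l \<in> face_poset X \<pi> \<Longrightarrow>
      stratum_boundary X \<pi> l \<subseteq> (\<Union>m \<in> {m \<in> face_poset X \<pi>. m < l}. stratum X \<pi> m)"

definition bd_pair :: "'x topology \<Rightarrow> ('x \<Rightarrow> 'l) \<Rightarrow> 'l \<Rightarrow> 'l \<Rightarrow> bool" where
  "bd_pair X \<pi> m l \<longleftrightarrow> m \<in> face_poset X \<pi> \<and> l \<in> face_poset X \<pi> \<and>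
     stratum X \<pi> m \<subseteq> stratum_boundary X \<pi> l"

definition cl_pair :: "'x topology \<Rightarrow> ('x \<Rightarrow> 'l) \<Rightarrow> 'l \<Rightarrow> 'l \<Rightarrow> bool" where
  "cl_pair X \<pi> m l \<longleftrightarrow> m \<in> face_poset X \<pi> \<and> l \<in> face_poset X \<pi> \<and>
     stratum_closure X \<pi> m \<subseteq> stratum_closure X \<pi> l"

text \<open>
  \<open>P m l\<close>, \<open>b m l\<close> and \<open>c l0 l1 l2\<close> are \<open>P\<^bsub>m,l\<^esub>\<close>, \<open>b\<^bsub>m,l\<^esub>\<close> and \<open>c\<^bsub>l0,l1,l2\<^esub>\<close>. The parameter space
  \<open>P m l\<close> counts as one stratum, so that \<open>P m l \<times> D m\<close> is stratified through its second
  projection. No \<open>b l l\<close> is part of the structure, hence the laws involving \<open>b\<close> refer to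
  \<^const>\<open>bd_pair\<close> and the others to \<^const>\<open>cl_pair\<close>. The assumptions \<open>boundary_union\<close> and
  \<open>boundary_strata\<close> together express that the boundary of \<open>D l\<close> is the union of the images as
  a stratified space.
\<close>

locale cnsss = stellar_stratified_space X \<pi> S \<pi>S D \<phi>
  for X :: "'x topology"
    and \<pi> :: "'x \<Rightarrow> 'l::order"
    and S :: "'l \<Rightarrow> 's topology"
    and \<pi>S :: "'l \<Rightarrow> 's \<Rightarrow> 'm::order"
    and D :: "'l \<Rightarrow> 's cone_point set"
    and \<phi> :: "'l \<Rightarrow> 's cone_point \<Rightarrow> 'x" +
  fixes P :: "'l \<Rightarrow> 'l \<Rightarrow> 'p topology"
    and b :: "'l \<Rightarrow> 'l \<Rightarrow> 'p \<times> 's cone_point \<Rightarrow> 's cone_point"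
    and c :: "'l \<Rightarrow> 'l \<Rightarrow> 'l \<Rightarrow> 'p \<times> 'p \<Rightarrow> 'p"
  assumes normal: "normal_stratification X \<pi>"
    and b_morphism: "\<And>m l. bd_pair X \<pi> m l \<Longrightarrow>
      strict_strat_morphism
        (prod_topology (P m l) (subtopology (cone_topology (S m)) (D m)))
        (\<lambda>z. cone_strat (\<pi>S m) (snd z))
        (subtopology (cone_topology (S l)) (aster_boundary (D l)))
        (cone_strat (\<pi>S l))
        (b m l)"
    and P_refl: "\<And>l. l \<in> face_poset X \<pi> \<Longrightarrow> \<exists>p. topspace (P l l) = {p}"
    and c_continuous: "\<And>l0 l1 l2. cl_pair X \<pi> l0 l1 \<Longrightarrow> cl_pair X \<pi> l1 l2 \<Longrightarrow>
      continuous_map (prod_topology (P l1 l2) (P l0 l1)) (P l0 l2) (c l0 l1 l2)"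
    and b_homeo: "\<And>m l. bd_pair X \<pi> m l \<Longrightarrow>
      embedding_map
        (prod_topology (P m l) (subtopology (cone_topology (S m)) (aster_interior (D m))))
        (subtopology (cone_topology (S l)) (aster_boundary (D l)))
        (b m l)"
    and \<phi>_b: "\<And>m l p x. bd_pair X \<pi> m l \<Longrightarrow> p \<in> topspace (P m l) \<Longrightarrow> x \<in> D m \<Longrightarrow>
      \<phi> l (b m l (p, x)) = \<phi> m x"
    and b_b: "\<And>l0 l1 l2 p q x. bd_pair X \<pi> l0 l1 \<Longrightarrow> bd_pair X \<pi> l1 l2 \<Longrightarrow>
      p \<in> topspace (P l1 l2) \<Longrightarrow> q \<in> topspace (P l0 l1) \<Longrightarrow> x \<in> D l0 \<Longrightarrow>
      b l1 l2 (p, b l0 l1 (q, x)) = b l0 l2 (c l0 l1 l2 (p, q), x)"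
    and c_assoc: "\<And>l0 l1 l2 l3 p q r.
      cl_pair X \<pi> l0 l1 \<Longrightarrow> cl_pair X \<pi> l1 l2 \<Longrightarrow> cl_pair X \<pi> l2 l3 \<Longrightarrow>
      p \<in> topspace (P l2 l3) \<Longrightarrow> q \<in> topspace (P l1 l2) \<Longrightarrow> r \<in> topspace (P l0 l1) \<Longrightarrow>
      c l0 l1 l3 (c l1 l2 l3 (p, q), r) = c l0 l2 l3 (p, c l0 l1 l2 (q, r))"
    and boundary_union: "\<And>l. l \<in> face_poset X \<pi> \<Longrightarrow>
      aster_boundary (D l) =
        (\<Union>m \<in> {m. bd_pair X \<pi> m l}. b m l ` (topspace (P m l) \<times> aster_interior (D m)))"
    and boundary_strata: "\<And>l. l \<in> face_poset X \<pi> \<Longrightarrow>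
      strata (subtopology (cone_topology (S l)) (aster_boundary (D l))) (cone_strat (\<pi>S l)) =
        (\<Union>m \<in> {m. bd_pair X \<pi> m l}. (\<lambda>E. b m l ` (topspace (P m l) \<times> E)) `
           strata (subtopology (cone_topology (S m)) (aster_interior (D m))) (cone_strat (\<pi>S m)))"

section \<open>CW complexes\<close>

text \<open>
  \<open>unit_sphere n\<close> is the sphere of dimension \<open>n - 1\<close> bounding \<open>unit_disk n\<close>; it is empty for \<open>n = 0\<close>.
\<close>

definition unit_disk :: "nat \<Rightarrow> (nat \<Rightarrow> real) topology" where
  "unit_disk n = subtopology (Euclidean_space n) {x. (\<Sum>i<n. (x i)\<^sup>2) \<le> 1}"

definition unit_open_disk :: "nat \<Rightarrow> (nat \<Rightarrow> real) topology" where
  "unit_open_disk n = subtopology (Euclidean_space n) {x. (\<Sum>i<n. (x i)\<^sup>2) < 1}"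

definition unit_sphere :: "nat \<Rightarrow> (nat \<Rightarrow> real) topology" where
  "unit_sphere n = subtopology (Euclidean_space n) {x. (\<Sum>i<n. (x i)\<^sup>2) = 1}"

definition open_cell :: "('i \<Rightarrow> nat) \<Rightarrow> ('i \<Rightarrow> (nat \<Rightarrow> real) \<Rightarrow> 'x) \<Rightarrow> 'i \<Rightarrow> 'x set" where
  "open_cell n \<Phi> i = \<Phi> i ` topspace (unit_open_disk (n i))"

text \<open>
  \<open>X\<close> is a CW complex with cells indexed by \<open>I\<close>, cell \<open>i\<close> having dimension \<open>n i\<close> and characteristic
  map \<open>\<Phi> i\<close> (cf. Hatcher, Algebraic Topology, Proposition A.2).
\<close>

definition CW_complex ::
  "'x topology \<Rightarrow> 'i set \<Rightarrow> ('i \<Rightarrow> nat) \<Rightarrow> ('i \<Rightarrow> (nat \<Rightarrow> real) \<Rightarrow> 'x) \<Rightarrow> bool" where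
  "CW_complex X I n \<Phi> \<longleftrightarrow>
     Hausdorff_space X \<and>
     (\<forall>i\<in>I. continuous_map (unit_disk (n i)) X (\<Phi> i) \<and>
            homeomorphic_map (unit_open_disk (n i)) (subtopology X (open_cell n \<Phi> i)) (\<Phi> i)) \<and>
     disjoint_family_on (open_cell n \<Phi>) I \<and>
     (\<Union>i\<in>I. open_cell n \<Phi> i) = topspace X \<and>
     (\<forall>i\<in>I. \<exists>J. finite J \<and> J \<subseteq> {j\<in>I. n j < n i} \<and>
            \<Phi> i ` topspace (unit_sphere (n i)) \<subseteq> (\<Union>j\<in>J. open_cell n \<Phi> j)) \<and>
     (\<forall>A. A \<subseteq> topspace X \<longrightarrow>
            (closedin X A \<longleftrightarrow> (\<forall>i\<in>I. closedin X (A \<inter> X closure_of open_cell n \<Phi> i))))"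

definition finite_CW_complex ::
  "'x topology \<Rightarrow> 'i set \<Rightarrow> ('i \<Rightarrow> nat) \<Rightarrow> ('i \<Rightarrow> (nat \<Rightarrow> real) \<Rightarrow> 'x) \<Rightarrow> bool" where
  "finite_CW_complex X I n \<Phi> \<longleftrightarrow> CW_complex X I n \<Phi> \<and> finite I"

text \<open>The identification of the cone on the unit sphere with the unit disk.\<close>

fun cone_to_disk :: "(nat \<Rightarrow> real) cone_point \<Rightarrow> (nat \<Rightarrow> real)" where
  "cone_to_disk None = (\<lambda>i. 0)"
| "cone_to_disk (Some (t, y)) = (\<lambda>i. t * y i)"

text \<open>
  The strata are the open cells, indexed by the face poset, and the stellar structure of a cell
  is its characteristic map on the whole cone of its boundary sphere.
\<close>

definition CW_cnsss_structure ::
  "'x topology \<Rightarrow> 'l set \<Rightarrow> ('l \<Rightarrow> nat) \<Rightarrow> ('l \<Rightarrow> (nat \<Rightarrow> real) \<Rightarrow> 'x) \<Rightarrow>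
   ('x \<Rightarrow> 'l::order) \<Rightarrow> ('l \<Rightarrow> (nat \<Rightarrow> real) \<Rightarrow> 'm::order) \<Rightarrow>
   ('l \<Rightarrow> 'l \<Rightarrow> 'p topology) \<Rightarrow>
   ('l \<Rightarrow> 'l \<Rightarrow> 'p \<times> (nat \<Rightarrow> real) cone_point \<Rightarrow> (nat \<Rightarrow> real) cone_point) \<Rightarrow>
   ('l \<Rightarrow> 'l \<Rightarrow> 'l \<Rightarrow> 'p \<times> 'p \<Rightarrow> 'p) \<Rightarrow> bool" where
  "CW_cnsss_structure X I n \<Phi> \<pi> \<pi>S P b c \<longleftrightarrow>
     I = face_poset X \<pi> \<and>
     (\<forall>l\<in>I. stratum X \<pi> l = open_cell n \<Phi> l) \<and>
     cnsss X \<pi> (\<lambda>l. unit_sphere (n l)) \<pi>S (\<lambda>l. cone_carrier (unit_sphere (n l)))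
       (\<lambda>l. \<Phi> l \<circ> cone_to_disk) P b c"

section \<open>Conically stratified spaces\<close>

definition open_cone :: "'s topology \<Rightarrow> 's cone_point topology" where
  "open_cone Y = subtopology (cone_topology Y) {x. \<forall>t y. x = Some (t, y) \<longrightarrow> t < 1}"

fun open_cone_strat :: "'l \<Rightarrow> ('s \<Rightarrow> 'l) \<Rightarrow> 's cone_point \<Rightarrow> 'l" where
  "open_cone_strat l \<rho> None = l"
| "open_cone_strat l \<rho> (Some (t, y)) = \<rho> y"

text \<open>
  Letting \<open>Y\<close> and \<open>Z\<close> range over topologies on the type of \<open>X\<close> is no restriction: as \<open>Z\<close> and
  the open cone are nonempty, the embedding makes both \<open>Y\<close> and \<open>Z\<close> inject into \<open>X\<close>.
\<close>

definition conically_stratified :: "'x topology \<Rightarrow> ('x \<Rightarrow> 'l::order) \<Rightarrow> bool" where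
  "conically_stratified X \<pi> \<longleftrightarrow>
     (\<forall>x \<in> topspace X. \<exists>(Y :: 'x topology) \<rho> (Z :: 'x topology) h.
        continuous_map Y (subtopology alexandroff {l \<in> face_poset X \<pi>. \<pi> x < l}) \<rho> \<and>
        embedding_map (prod_topology Z (open_cone Y)) X h \<and>
        open_map (prod_topology Z (open_cone Y)) X h \<and>
        (\<forall>z \<in> topspace Z. \<forall>w \<in> topspace (open_cone Y).
           \<pi> (h (z, w)) = open_cone_strat (\<pi> x) \<rho> w) \<and>
        x \<in> h ` topspace (prod_topology Z (open_cone Y)))"

section \<open>Simplicial sets and quasi-categories\<close>

text \<open>
  \<open>ord_maps m n\<close> consists of the order-preserving maps from \<open>[m]\<close> to \<open>[n]\<close>. A simplicial set \<open>K\<close>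
  has \<open>n\<close>-simplices \<open>simplices K n\<close>, and \<open>act K m n \<alpha>\<close> is the map \<open>K\<^sub>n \<rightarrow> K\<^sub>m\<close>
  induced by \<open>\<alpha> \<in> ord_maps m n\<close>.
\<close>

definition ord_maps :: "nat \<Rightarrow> nat \<Rightarrow> (nat \<Rightarrow> nat) set" where
  "ord_maps m n = {\<alpha> \<in> {..m} \<rightarrow>\<^sub>E {..n}. mono_on {..m} \<alpha>}"

record 'a sset =
  simplices :: "nat \<Rightarrow> 'a set"
  act :: "nat \<Rightarrow> nat \<Rightarrow> (nat \<Rightarrow> nat) \<Rightarrow> 'a \<Rightarrow> 'a"

definition simplicial_set :: "'a sset \<Rightarrow> bool" where
  "simplicial_set K \<longleftrightarrow>
     (\<forall>m n. \<forall>\<alpha> \<in> ord_maps m n. act K m n \<alpha> \<in> simplices K n \<rightarrow> simplices K m) \<and>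
     (\<forall>n. \<forall>x \<in> simplices K n. act K n n (\<lambda>i\<in>{..n}. i) x = x) \<and>
     (\<forall>l m n. \<forall>\<beta> \<in> ord_maps l m. \<forall>\<alpha> \<in> ord_maps m n. \<forall>x \<in> simplices K n.
        act K l n (compose {..l} \<alpha> \<beta>) x = act K l m \<beta> (act K m n \<alpha> x))"

definition simplicial_map :: "'a sset \<Rightarrow> 'b sset \<Rightarrow> (nat \<Rightarrow> 'a \<Rightarrow> 'b) \<Rightarrow> bool" where
  "simplicial_map K L F \<longleftrightarrow>
     (\<forall>n. F n \<in> simplices K n \<rightarrow> simplices L n) \<and>
     (\<forall>m n. \<forall>\<alpha> \<in> ord_maps m n. \<forall>x \<in> simplices K n.
        F m (act K m n \<alpha> x) = act L m n \<alpha> (F n x))"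

definition Delta :: "nat \<Rightarrow> (nat \<Rightarrow> nat) sset" where
  "Delta n = \<lparr>simplices = (\<lambda>m. ord_maps m n), act = (\<lambda>k m \<beta> \<alpha>. compose {..k} \<alpha> \<beta>)\<rparr>"

definition Horn :: "nat \<Rightarrow> nat \<Rightarrow> (nat \<Rightarrow> nat) sset" where
  "Horn n j = \<lparr>simplices = (\<lambda>m. {\<alpha> \<in> ord_maps m n. \<not> {..n} \<subseteq> insert j (\<alpha> ` {..m})}),
               act = (\<lambda>k m \<beta> \<alpha>. compose {..k} \<alpha> \<beta>)\<rparr>"

definition quasi_category :: "'a sset \<Rightarrow> bool" where
  "quasi_category K \<longleftrightarrow> simplicial_set K \<and>
     (\<forall>n j. 0 < j \<and> j < n \<longrightarrow>
        (\<forall>F. simplicial_map (Horn n j) K F \<longrightarrow>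
           (\<exists>G. simplicial_map (Delta n) K G \<and>
                (\<forall>m. \<forall>\<alpha> \<in> simplices (Horn n j) m. G m \<alpha> = F m \<alpha>))))"

section \<open>Exit paths\<close>

text \<open>The affine map of standard simplices given on vertices by \<open>\<alpha> \<in> ord_maps m n\<close>.\<close>

definition simplex_op :: "nat \<Rightarrow> (nat \<Rightarrow> nat) \<Rightarrow> (nat \<Rightarrow> real) \<Rightarrow> (nat \<Rightarrow> real)" where
  "simplex_op m \<alpha> t = (\<lambda>j. \<Sum>i \<in> {i \<in> {..m}. \<alpha> i = j}. t i)"

definition Sing :: "'x topology \<Rightarrow> ((nat \<Rightarrow> real) \<Rightarrow> 'x) sset" where
  "Sing X = \<lparr>simplices = (\<lambda>n. singular_simplex_set n X),
             act = (\<lambda>m n \<alpha> \<sigma>. restrict (\<sigma> \<circ> simplex_op m \<alpha>) (standard_simplex m))\<rparr>"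

definition simplex_strat :: "nat \<Rightarrow> (nat \<Rightarrow> real) \<Rightarrow> nat" where
  "simplex_strat n t = Max {i. i \<le> n \<and> t i \<noteq> 0}"

definition Exit :: "'x topology \<Rightarrow> ('x \<Rightarrow> 'l::order) \<Rightarrow> ((nat \<Rightarrow> real) \<Rightarrow> 'x) sset" where
  "Exit X \<pi> = \<lparr>simplices = (\<lambda>n. {\<sigma> \<in> simplices (Sing X) n.
                  \<exists>\<alpha>. \<alpha> \<in> {..n} \<rightarrow> face_poset X \<pi> \<and> mono_on {..n} \<alpha> \<and>
                      (\<forall>t \<in> standard_simplex n. \<pi> (\<sigma> t) = \<alpha> (simplex_strat n t))}),
               act = act (Sing X)\<rparr>"

end

theory Submission
  imports Defs "HOL-Analysis.Analysis"
begin

text \<open>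
  Conical charts. Near the rim, a point of the cone on the boundary sphere of a cell \<open>l\<close> has a
  radial coordinate and a rim point \<open>b m l (p, x)\<close> with \<open>x\<close> inside the cone of a smaller cell \<open>m\<close>;
  iterating, one arrives either at the centre of some cone or in the open cell \<open>k\<close>. The points of the
  second kind form an open neighbourhood of \<open>e\<^sub>k\<close>, and on it one can replace the final point of
  \<open>e\<^sub>k\<close> by any other one while rescaling all radial coordinates by a common factor. The laws for
  \<open>b\<close> and \<open>c\<close> say that this is independent of the way in which a point is described, and the
  parameter spaces being compact, continuity can be checked on the finitely many pieces. This gives
  an open set homeomorphic to \<open>e\<^sub>k \<times> cone\<^sup>\<circ>(Y)\<close>, where \<open>Y\<close> is the slice at height 1 over a point.

  Horns. The product structure of these neighbourhoods and the fact that the cells are absolute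
  extensors imply that a strata-preserving homotopy on a closed subset of a metric space extends,
  whatever the subset is (by descending through the strata, extending to thinner and thinner
  neighbourhoods). An inner horn of \<open>\<Delta>\<^sup>n\<close> at the vertex \<open>j\<close> is then filled away from the face on
  \<open>0, \<dots>, j - 1\<close>, since there the coordinates \<open>0, \<dots>, j - 1\<close> do not influence the stratum, and
  deforming them into the horn is a homotopy of the above kind. Restricting the filler to a thin
  neighbourhood of the horn, into which the whole simplex can be pushed, makes it continuous on the
  remaining face as well.
\<close>

section \<open>Proper covers and cones\<close>

text \<open>Both conclusions come from the same tubes: the charts use the rescaling of heights, the
  horns only the transport along a stratum at scale 1, so no general theorem on conically stratified
  spaces is invoked. A point of a tube may have several radial coordinates, one for each cone that
  it passes. A rescaling acts on all of them at once, and their maximum serves as the height because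
  it is continuous, is multiplied by the scale, and has compact sublevel sets over each point of the
  stratum. This compactness makes the quotient topology of the cone on the slice agree with that of
  the chart at the apex. The obstacle in filling horns is a loss of continuity at a closed set: an
  extension found over the upper strata need not approach the given homotopy at the next stratum,
  and a filler found away from a face need not approach the given map at that face. Both are met by
  restricting to points that are closer to some point with a prescribed value than to the closed
  set. That argument is metric, which is why the space is embedded into a countable product of
  lines.\<close>

text \<open>Finitely many closed maps covering \<open>Y\<close> determine its topology. Proper maps
  are asked for, and not just quotient maps, because they stay closed after restriction to the
  preimage of a subspace and after a product with the identity of a further space; both occur
  below.\<close>

lemma closedin_proper_cover:
  assumes I: "finite I" and q: "\<And>i. i \<in> I \<Longrightarrow> proper_map (K i) Y (q i)"
    and cover: "topspace Y \<subseteq> (\<Union>i\<in>I. q i ` topspace (K i))"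
    and A: "A \<subseteq> topspace Y" "\<And>i. i \<in> I \<Longrightarrow> closedin (K i) {x \<in> topspace (K i). q i x \<in> A}"
  shows "closedin Y A"
proof -
  have "A = (\<Union>i\<in>I. q i ` {x \<in> topspace (K i). q i x \<in> A})"
    using A(1) cover by blast
  moreover have "closedin Y (\<Union>i\<in>I. q i ` {x \<in> topspace (K i). q i x \<in> A})"
    using I A(2) q by (intro closedin_Union) (auto simp: proper_map_def closed_map_def)
  ultimately show ?thesis by simp
qed

lemma openin_proper_cover:
  assumes I: "finite I" and q: "\<And>i. i \<in> I \<Longrightarrow> proper_map (K i) Y (q i)"
    and cover: "topspace Y \<subseteq> (\<Union>i\<in>I. q i ` topspace (K i))"
    and A: "A \<subseteq> topspace Y" "\<And>i. i \<in> I \<Longrightarrow> openin (K i) {x \<in> topspace (K i). q i x \<in> A}"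
  shows "openin Y A"
proof -
  have "closedin Y (topspace Y - A)"
  proof (rule closedin_proper_cover[OF I q cover])
    fix i assume i: "i \<in> I"
    have "q i ` topspace (K i) \<subseteq> topspace Y"
      using q[OF i] closed_map_imp_subset_topspace unfolding proper_map_def by blast
    then have "{x \<in> topspace (K i). q i x \<in> topspace Y - A} = topspace (K i) - {x \<in> topspace (K i). q i x \<in> A}"
      by blast
    then show "closedin (K i) {x \<in> topspace (K i). q i x \<in> topspace Y - A}"
      using A(2)[OF i] by (simp add: closedin_diff)
  qed auto
  then show ?thesis using A(1) by (simp add: openin_closedin_eq)
qed

lemma continuous_map_proper_cover:
  assumes I: "finite I" and q: "\<And>i. i \<in> I \<Longrightarrow> proper_map (K i) Y (q i)"
    and cover: "topspace Y \<subseteq> (\<Union>i\<in>I. q i ` topspace (K i))"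
    and g: "\<And>i. i \<in> I \<Longrightarrow> continuous_map (K i) Z (\<lambda>x. g (q i x))"
  shows "continuous_map Y Z g"
  unfolding continuous_map_closedin
proof (intro conjI allI impI Pi_I)
  show "g y \<in> topspace Z" if y: "y \<in> topspace Y" for y
  proof -
    obtain i x where ix: "i \<in> I" "x \<in> topspace (K i)" "y = q i x" using cover y by blast
    then show ?thesis using continuous_map_image_subset_topspace[OF g[OF ix(1)]] by blast
  qed
  show "closedin Y {x \<in> topspace Y. g x \<in> C}" if C: "closedin Z C" for C
  proof (rule closedin_proper_cover[OF I q cover])
    fix i assume i: "i \<in> I"
    have "q i ` topspace (K i) \<subseteq> topspace Y"
      using q[OF i] closed_map_imp_subset_topspace unfolding proper_map_def by blast
    then have "{x \<in> topspace (K i). q i x \<in> {x \<in> topspace Y. g x \<in> C}} = {x \<in> topspace (K i). g (q i x) \<in> C}"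
      by blast
    then show "closedin (K i) {x \<in> topspace (K i). q i x \<in> {x \<in> topspace Y. g x \<in> C}}"
      using g[OF i] C by (simp add: continuous_map_closedin)
  qed auto
qed

lemma proper_map_closed_inclusion:
  assumes "closedin X S"
  shows "proper_map (subtopology X S) X (\<lambda>x. x)"
proof (rule closed_injective_imp_proper_map)
  show "closed_map (subtopology X S) X (\<lambda>x. x)"
    unfolding closed_map_def using closedin_closed_subtopology[OF assms] by simp
qed simp

section \<open>Cones: maps out of them, compactness, separation, neighbourhoods of the apex\<close>

lemma None_in_cone_carrier [simp]: "None \<in> cone_carrier S"
  by (simp add: cone_carrier_def)

lemma Some_in_cone_carrier: "Some (t, y) \<in> cone_carrier S \<longleftrightarrow> 0 < t \<and> t \<le> 1 \<and> y \<in> topspace S"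
  by (auto simp: cone_carrier_def)

lemma cone_carrierE:
  assumes "x \<in> cone_carrier S"
  obtains "x = None" | t y where "x = Some (t, y)" "0 < t" "t \<le> 1" "y \<in> topspace S"
  using assms by (auto simp: cone_carrier_def)

lemma continuous_map_cone_pt:
  "continuous_map (prod_topology (top_of_set {0..1}) S) (cone_topology S) (case_prod cone_pt)"
  by (auto simp: continuous_map_def openin_cone_topology cone_pt_in_cone_carrier)

lemma continuous_map_from_cone:
  assumes "f None \<in> topspace Y"
    and "continuous_map (prod_topology (top_of_set {0..1}) S) Y (\<lambda>z. f (case_prod cone_pt z))"
  shows "continuous_map (cone_topology S) Y f"
  unfolding continuous_map_def
proof (intro conjI allI impI)
  have "f x \<in> topspace Y" if "x \<in> cone_carrier S" for x
    using that
  proof (cases rule: cone_carrierE)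
    case (2 t y)
    then have "f (case_prod cone_pt (t, y)) \<in> topspace Y"
      using assms(2) unfolding continuous_map_def by (auto simp: Pi_iff)
    then show ?thesis using 2 by (simp add: cone_pt_def)
  qed (use assms(1) in simp)
  then show "f \<in> topspace (cone_topology S) \<rightarrow> topspace Y" by simp
  fix V assume V: "openin Y V"
  have "{z \<in> {0..1} \<times> topspace S. case_prod cone_pt z \<in> {x \<in> cone_carrier S. f x \<in> V}} =
     {z \<in> topspace (prod_topology (top_of_set {0..1::real}) S). f (case_prod cone_pt z) \<in> V}"
    by (auto simp: cone_pt_in_cone_carrier)
  then show "openin (cone_topology S) {x \<in> topspace (cone_topology S). f x \<in> V}"
    using openin_continuous_map_preimage[OF assms(2) V] by (auto simp: openin_cone_topology)
qed

definition cone_height :: "'s cone_point \<Rightarrow> real" where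
  "cone_height x = (case x of None \<Rightarrow> 0 | Some z \<Rightarrow> fst z)"

lemma cone_height_simps [simp]: "cone_height None = 0" "cone_height (Some (t, y)) = t" "cone_height (cone_pt t y) = t"
  by (auto simp: cone_height_def cone_pt_def)

lemma continuous_map_cone_height: "continuous_map (cone_topology S) euclideanreal cone_height"
proof (rule continuous_map_from_cone)
  have "continuous_map (prod_topology (top_of_set {0..1}) S) euclideanreal fst"
    by (rule continuous_map_compose[OF continuous_map_fst, unfolded o_def]) auto
  then show "continuous_map (prod_topology (top_of_set {0..1}) S) euclideanreal (\<lambda>z. cone_height (case_prod cone_pt z))"
    by (simp add: case_prod_unfold)
qed simp

lemma compact_space_cone:
  assumes "compact_space S"
  shows "compact_space (cone_topology S)"
proof -
  have "compact_space (prod_topology (top_of_set {0..1::real}) S)"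
    using assms by (simp add: compact_space_prod_topology compact_space_subtopology)
  then have "compactin (cone_topology S) (case_prod cone_pt ` ({0..1} \<times> topspace S))"
    using image_compactin[OF _ continuous_map_cone_pt[of S]] by (fastforce simp: compact_space_def)
  \<comment> \<open>The apex is added by hand, for it is not in the image of the cylinder if
    \<open>S\<close> is empty.\<close>
  moreover have "compactin (cone_topology S) {None}" by simp
  ultimately have "compactin (cone_topology S) (case_prod cone_pt ` ({0..1} \<times> topspace S) \<union> {None})"
    by (rule compactin_Un)
  moreover have "case_prod cone_pt ` ({0..1} \<times> topspace S) \<union> {None} = cone_carrier S"
  proof
    show "case_prod cone_pt ` ({0..1} \<times> topspace S) \<union> {None} \<subseteq> cone_carrier S"
      by (auto simp: cone_pt_in_cone_carrier)
    show "cone_carrier S \<subseteq> case_prod cone_pt ` ({0..1} \<times> topspace S) \<union> {None}"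
    proof
      fix x assume "x \<in> cone_carrier S"
      then show "x \<in> case_prod cone_pt ` ({0..1} \<times> topspace S) \<union> {None}"
      proof (cases rule: cone_carrierE)
        case (2 t y)
        then show ?thesis by (intro UnI1 image_eqI[of _ _ "(t, y)"]) (auto simp: cone_pt_def)
      qed simp
    qed
  qed
  ultimately show ?thesis by (simp add: compact_space_def)
qed

text \<open>Away from the apex the cone is a product: a set that avoids the apex is its own preimage
  in the cylinder.\<close>

lemma openin_cone_Some:
  assumes "openin (prod_topology (top_of_set {0<..1}) S) W"
  shows "openin (cone_topology S) (Some ` W)"
proof -
  have sub: "W \<subseteq> {0<..1} \<times> topspace S" using openin_subset[OF assms] by simp
  have "{z \<in> {0..1} \<times> topspace S. case_prod cone_pt z \<in> Some ` W} = W"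
    using sub by (auto simp: cone_pt_def split: if_splits)
  moreover have "openin (prod_topology (top_of_set {0..1}) S) W"
  proof (rule openin_trans_full)
    have "prod_topology (top_of_set {0<..1}) S = subtopology (prod_topology (top_of_set {0..1::real}) S) ({0<..1} \<times> topspace S)"
    proof -
      have "top_of_set {0<..1::real} = subtopology (top_of_set {0..1}) {0<..1}"
        by (simp add: subtopology_subtopology) (metis Int_absorb1 atLeastAtMost_iff greaterThanAtMost_iff less_imp_le subsetI)
      then show ?thesis by (simp add: prod_topology_subtopology(1) subtopology_Times[symmetric] subtopology_topspace)
    qed
    then show "openin (subtopology (prod_topology (top_of_set {0..1}) S) ({0<..1} \<times> topspace S)) W"
      using assms by simp
    have "openin (top_of_set {0..1::real}) {0<..1}"
    proof -
      have "{0<..1::real} = {0..1} \<inter> {0<..}" by auto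
      then show ?thesis by (metis open_greaterThan openin_open)
    qed
    then show "openin (prod_topology (top_of_set {0..1::real}) S) ({0<..1} \<times> topspace S)"
      unfolding openin_prod_Times_iff by blast
  qed
  ultimately show ?thesis
    using sub by (auto simp: openin_cone_topology cone_carrier_def)
qed

lemma continuous_map_Some:
  "continuous_map (prod_topology (top_of_set {0<..1}) S) (cone_topology S) Some"
proof -
  have "continuous_map (top_of_set {0<..1::real}) (top_of_set {0..1}) id"
    by (auto simp: continuous_map_in_subtopology intro: continuous_map_from_subtopology)
  then have "continuous_map (prod_topology (top_of_set {0<..1::real}) S) (prod_topology (top_of_set {0..1}) S) (\<lambda>(t, y). (id t, id y))"
    unfolding continuous_map_prod_top by simp
  then have "continuous_map (prod_topology (top_of_set {0<..1}) S) (cone_topology S) (case_prod cone_pt \<circ> (\<lambda>(t, y). (id t, id y)))"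
    using continuous_map_cone_pt by (rule continuous_map_compose)
  then show ?thesis
    by (rule continuous_map_eq) (auto simp: cone_pt_def)
qed

lemma continuous_map_the:
  "continuous_map (subtopology (cone_topology S) (cone_carrier S - {None})) (prod_topology (top_of_set {0<..1}) S) the"
  unfolding continuous_map_def
proof (intro conjI allI impI)
  show "the \<in> topspace (subtopology (cone_topology S) (cone_carrier S - {None})) \<rightarrow>
      topspace (prod_topology (top_of_set {0<..1}) S)"
    by (auto simp: cone_carrier_def)
  fix W assume W: "openin (prod_topology (top_of_set {0<..1::real}) S) W"
  have "{x \<in> topspace (subtopology (cone_topology S) (cone_carrier S - {None})). the x \<in> W} = Some ` W"
    using openin_subset[OF W] by (force simp: cone_carrier_def)
  then show "openin (subtopology (cone_topology S) (cone_carrier S - {None}))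
     {x \<in> topspace (subtopology (cone_topology S) (cone_carrier S - {None})). the x \<in> W}"
    using openin_cone_Some[OF W] openin_subset[OF openin_cone_Some[OF W]]
    by (simp add: openin_subtopology_Int2 openin_subset_topspace_eq openin_open_subtopology openin_subtopology) blast
qed

text \<open>Points at different heights are separated by the height function. Different points at
  the same height are off the apex and differ in the base, so the open cylinders over disjoint open
  sets separate them.\<close>

lemma Hausdorff_space_cone:
  assumes "Hausdorff_space S"
  shows "Hausdorff_space (cone_topology S)"
  unfolding Hausdorff_space_def
proof (intro allI impI)
  have height: "\<exists>U V. openin (cone_topology S) U \<and> openin (cone_topology S) V \<and> x \<in> U \<and> y \<in> V \<and> disjnt U V"
    if xy: "x \<in> cone_carrier S" "y \<in> cone_carrier S" "cone_height x \<noteq> cone_height y" for x y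
  proof -
    obtain A B where AB: "open A" "open B" "cone_height x \<in> A" "cone_height y \<in> B" "A \<inter> B = {}"
      using hausdorff[OF xy(3)] by blast
    let ?p = "\<lambda>A. {z \<in> topspace (cone_topology S). cone_height z \<in> A}"
    have "openin (cone_topology S) (?p A)" "openin (cone_topology S) (?p B)"
      using AB openin_continuous_map_preimage[OF continuous_map_cone_height, of _ S] by auto
    then show ?thesis
      using AB xy by (intro exI[of _ "?p A"] exI[of _ "?p B"]) (auto simp: disjnt_def)
  qed
  fix x y assume "x \<in> topspace (cone_topology S) \<and> y \<in> topspace (cone_topology S) \<and> x \<noteq> y"
  then have xy: "x \<in> cone_carrier S" "y \<in> cone_carrier S" "x \<noteq> y" by auto
  show "\<exists>U V. openin (cone_topology S) U \<and> openin (cone_topology S) V \<and> x \<in> U \<and> y \<in> V \<and> disjnt U V"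
  proof (cases "cone_height x = cone_height y")
    case True
    then obtain t u v where uv: "x = Some (t, u)" "y = Some (t, v)" "0 < t" "t \<le> 1" "u \<in> topspace S" "v \<in> topspace S" "u \<noteq> v"
      using xy by (elim cone_carrierE) auto
    then obtain A B where AB: "openin S A" "openin S B" "u \<in> A" "v \<in> B" "disjnt A B"
      using assms unfolding Hausdorff_space_def by metis
    have "openin (cone_topology S) (Some ` ({0<..1} \<times> A))" "openin (cone_topology S) (Some ` ({0<..1} \<times> B))"
      using AB by (auto intro!: openin_cone_Some simp: openin_prod_Times_iff)
    then show ?thesis
      using AB uv by (intro exI[of _ "Some ` ({0<..1} \<times> A)"] exI[of _ "Some ` ({0<..1} \<times> B)"]) (auto simp: disjnt_def)
  qed (use height xy in blast)
qed

text \<open>The tube lemma along the bottom of the cylinder. For a compact base, small height alone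
  forces a point to be near the apex; the continuity of the inverse chart at the stratum rests on
  this.\<close>

lemma openin_cone_apex:
  assumes S: "compact_space S" and W: "openin (cone_topology S) W" "None \<in> W"
  obtains \<epsilon> where "0 < \<epsilon>" "\<And>x. x \<in> cone_carrier S \<Longrightarrow> cone_height x < \<epsilon> \<Longrightarrow> x \<in> W"
proof -
  let ?Q = "{z \<in> {0..1} \<times> topspace S. case_prod cone_pt z \<in> W}"
  have Q: "openin (prod_topology (top_of_set {0..1}) S) ?Q"
    using W(1) by (simp add: openin_cone_topology)
  have 0: "compactin (top_of_set {0..1::real}) {0}" by simp
  have TS: "compactin S (topspace S)" using S by (simp add: compact_space_def)
  have sub: "{0} \<times> topspace S \<subseteq> ?Q" using W(2) by (auto simp: cone_pt_def)
  obtain A B where AB: "openin (top_of_set {0..1::real}) A" "openin S B" "{0} \<subseteq> A" "topspace S \<subseteq> B" "A \<times> B \<subseteq> ?Q"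
    by (rule Wallace_theorem_prod_topology[OF 0 TS Q sub])
  have "\<exists>e>0. \<forall>x'\<in>{0..1}. dist x' 0 < e \<longrightarrow> x' \<in> A"
    using AB(1,3) unfolding openin_euclidean_subtopology_iff by blast
  then obtain e where e: "e > 0" "\<And>t. t \<in> {0..1} \<Longrightarrow> dist t 0 < e \<Longrightarrow> t \<in> A" by blast
  show thesis
  proof (rule that[OF e(1)])
    fix x assume x: "x \<in> cone_carrier S" "cone_height x < e"
    from x(1) show "x \<in> W"
    proof (cases rule: cone_carrierE)
      case (2 t y)
      then have "t \<in> A" using e(2)[of t] x(2) by (auto simp: dist_real_def)
      then have "(t, y) \<in> ?Q" using AB(4,5) 2 by blast
      then show ?thesis using 2 by (simp add: cone_pt_def)
    qed (use W in simp)
  qed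
qed

lemma aster_boundary_cone: "aster_boundary (cone_carrier S) = Some ` ({1} \<times> topspace S)"
  by (auto simp: aster_boundary_def cone_carrier_def)

lemma aster_interior_cone: "aster_interior (cone_carrier S) = {x \<in> cone_carrier S. cone_height x < 1}"
  by (auto simp: aster_interior_def aster_boundary_def cone_carrier_def cone_height_def)

lemma openin_aster_interior: "openin (cone_topology S) (aster_interior (cone_carrier S))"
  unfolding aster_interior_cone
  using openin_continuous_map_preimage[OF continuous_map_cone_height, of "{..<1}" S] by simp

lemma closedin_aster_boundary: "closedin (cone_topology S) (aster_boundary (cone_carrier S))"
proof -
  have "aster_boundary (cone_carrier S) = topspace (cone_topology S) - aster_interior (cone_carrier S)"
    by (auto simp: aster_interior_def aster_boundary_def)
  then show ?thesis using closedin_diff[OF closedin_topspace openin_aster_interior[of S]] by simp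
qed

section \<open>Homotopy extension over stratified spaces\<close>

text \<open>The Tietze extension of an indicator function, clamped afterwards, so that the bounds
  hold everywhere and not only on \<open>U\<close>.\<close>

lemma Urysohn_metric:
  fixes A B U :: "'a::{metric_space,second_countable_topology} set"
  assumes "closedin (top_of_set U) A" "closedin (top_of_set U) B" "A \<inter> B = {}"
  obtains \<theta> :: "'a \<Rightarrow> real" where "continuous_on U \<theta>" "\<And>x. 0 \<le> \<theta> x \<and> \<theta> x \<le> 1"
    "\<And>x. x \<in> A \<Longrightarrow> \<theta> x = 0" "\<And>x. x \<in> B \<Longrightarrow> \<theta> x = 1"
proof -
  let ?f = "\<lambda>x. if x \<in> A then 0 else 1::real"
  have sub: "A \<subseteq> U" "B \<subseteq> U"
    using assms by (auto dest: closedin_imp_subset)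
  have "closedin (top_of_set (A \<union> B)) A" "closedin (top_of_set (A \<union> B)) B"
    using assms sub by (auto intro!: closedin_subset_trans[of U])
  then have "continuous_on (A \<union> B) ?f"
    using assms(3) by (intro continuous_on_cases_local) auto
  moreover have "closedin (top_of_set U) (A \<union> B)"
    using assms by blast
  ultimately obtain g where g: "continuous_on U g" "\<And>x. x \<in> A \<union> B \<Longrightarrow> g x = ?f x"
    using Tietze_unbounded[of "A \<union> B" ?f U] by metis
  show thesis
  proof (rule that[of "\<lambda>x. max 0 (min 1 (g x))"])
    show "continuous_on U (\<lambda>x. max 0 (min 1 (g x)))"
      using g(1) by (intro continuous_intros)
  qed (use g(2) assms(3) in auto)
qed

text \<open>Near \<open>K\<close> the map \<open>F\<close> may behave badly although it agrees with
  \<open>H\<close> on \<open>D - K\<close>. The cure is to keep only those \<open>x\<close> that are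
  closer to some \<open>x'\<close> in \<open>D - K\<close> than to \<open>K\<close>, and for which
  \<open>F x\<close> is closer to \<open>F x'\<close> than that distance. When \<open>x\<close>
  tends to a point of \<open>K\<close>, so does \<open>x'\<close>, and \<open>F x\<close> is forced
  towards \<open>F x' = H x'\<close>.\<close>

lemma thin_extension:
  fixes C :: "'a::metric_space set" and F H :: "'a \<Rightarrow> 'e::metric_space"
  assumes K: "closedin (top_of_set C) K" "K \<subseteq> D" and W: "openin (top_of_set C) W"
    and DW: "D - K \<subseteq> W" and WK: "W \<inter> K = {}"
    and F: "continuous_on W F" and H: "continuous_on D H" and FH: "\<And>x. x \<in> D - K \<Longrightarrow> F x = H x"
  obtains W' where "openin (top_of_set C) W'" "W' \<subseteq> W" "D - K \<subseteq> W'"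
    "continuous_on (W' \<union> K) (\<lambda>x. if x \<in> K then H x else F x)"
proof -
  \<comment> \<open>\<open>infdist\<close> to the empty set is 0, so for empty \<open>K\<close> the
    allowed deviation is set to 1.\<close>
  define e where "e x = (if K = {} then 1 else infdist x K)" for x
  have e_cont: "continuous_on A e" for A
    unfolding e_def by (cases "K = {}") (auto intro!: continuous_intros)
  have e_pos: "e x > 0" if "x \<in> W" for x
  proof (cases "K = {}")
    case False
    have "x \<notin> closure K"
    proof
      assume "x \<in> closure K"
      moreover have "x \<in> C"
        using that W openin_imp_subset by blast
      moreover obtain T where T: "closed T" "K = C \<inter> T"
        using K(1) by (auto simp: closedin_closed)
      ultimately have "x \<in> K"
        using closure_minimal[of K T] by auto
      with that WK show False by blast
    qed
    then show ?thesis
      using False infdist_nonneg[of x K] in_closure_iff_infdist_zero[of K x] by (auto simp: e_def less_le)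
  qed (auto simp: e_def)
  have e_le: "e x \<le> dist x a" if "a \<in> K" for x a
    using that by (auto simp: e_def infdist_le)
  define B where "B x' = {x \<in> W. dist x x' < e x \<and> dist (F x) (F x') < e x}" for x'
  define W' where "W' = (\<Union>x' \<in> D - K. B x')"
  have opB: "openin (top_of_set C) (B x')" for x'
  proof -
    have "openin (top_of_set W) (W \<inter> (\<lambda>x. e x - max (dist x x') (dist (F x) (F x'))) -` {0<..})"
      using F e_cont by (intro continuous_openin_preimage_gen continuous_intros) auto
    moreover have "W \<inter> (\<lambda>x. e x - max (dist x x') (dist (F x) (F x'))) -` {0<..} = B x'"
      by (auto simp: B_def)
    ultimately show ?thesis
      using W openin_trans by metis
  qed
  have 1: "openin (top_of_set C) W'"
    unfolding W'_def using opB by blast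
  have 2: "W' \<subseteq> W"
    by (auto simp: W'_def B_def)
  have 3: "D - K \<subseteq> W'"
  proof
    fix x assume x: "x \<in> D - K"
    then have "x \<in> B x" using e_pos[of x] DW by (auto simp: B_def)
    with x show "x \<in> W'" by (auto simp: W'_def)
  qed
  let ?G = "\<lambda>x. if x \<in> K then H x else F x"
  have "continuous_on (W' \<union> K) ?G"
  proof (rule continuous_on_iff[THEN iffD2], intro ballI allI impI)
    fix x0 and \<epsilon> :: real assume x0: "x0 \<in> W' \<union> K" and \<epsilon>: "0 < \<epsilon>"
    show "\<exists>d>0. \<forall>x'\<in>W' \<union> K. dist x' x0 < d \<longrightarrow> dist (?G x') (?G x0) < \<epsilon>"
    proof (cases "x0 \<in> K")
      case True
      then obtain \<delta> where \<delta>: "\<delta> > 0" "\<And>x. x \<in> D \<Longrightarrow> dist x x0 < \<delta> \<Longrightarrow> dist (H x) (H x0) < \<epsilon>/2"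
        using H K(2) \<epsilon> half_gt_zero unfolding continuous_on_iff by (metis subsetD)
      show ?thesis
      proof (intro exI conjI ballI impI)
        show "min (\<delta>/2) (\<epsilon>/2) > 0" using \<delta> \<epsilon> by auto
        fix x assume x: "x \<in> W' \<union> K" and d: "dist x x0 < min (\<delta>/2) (\<epsilon>/2)"
        show "dist (?G x) (?G x0) < \<epsilon>"
        proof (cases "x \<in> K")
          case xK: True
          then have "dist (H x) (H x0) < \<epsilon>/2"
            using \<delta> d K(2) by auto
          then show ?thesis using xK True \<epsilon> by auto
        next
          case xK: False
          then obtain x' where x': "x' \<in> D - K" "dist x x' < e x" "dist (F x) (F x') < e x"
            using x by (auto simp: W'_def B_def)
          have ex: "e x \<le> dist x x0" using e_le True by blast
          \<comment> \<open>Since \<open>x0\<close> is in \<open>K\<close>, \<open>e x\<close> is at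
            most the distance from \<open>x\<close> to \<open>x0\<close>. Hence \<open>x'\<close> is
            within twice that distance of \<open>x0\<close>, which explains the halves of \<delta>
            and \<epsilon>.\<close>
          have "dist x' x0 \<le> dist x x' + dist x x0"
            by (metis dist_commute dist_triangle)
          then have "dist (H x') (H x0) < \<epsilon>/2"
            using \<delta>(2)[of x'] x' ex d by auto
          moreover have "dist (F x) (F x') < \<epsilon>/2" using x' ex d by auto
          ultimately have "dist (F x) (H x0) < \<epsilon>"
            using dist_triangle[of "F x" "H x0" "F x'"] FH[OF x'(1)] by auto
          then show ?thesis using xK True by auto
        qed
      qed
    next
      case False
      then have "x0 \<in> W'" using x0 by auto
      then have "\<exists>d>0. \<forall>x'\<in>C. dist x' x0 < d \<longrightarrow> x' \<in> W'"
        using 1 unfolding openin_euclidean_subtopology_iff by blast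
      then obtain d1 where d1: "d1 > 0" "\<And>x'. x' \<in> C \<Longrightarrow> dist x' x0 < d1 \<Longrightarrow> x' \<in> W'" by blast
      obtain d2 where d2: "d2 > 0" "\<And>x'. x' \<in> W \<Longrightarrow> dist x' x0 < d2 \<Longrightarrow> dist (F x') (F x0) < \<epsilon>"
        using F \<epsilon> \<open>x0 \<in> W'\<close> 2 unfolding continuous_on_iff by (metis subsetD)
      have "W' \<union> K \<subseteq> C" using 1 K by (meson closedin_imp_subset le_sup_iff openin_imp_subset)
      then show ?thesis
      proof (intro exI[of _ "min d1 d2"] conjI ballI impI)
        fix x assume x: "x \<in> W' \<union> K" "dist x x0 < min d1 d2"
        then have "x \<in> W'" using d1(2) \<open>W' \<union> K \<subseteq> C\<close> by auto
        then have "x \<in> W" "x \<notin> K" using 2 WK by auto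
        then show "dist (?G x) (?G x0) < \<epsilon>" using d2(2) x False by simp
      qed (use d1 d2 in auto)
    qed
  qed
  with 1 2 3 show thesis using that by blast
qed

lemma open_tube:
  fixes C :: "'a::topological_space set" and J :: "'b::topological_space set"
  assumes "compact J" "openin (top_of_set (C \<times> J)) W"
  shows "openin (top_of_set C) {x \<in> C. {x} \<times> J \<subseteq> W}"
proof -
  have W: "openin (prod_topology (top_of_set C) (top_of_set J)) W"
    using assms(2) by simp
  show ?thesis
  proof (subst openin_subopen, intro ballI)
    fix x assume x: "x \<in> {x \<in> C. {x} \<times> J \<subseteq> W}"
    have J': "compactin (top_of_set J) J"
      using assms(1) by (simp add: compactin_subtopology)
    have x': "compactin (top_of_set C) {x}" "{x} \<times> J \<subseteq> W"
      using x by simp_all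
    obtain A B where AB: "openin (top_of_set C) A" "openin (top_of_set J) B" "{x} \<subseteq> A" "J \<subseteq> B" "A \<times> B \<subseteq> W"
      by (rule Wallace_theorem_prod_topology[OF x'(1) J' W x'(2)])
    have "A \<subseteq> C" using AB(1) by (rule openin_imp_subset)
    with AB have "openin (top_of_set C) A \<and> x \<in> A \<and> A \<subseteq> {x \<in> C. {x} \<times> J \<subseteq> W}"
      by blast
    then show "\<exists>T. openin (top_of_set C) T \<and> x \<in> T \<and> T \<subseteq> {x \<in> C. {x} \<times> J \<subseteq> W}" ..
  qed
qed

text \<open>On products the thin neighbourhood is merely an open subset of
  \<open>C \<times> J\<close>; compactness of \<open>J\<close> yields a neighbourhood of the form
  \<open>W' \<times> J\<close> inside it.\<close>

lemma thin_extension_param: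
  fixes C :: "'a::metric_space set" and J :: "'b::metric_space set" and F H :: "'a \<times> 'b \<Rightarrow> 'e::metric_space"
  assumes J: "compact J" 
    and K: "closedin (top_of_set C) K" "K \<subseteq> D" and W: "openin (top_of_set C) W"
    and DW: "D - K \<subseteq> W" and WK: "W \<inter> K = {}"
    and F: "continuous_on (W \<times> J) F" and H: "continuous_on (D \<times> J) H"
    and FH: "\<And>x s. x \<in> D - K \<Longrightarrow> s \<in> J \<Longrightarrow> F (x, s) = H (x, s)"
  obtains W' where "openin (top_of_set C) W'" "W' \<subseteq> W" "D - K \<subseteq> W'"
    "continuous_on ((W' \<union> K) \<times> J) (\<lambda>z. if fst z \<in> K then H z else F z)"
proof -
  obtain W'' where W'': "openin (top_of_set (C \<times> J)) W''" "W'' \<subseteq> W \<times> J" "D \<times> J - K \<times> J \<subseteq> W''"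
    "continuous_on (W'' \<union> K \<times> J) (\<lambda>x. if x \<in> K \<times> J then H x else F x)"
  proof (rule thin_extension[of "C \<times> J" "K \<times> J" "D \<times> J" "W \<times> J" F H])
    show "closedin (top_of_set (C \<times> J)) (K \<times> J)" using K by (simp add: closedin_Times)
    show "openin (top_of_set (C \<times> J)) (W \<times> J)" using W by (simp add: openin_Times)
  qed (use K DW WK F H FH in auto)
  let ?W = "{x \<in> C. {x} \<times> J \<subseteq> W''} \<inter> W"
  have CK: "D - K \<subseteq> C" using DW W openin_imp_subset by blast
  show thesis
  proof (rule that[of ?W])
    show "openin (top_of_set C) ?W"
      using open_tube[OF J W''(1)] W by blast
    show "D - K \<subseteq> ?W"
      using W''(3) CK DW by auto
    have "continuous_on ((?W \<union> K) \<times> J) (\<lambda>x. if x \<in> K \<times> J then H x else F x)"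
      by (rule continuous_on_subset[OF W''(4)]) auto
    then show "continuous_on ((?W \<union> K) \<times> J) (\<lambda>z. if fst z \<in> K then H z else F z)"
      by (rule continuous_on_eq) auto
  qed auto
qed

text \<open>The parameter \<open>\<tau>\<close> may oscillate arbitrarily on approaching
  \<open>K\<close>. This does no harm: over a point of \<open>K\<close> the map
  \<open>\<Gamma>\<close> ignores the parameter, and by compactness of \<open>J\<close> it nearly
  ignores it, uniformly, over nearby points. The lemma admits cut-off functions that exist only off
  \<open>K\<close>.\<close>

lemma continuous_on_bounded_param:
  fixes A :: "'a::metric_space set" and J :: "'b::metric_space set" and \<Gamma> :: "'a \<times> 'b \<Rightarrow> 'e::metric_space"
  assumes J: "compact J" and K: "closedin (top_of_set A) K"
    and \<tau>: "continuous_on (A - K) \<tau>"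
    and \<Gamma>: "continuous_on M \<Gamma>" and M: "\<And>a. a \<in> A \<Longrightarrow> (a, \<tau> a) \<in> M" "K \<times> J \<subseteq> M"
    and \<tau>J: "\<And>a. a \<in> A \<Longrightarrow> \<tau> a \<in> J"
    and const: "\<And>a t t'. a \<in> K \<Longrightarrow> t \<in> J \<Longrightarrow> t' \<in> J \<Longrightarrow> \<Gamma> (a, t) = \<Gamma> (a, t')"
  shows "continuous_on A (\<lambda>a. \<Gamma> (a, \<tau> a))"
  unfolding continuous_on_eq_continuous_within
proof
  fix a0 assume a0: "a0 \<in> A"
  show "continuous (at a0 within A) (\<lambda>a. \<Gamma> (a, \<tau> a))"
  proof (cases "a0 \<in> K")
    case False
    have "openin (top_of_set A) (A - K)" using K by (intro openin_diff) simp_all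
    then obtain T where T: "open T" "A - K = A \<inter> T" unfolding openin_open by blast
    have "at a0 within A = at a0 within (A - K)"
      by (rule at_within_nhd[of _ T]) (use T False a0 in auto)
    moreover have "continuous_on (A - K) (\<lambda>a. \<Gamma> (a, \<tau> a))"
      by (rule continuous_on_compose2[OF \<Gamma>]) (use \<tau> M in \<open>auto intro!: continuous_intros\<close>)
    ultimately show ?thesis
      using False a0 by (simp add: continuous_on_eq_continuous_within)
  next
    case True
    show ?thesis
      unfolding continuous_within tendsto_iff
    proof (intro allI impI)
      fix e :: real assume e: "e > 0"
      have "openin (top_of_set M) (M \<inter> \<Gamma> -` ball (\<Gamma> (a0, \<tau> a0)) e)"
        using \<Gamma> by (intro continuous_openin_preimage_gen) auto
      then obtain O' where O': "open O'" "M \<inter> \<Gamma> -` ball (\<Gamma> (a0, \<tau> a0)) e = M \<inter> O'"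
        unfolding openin_open by blast
      have "{a0} \<times> J \<subseteq> O'"
      proof
        fix z assume "z \<in> {a0} \<times> J"
        then obtain t where t: "z = (a0, t)" "t \<in> J" by blast
        have "\<Gamma> z = \<Gamma> (a0, \<tau> a0)"
          unfolding t(1) by (rule const[OF True t(2) \<tau>J[OF a0]])
        moreover have "z \<in> M" using M(2) True t by blast
        ultimately have "z \<in> M \<inter> \<Gamma> -` ball (\<Gamma> (a0, \<tau> a0)) e" using e by simp
        then show "z \<in> O'" unfolding O'(2) by (rule IntD2)
      qed
      then obtain X0 where X0: "a0 \<in> X0" "open X0" "X0 \<times> J \<subseteq> O'"
        using Elementary_Topology.tube_lemma[OF J O'(1)] by blast
      have "dist (\<Gamma> (a, \<tau> a)) (\<Gamma> (a0, \<tau> a0)) < e" if "a \<in> X0" "a \<in> A" for a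
      proof -
        have "(a, \<tau> a) \<in> M \<inter> O'" using that M(1) \<tau>J X0(3) by blast
        then have "(a, \<tau> a) \<in> \<Gamma> -` ball (\<Gamma> (a0, \<tau> a0)) e" using O'(2) by blast
        then show ?thesis by (simp add: dist_commute)
      qed
      then show "\<forall>\<^sub>F a in at a0 within A. dist (\<Gamma> (a, \<tau> a)) (\<Gamma> (a0, \<tau> a0)) < e"
        unfolding eventually_at_topological using X0 by blast
    qed
  qed
qed

section \<open>Absolute extensors, tubes in a metric space, and the extension of homotopies\<close>

text \<open>The test spaces are the subsets of a single type, named by the first argument, since a
  definition cannot quantify over types. Homotopies on a set of type \<open>'a\<close> are tested on
  \<open>'a \<times> real\<close>.\<close>

definition absolute_extensor :: "'a::topological_space itself \<Rightarrow> 'e::topological_space set \<Rightarrow> bool" where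
  "absolute_extensor _ A \<longleftrightarrow> (\<forall>(N::'a set) S f. closedin (top_of_set N) S \<and> continuous_on S f \<and> f ` S \<subseteq> A \<longrightarrow>
     (\<exists>g. continuous_on N g \<and> g ` N \<subseteq> A \<and> (\<forall>x\<in>S. g x = f x)))"

lemma absolute_extensorD:
  fixes N :: "'a::topological_space set"
  assumes "absolute_extensor TYPE('a) A" "closedin (top_of_set N) S" "continuous_on S f" "f ` S \<subseteq> A"
  obtains g where "continuous_on N g" "g ` N \<subseteq> A" "\<And>x. x \<in> S \<Longrightarrow> g x = f x"
proof -
  have "\<exists>g. continuous_on N g \<and> g ` N \<subseteq> A \<and> (\<forall>x\<in>S. g x = f x)"
    using assms(1)[unfolded absolute_extensor_def, rule_format, OF conjI[OF assms(2) conjI[OF assms(3,4)]]] .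
  then show thesis using that by blast
qed

text \<open>This is the part of a conical tube that homotopies need. \<open>T k (x, z)\<close> plays
  the role of \<open>x\<close> moved over the base point \<open>z\<close> with its radial part
  unchanged, so it stays in the stratum of \<open>x\<close>. In this way the base coordinate near a
  stratum can be prescribed freely.\<close>

locale stratified_tubes =
  fixes E :: "'e::metric_space set" and \<pi> :: "'e \<Rightarrow> 'l::order"
    and U :: "'l \<Rightarrow> 'e set" and r :: "'l \<Rightarrow> 'e \<Rightarrow> 'e" and T :: "'l \<Rightarrow> 'e \<times> 'e \<Rightarrow> 'e"
  assumes finite_strata: "finite (\<pi> ` E)"
    and upper_open: "\<And>\<Lambda>. \<Lambda> \<subseteq> \<pi> ` E \<Longrightarrow> (\<And>l m. l \<in> \<Lambda> \<Longrightarrow> m \<in> \<pi> ` E \<Longrightarrow> l \<le> m \<Longrightarrow> m \<in> \<Lambda>) \<Longrightarrow>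
      openin (top_of_set E) (E \<inter> \<pi> -` \<Lambda>)"
    and tube_open: "\<And>k. k \<in> \<pi> ` E \<Longrightarrow> openin (top_of_set E) (U k)"
    and stratum_in_tube: "\<And>x. x \<in> E \<Longrightarrow> x \<in> U (\<pi> x)"
    and r_cont: "\<And>k. k \<in> \<pi> ` E \<Longrightarrow> continuous_on (U k) (r k)"
    and r_in: "\<And>k x. k \<in> \<pi> ` E \<Longrightarrow> x \<in> U k \<Longrightarrow> r k x \<in> E \<inter> \<pi> -` {k}"
    and T_cont: "\<And>k. k \<in> \<pi> ` E \<Longrightarrow> continuous_on (U k \<times> (E \<inter> \<pi> -` {k})) (T k)"
    and T_in: "\<And>k x z. k \<in> \<pi> ` E \<Longrightarrow> x \<in> U k \<Longrightarrow> z \<in> E \<inter> \<pi> -` {k} \<Longrightarrow> T k (x, z) \<in> E \<and> \<pi> (T k (x, z)) = \<pi> x"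
    and T_r: "\<And>k x. k \<in> \<pi> ` E \<Longrightarrow> x \<in> U k \<Longrightarrow> T k (x, r k x) = x"
    and T_stratum: "\<And>k x z. x \<in> E \<inter> \<pi> -` {k} \<Longrightarrow> z \<in> E \<inter> \<pi> -` {k} \<Longrightarrow> T k (x, z) = z"
begin

lemma r_stratum: "x \<in> E \<inter> \<pi> -` {k} \<Longrightarrow> r k x = x"
proof -
  assume x: "x \<in> E \<inter> \<pi> -` {k}"
  then have "k \<in> \<pi> ` E" "x \<in> U k" using stratum_in_tube[of x] by auto
  then show ?thesis using T_r T_stratum[OF x r_in] by metis
qed

end

text \<open>\<open>g\<close> is the map at time 0, and \<open>H\<close> is a homotopy of its
  restriction to \<open>D\<close> each of whose tracks stays in one stratum. No collar or
  neighbourhood retraction of \<open>D\<close> is supposed; \<open>D\<close> is just closed.\<close>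

locale homotopy_extension = stratified_tubes E \<pi> U r T
  for E :: "'e::metric_space set" and \<pi> :: "'e \<Rightarrow> 'l::order" and U r T +
  fixes C D :: "'a::{metric_space,second_countable_topology} set" and g :: "'a \<Rightarrow> 'e" and H :: "'a \<times> real \<Rightarrow> 'e"
  assumes D_closed: "closedin (top_of_set C) D"
    and g_cont: "continuous_on C g" and g_in: "\<And>x. x \<in> C \<Longrightarrow> g x \<in> E"
    and H_cont: "continuous_on (D \<times> {0..1}) H"
    and H_in: "\<And>x s. x \<in> D \<Longrightarrow> s \<in> {0..1} \<Longrightarrow> H (x, s) \<in> E"
    and H_strat: "\<And>x s. x \<in> D \<Longrightarrow> s \<in> {0..1} \<Longrightarrow> \<pi> (H (x, s)) = \<pi> (g x)"
    and H_0: "\<And>x. x \<in> D \<Longrightarrow> H (x, 0) = g x"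
    and extensor: "\<And>k. k \<in> \<pi> ` E \<Longrightarrow> absolute_extensor TYPE('a \<times> real) (E \<inter> \<pi> -` {k})"
begin

text \<open>Only a neighbourhood \<open>W\<close> of the part of \<open>D\<close> over
  \<open>\<Lambda>\<close> is covered, and it may be thinned whenever a stratum is added. A cut-off
  in time makes up for this at the very end.\<close>

definition partial_extension :: "'l set \<Rightarrow> 'a set \<Rightarrow> ('a \<times> real \<Rightarrow> 'e) \<Rightarrow> bool" where
  "partial_extension \<Lambda> W F \<longleftrightarrow> openin (top_of_set C) W \<and> W \<subseteq> g -` \<pi> -` \<Lambda> \<and> D \<inter> g -` \<pi> -` \<Lambda> \<subseteq> W \<and>
     continuous_on (W \<times> {0..1}) F \<and> (\<forall>x\<in>W. F (x, 0) = g x) \<and>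
     (\<forall>x\<in>W. \<forall>s\<in>{0..1}. F (x, s) \<in> E \<and> \<pi> (F (x, s)) = \<pi> (g x)) \<and>
     (\<forall>x\<in>W \<inter> D. \<forall>s\<in>{0..1}. F (x, s) = H (x, s))"

definition upper_set :: "'l set \<Rightarrow> bool" where
  "upper_set \<Lambda> \<longleftrightarrow> \<Lambda> \<subseteq> \<pi> ` E \<and> (\<forall>l\<in>\<Lambda>. \<forall>m\<in>\<pi> ` E. l \<le> m \<longrightarrow> m \<in> \<Lambda>)"

lemma upper_set_remove:
  assumes \<Lambda>: "upper_set \<Lambda>" and i: "\<And>l. l \<in> \<Lambda> \<Longrightarrow> l \<le> i \<Longrightarrow> l = i"
  shows "upper_set (\<Lambda> - {i})"
  unfolding upper_set_def
proof (intro conjI ballI impI)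
  show "\<Lambda> - {i} \<subseteq> \<pi> ` E" using \<Lambda> by (auto simp: upper_set_def)
  fix l m assume l: "l \<in> \<Lambda> - {i}" and m: "m \<in> \<pi> ` E" "l \<le> m"
  then have "m \<in> \<Lambda>" using \<Lambda> by (auto simp: upper_set_def)
  moreover have "m \<noteq> i" using l m(2) i[of l] by auto
  ultimately show "m \<in> \<Lambda> - {i}" by simp
qed

lemma openin_preimage:
  assumes "upper_set \<Lambda>"
  shows "openin (top_of_set C) (C \<inter> g -` \<pi> -` \<Lambda>)"
proof -
  have "openin (top_of_set E) (E \<inter> \<pi> -` \<Lambda>)"
    using assms by (intro upper_open) (auto simp: upper_set_def)
  then have "openin (top_of_set C) (C \<inter> g -` (E \<inter> \<pi> -` \<Lambda>))"
    using g_in by (intro continuous_openin_preimage[OF g_cont, of E]) auto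
  moreover have "C \<inter> g -` (E \<inter> \<pi> -` \<Lambda>) = C \<inter> g -` \<pi> -` \<Lambda>"
    using g_in by auto
  ultimately show ?thesis by simp
qed

lemma D_subset: "D \<subseteq> C"
  using D_closed by (rule closedin_imp_subset)

text \<open>Near the new stratum the homotopy may be slowed down arbitrarily, because its base coordinate
  is prescribed independently, by \<open>z\<close> in the proof.\<close>

lemma partial_extension_step:
  assumes \<Lambda>: "upper_set \<Lambda>" and i: "i \<in> \<Lambda>" "\<And>l. l \<in> \<Lambda> \<Longrightarrow> l \<le> i \<Longrightarrow> l = i"
    and WF: "partial_extension (\<Lambda> - {i}) W F"
  shows "\<exists>W' F'. partial_extension \<Lambda> W' F'"
proof -
  let ?I = "{0..1::real}"
  let ?e = "E \<inter> \<pi> -` {i}"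
  have iE: "i \<in> \<pi> ` E" using \<Lambda> i(1) by (auto simp: upper_set_def)
  define C1 where "C1 = C \<inter> g -` \<pi> -` \<Lambda>"
  define C2 where "C2 = C \<inter> g -` \<pi> -` (\<Lambda> - {i})"
  \<comment> \<open>\<open>K\<close> is the part of \<open>D\<close> over the new stratum: the
    result has to be \<open>H\<close> there, while \<open>F\<close> gives no information.\<close>
  define K where "K = D \<inter> (C1 - C2)"
  define D1 where "D1 = D \<inter> C1"
  have "upper_set (\<Lambda> - {i})" by (rule upper_set_remove[OF \<Lambda> i(2)])
  then have opC2: "openin (top_of_set C) C2" unfolding C2_def by (rule openin_preimage)
  have opC1: "openin (top_of_set C) C1" unfolding C1_def by (rule openin_preimage[OF \<Lambda>])
  have C21: "C2 \<subseteq> C1" by (auto simp: C1_def C2_def)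
  have C1C: "C1 \<subseteq> C" by (auto simp: C1_def)
  have strat12: "\<pi> (g x) = i" if "x \<in> C1" "x \<notin> C2" for x using that by (auto simp: C1_def C2_def)
  have W: "openin (top_of_set C) W" "W \<subseteq> g -` \<pi> -` (\<Lambda> - {i})" "D \<inter> g -` \<pi> -` (\<Lambda> - {i}) \<subseteq> W"
    "continuous_on (W \<times> ?I) F" and F0: "\<And>x. x \<in> W \<Longrightarrow> F (x, 0) = g x"
    and FE: "\<And>x s. x \<in> W \<Longrightarrow> s \<in> ?I \<Longrightarrow> F (x, s) \<in> E \<and> \<pi> (F (x, s)) = \<pi> (g x)"
    and FH: "\<And>x s. x \<in> W \<Longrightarrow> x \<in> D \<Longrightarrow> s \<in> ?I \<Longrightarrow> F (x, s) = H (x, s)"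
    using WF unfolding partial_extension_def by blast+
  have WC2: "W \<subseteq> C2" using W(2) openin_imp_subset[OF W(1)] by (auto simp: C2_def)
  have clD1: "closedin (top_of_set C1) D1"
    unfolding D1_def using D_closed C1C by (auto simp: closedin_closed)
  have opC21: "openin (top_of_set C1) C2"
    by (rule openin_subset_trans[OF opC2 C21 C1C])
  have clK: "closedin (top_of_set C1) K"
  proof -
    have "K = D1 \<inter> (C1 - C2)" by (auto simp: K_def D1_def)
    moreover have "closedin (top_of_set C1) (C1 - C2)" by (rule closedin_diff[OF _ opC21]) simp
    ultimately show ?thesis using closedin_Int[OF clD1] by metis
  qed
  have KD1: "K \<subseteq> D1" by (auto simp: K_def D1_def)
  have Kstrat: "\<pi> (g x) = i" if "x \<in> K" for x using that strat12 by (auto simp: K_def)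
  have D1K: "D1 - K \<subseteq> W" using W(3) by (auto simp: D1_def K_def C2_def)
  have opW1: "openin (top_of_set C1) W"
    by (rule openin_subset_trans[OF W(1) subset_trans[OF WC2 C21] C1C])
  have WK: "W \<inter> K = {}" using WC2 by (auto simp: K_def)
  \<comment> \<open>After thinning, the old homotopy and \<open>H\<close> fit together continuously
    along \<open>K\<close>.\<close>
  define F1 where "F1 = (\<lambda>z. if fst z \<in> K then H z else F z)"
  obtain W1 where W1: "openin (top_of_set C1) W1" "W1 \<subseteq> W" "D1 - K \<subseteq> W1"
    "continuous_on ((W1 \<union> K) \<times> ?I) F1"
    unfolding F1_def
  proof (rule thin_extension_param[OF _ clK KD1 opW1 D1K WK W(4)])
    show "continuous_on (D1 \<times> ?I) H" by (rule continuous_on_subset[OF H_cont]) (auto simp: D1_def)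
    show "F (x, s) = H (x, s)" if "x \<in> D1 - K" "s \<in> ?I" for x s
      using that D1K by (intro FH) (auto simp: D1_def)
  qed auto
  have F1_0: "F1 (x, 0) = g x" if "x \<in> W1 \<union> K" for x
    using that F0[of x] W1(2) H_0[of x] by (auto simp: F1_def K_def)
  have F1_E: "F1 (x, s) \<in> E \<and> \<pi> (F1 (x, s)) = \<pi> (g x)" if "x \<in> W1 \<union> K" "s \<in> ?I" for x s
    using that FE[of x s] W1(2) H_in[of x s] H_strat[of x s] by (auto simp: F1_def K_def)
  have F1_H: "F1 (x, s) = H (x, s)" if "x \<in> W1 \<union> K" "x \<in> D" "s \<in> ?I" for x s
    using that FH[of x s] W1(2) by (auto simp: F1_def)
  have opCK: "openin (top_of_set C1) (C1 - K)" by (rule openin_diff[OF _ clK]) simp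
  have W1CK: "W1 \<subseteq> C1 - K" using W1(2) WK WC2 C21 by blast
  have "openin (top_of_set (C1 - K)) W1" by (rule openin_subset_trans[OF W1(1) W1CK]) blast
  then have cl0: "closedin (top_of_set (C1 - K)) ((C1 - K) - W1)" by (rule closedin_diff[rotated]) simp
  obtain T' where "closed T'" "D1 = C1 \<inter> T'" using clD1 unfolding closedin_closed by blast
  then have "D1 - K = (C1 - K) \<inter> T'" by blast
  then have cl1: "closedin (top_of_set (C1 - K)) (D1 - K)" using \<open>closed T'\<close> by (auto simp: closedin_closed)
  have disj: "((C1 - K) - W1) \<inter> (D1 - K) = {}" using W1(3) by blast
  \<comment> \<open>A Urysohn function on \<open>C1 - K\<close> only; it need not have a limit at
    \<open>K\<close>.\<close>
  obtain \<theta>0 :: "'a \<Rightarrow> real" where \<theta>0: "continuous_on (C1 - K) \<theta>0" "\<And>x. 0 \<le> \<theta>0 x \<and> \<theta>0 x \<le> 1"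
    "\<And>x. x \<in> (C1 - K) - W1 \<Longrightarrow> \<theta>0 x = 0" "\<And>x. x \<in> D1 - K \<Longrightarrow> \<theta>0 x = 1"
    by (rule Urysohn_metric[OF cl0 cl1 disj]) blast
  \<comment> \<open>The thresholds 1/3 and 2/3 leave room between \<open>V\<close>, where the
    homotopy keeps full speed, and the complement of \<open>V'\<close>, where it stands still.
    \<open>F1\<close> is available on all of \<open>V'\<close>.\<close>
  define \<theta> where "\<theta> x = max 0 (min 1 (3 * \<theta>0 x - 1))" for x
  have \<theta>_cont: "continuous_on (C1 - K) \<theta>" unfolding \<theta>_def using \<theta>0(1) by (intro continuous_intros)
  have \<theta>_I: "\<theta> x * s \<in> ?I" if "s \<in> ?I" for x s
    using that by (auto simp: \<theta>_def intro!: mult_le_one mult_nonneg_nonneg)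
  have super_closed: "closedin (top_of_set C1) ({x \<in> C1 - K. a \<le> \<theta>0 x} \<union> K)" for a
  proof -
    have "openin (top_of_set (C1 - K)) ((C1 - K) \<inter> \<theta>0 -` {..<a})"
      using \<theta>0(1) by (intro continuous_openin_preimage_gen) auto
    then have "openin (top_of_set C1) ((C1 - K) \<inter> \<theta>0 -` {..<a})"
      using opCK openin_trans by blast
    then have "closedin (top_of_set C1) (C1 - ((C1 - K) \<inter> \<theta>0 -` {..<a}))"
      by (intro closedin_diff) simp_all
    moreover have "C1 - ((C1 - K) \<inter> \<theta>0 -` {..<a}) = {x \<in> C1 - K. a \<le> \<theta>0 x} \<union> K"
      using closedin_imp_subset[OF clK] by auto
    ultimately show ?thesis by simp
  qed
  define V' where "V' = {x \<in> C1 - K. 1/3 \<le> \<theta>0 x} \<union> K"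
  define V where "V = {x \<in> C1 - K. 2/3 \<le> \<theta>0 x} \<union> K"
  define W2 where "W2 = {x \<in> C1 - K. 2/3 < \<theta>0 x}"
  have clV: "closedin (top_of_set C1) V" "closedin (top_of_set C1) V'"
    unfolding V_def V'_def by (rule super_closed)+
  have VV': "V \<subseteq> V'" by (auto simp: V_def V'_def)
  have V'W: "V' \<subseteq> W1 \<union> K" using \<theta>0(3) by (force simp: V'_def)
  have opW2: "openin (top_of_set C1) W2"
  proof -
    have "openin (top_of_set (C1 - K)) ((C1 - K) \<inter> \<theta>0 -` {2/3<..})"
      using \<theta>0(1) by (intro continuous_openin_preimage_gen) auto
    then have "openin (top_of_set C1) ((C1 - K) \<inter> \<theta>0 -` {2/3<..})"
      using opCK openin_trans by blast
    moreover have "(C1 - K) \<inter> \<theta>0 -` {2/3<..} = W2" by (auto simp: W2_def)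
    ultimately show ?thesis by simp
  qed
  have KC1: "K \<subseteq> C1" by (rule closedin_imp_subset[OF clK])
  have V'C1: "V' \<subseteq> C1" by (rule closedin_imp_subset[OF clV(2)])
  \<comment> \<open>\<open>F1\<close> is used at all times over \<open>V'\<close>, and
    \<open>g\<close> elsewhere at time 0. The domain \<open>M0\<close> contains every slowed point
    \<open>(x, \<theta> x * s)\<close> with \<open>x\<close> in \<open>C1\<close>.\<close>
  define F2 where "F2 = (\<lambda>z. if fst z \<in> V' then F1 z else g (fst z))"
  define M0 where "M0 = V' \<times> ?I \<union> C1 \<times> {0}"
  have F2_cont: "continuous_on M0 F2"
    unfolding M0_def F2_def
  proof (rule continuous_on_cases_local)
    have *: "V' \<times> ?I \<union> C1 \<times> {0} \<subseteq> C1 \<times> ?I" using V'C1 by auto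
    have "closedin (top_of_set (C1 \<times> ?I)) (V' \<times> ?I)" using clV by (simp add: closedin_Times)
    then show "closedin (top_of_set (V' \<times> ?I \<union> C1 \<times> {0})) (V' \<times> ?I)"
      by (rule closedin_subset_trans) (use * in auto)
    have "closedin (top_of_set (C1 \<times> ?I)) (C1 \<times> {0})" by (rule closedin_Times) (auto intro: closed_subset)
    then show "closedin (top_of_set (V' \<times> ?I \<union> C1 \<times> {0})) (C1 \<times> {0})"
      by (rule closedin_subset_trans) (use * in auto)
    show "continuous_on (V' \<times> ?I) F1"
      by (rule continuous_on_subset[OF W1(4)]) (use V'W in auto)
    show "continuous_on (C1 \<times> {0::real}) (\<lambda>z. g (fst z))"
      by (rule continuous_on_compose2[OF g_cont]) (use C1C in \<open>auto intro!: continuous_intros\<close>)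
    show "F1 z = g (fst z)" if "z \<in> V' \<times> ?I \<and> fst z \<notin> V' \<or> z \<in> C1 \<times> {0} \<and> fst z \<in> V'" for z
      using that F1_0[of "fst z"] V'W by (cases z) auto
  qed
  have F2_E: "F2 (x, t) \<in> E \<and> \<pi> (F2 (x, t)) = \<pi> (g x)" if "(x, t) \<in> M0" for x t
    using that F1_E[of x t] V'W C1C g_in by (auto simp: F2_def M0_def)
  have F2_0: "F2 (x, 0) = g x" if "x \<in> C1" for x
    using that F1_0[of x] V'W by (auto simp: F2_def)
  \<comment> \<open>\<open>N\<close> will be an open neighbourhood of \<open>K\<close> over which
    all values of \<open>F2\<close> on \<open>M0\<close> lie in the tube of \<open>i\<close>.
    Openness is the tube lemma for the time interval.\<close>
  define G where "G = {x \<in> V'. {x} \<times> ?I \<subseteq> (V' \<times> ?I) \<inter> F1 -` (U i)}"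
  define N where "N = (C1 \<inter> g -` U i) - (V' - G)"
  have opG: "openin (top_of_set V') G"
    unfolding G_def
  proof (rule open_tube)
    have "continuous_on (V' \<times> ?I) F1"
      by (rule continuous_on_subset[OF W1(4)]) (use V'W in auto)
    then show "openin (top_of_set (V' \<times> ?I)) ((V' \<times> ?I) \<inter> F1 -` (U i))"
      by (rule continuous_openin_preimage[OF _ _ tube_open[OF iE]]) (use F1_E V'W in auto)
  qed simp
  have opN: "openin (top_of_set C1) N"
    unfolding N_def
  proof (rule openin_diff)
    have "openin (top_of_set C1) (C1 \<inter> g -` U i)"
      by (rule continuous_openin_preimage[OF continuous_on_subset[OF g_cont C1C] _ tube_open[OF iE]])
        (use g_in C1C in auto)
    then show "openin (top_of_set C1) (C1 \<inter> g -` U i)" .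
    have "closedin (top_of_set V') (V' - G)" by (rule closedin_diff[OF _ opG]) simp
    then show "closedin (top_of_set C1) (V' - G)" using clV(2) closedin_trans by blast
  qed
  have NC1: "N \<subseteq> C1" by (auto simp: N_def)
  have KN: "K \<subseteq> N"
  proof
    fix x assume x: "x \<in> K"
    have "F1 (x, s) \<in> U i" if "s \<in> ?I" for s
      using F1_E[of x s] that x Kstrat[OF x] stratum_in_tube[of "F1 (x, s)"] by auto
    then have "x \<in> G" using x by (auto simp: G_def V'_def)
    moreover have "g x \<in> U i"
      using Kstrat[OF x] stratum_in_tube[of "g x"] g_in[of x] x KC1 C1C by auto
    ultimately show "x \<in> N" using x KC1 by (auto simp: N_def)
  qed
  have F2_U: "F2 (x, t) \<in> U i" if "(x, t) \<in> M0" "x \<in> N" for x t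
  proof (cases "x \<in> V'")
    case True
    then have "x \<in> G" using that by (auto simp: N_def)
    moreover have "t \<in> ?I" using that by (auto simp: M0_def)
    ultimately have "(x, t) \<in> F1 -` U i" unfolding G_def by blast
    then have "F1 (x, t) \<in> U i" by simp
    then show ?thesis using True by (simp add: F2_def)
  next
    case False
    then show ?thesis using that by (simp add: F2_def N_def)
  qed
  \<comment> \<open>The base coordinate is forced over \<open>V\<close>, where the result has to be
    \<open>F1\<close>, and at time 0. From this closed set it extends to all times over
    \<open>N\<close>, the stratum being an absolute extensor.\<close>
  define S where "S = (V \<inter> N) \<times> ?I \<union> N \<times> {0}"
  have SM0: "S \<subseteq> M0" using VV' NC1 by (auto simp: S_def M0_def)
  have SN: "fst y \<in> N" if "y \<in> S" for y using that by (auto simp: S_def)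
  have clS: "closedin (top_of_set (N \<times> ?I)) S"
    unfolding S_def
  proof (rule closedin_Un)
    have "closedin (top_of_set N) (V \<inter> N)" using clV(1) NC1 by (auto simp: closedin_closed)
    then show "closedin (top_of_set (N \<times> ?I)) ((V \<inter> N) \<times> ?I)" by (simp add: closedin_Times)
    show "closedin (top_of_set (N \<times> ?I)) (N \<times> {0})" by (rule closedin_Times) (auto intro: closed_subset)
  qed
  have z0_cont: "continuous_on S (\<lambda>y. r i (F2 y))"
    by (rule continuous_on_compose2[OF r_cont[OF iE] continuous_on_subset[OF F2_cont SM0]])
      (use F2_U SM0 SN in force)
  have z0_in: "(\<lambda>y. r i (F2 y)) ` S \<subseteq> ?e"
    using F2_U SM0 SN r_in[OF iE] by force
  obtain z where z: "continuous_on (N \<times> ?I) z" "z ` (N \<times> ?I) \<subseteq> ?e" "\<And>y. y \<in> S \<Longrightarrow> z y = r i (F2 y)"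
    by (rule absolute_extensorD[OF extensor[OF iE] clS z0_cont z0_in]) blast
  have F2_K: "F2 (x, s) = H (x, s)" if "x \<in> K" "s \<in> ?I" for x s
    using that by (auto simp: F2_def F1_def V'_def)
  have H_K: "H (x, s) \<in> ?e" if "x \<in> K" "s \<in> ?I" for x s
    using that H_in[of x s] H_strat[of x s] Kstrat[OF that(1)] by (auto simp: K_def)
  have z_K: "z (x, s) = H (x, s)" if "x \<in> K" "s \<in> ?I" for x s
  proof -
    have "(x, s) \<in> S" using that KN by (auto simp: S_def V_def)
    then show ?thesis using z(3) F2_K[OF that] r_stratum[OF H_K[OF that]] by simp
  qed
  have \<theta>M0: "(x, \<theta> x * s) \<in> M0" if "x \<in> C1" "s \<in> ?I" for x s
  proof (cases "x \<in> V'")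
    case True
    then show ?thesis using \<theta>_I[OF that(2)] by (auto simp: M0_def)
  next
    case False
    then have "\<theta> x = 0" using that by (auto simp: V'_def \<theta>_def)
    then show ?thesis using that by (auto simp: M0_def)
  qed
  \<comment> \<open>The radial part follows \<open>F2\<close> in slowed time, the base coordinate
    follows \<open>z\<close>. Over \<open>V - K\<close> the speed is 1 and \<open>z\<close> is the
    projection of \<open>F2\<close>, so nothing changes there. Over \<open>K\<close> a point of the
    stratum itself is transported, and the result is \<open>z\<close> whatever the time; so the
    missing limit of \<open>\<theta>\<close> is harmless.\<close>
  define F' where "F' = (\<lambda>y. T i (F2 (fst y, \<theta> (fst y) * snd y), z y))"
  have F'_cont: "continuous_on (N \<times> ?I) F'"
  proof -
    let ?M = "{w. fst w \<in> N \<times> ?I \<and> (fst (fst w), snd w) \<in> M0}"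
    let ?\<Gamma> = "\<lambda>w. T i (F2 (fst (fst w), snd w), z (fst w))"
    have "continuous_on (N \<times> ?I) (\<lambda>y. ?\<Gamma> (y, \<theta> (fst y) * snd y))"
    proof (rule continuous_on_bounded_param[where J = ?I and K = "K \<times> ?I" and M = ?M])
      show "closedin (top_of_set (N \<times> ?I)) (K \<times> ?I)"
        using closedin_subset_trans[OF clK KN NC1] by (simp add: closedin_Times)
      show "continuous_on (N \<times> ?I - K \<times> ?I) (\<lambda>y. \<theta> (fst y) * snd y)"
        by (intro continuous_intros continuous_on_compose2[OF \<theta>_cont]) (use NC1 in auto)
      show "continuous_on ?M ?\<Gamma>"
      proof (rule continuous_on_compose2[OF T_cont[OF iE]])
        show "continuous_on ?M (\<lambda>w. (F2 (fst (fst w), snd w), z (fst w)))"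
          by (intro continuous_intros continuous_on_compose2[OF F2_cont] continuous_on_compose2[OF z(1)]) auto
        show "(\<lambda>w. (F2 (fst (fst w), snd w), z (fst w))) ` ?M \<subseteq> U i \<times> ?e"
        proof (rule image_subsetI)
          fix w assume w: "w \<in> ?M"
          have "F2 (fst (fst w), snd w) \<in> U i" by (rule F2_U) (use w in auto)
          moreover have "fst w \<in> N \<times> ?I" using w by simp
          then have "z (fst w) \<in> ?e" by (rule subsetD[OF z(2) imageI])
          ultimately show "(F2 (fst (fst w), snd w), z (fst w)) \<in> U i \<times> ?e" by (rule SigmaI)
        qed
      qed
      show "(y, \<theta> (fst y) * snd y) \<in> ?M" if "y \<in> N \<times> ?I" for y
        using that \<theta>M0[of "fst y" "snd y"] NC1 by auto
      show "(K \<times> ?I) \<times> ?I \<subseteq> ?M" using KN by (auto simp: M0_def V'_def)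
      show "\<theta> (fst y) * snd y \<in> ?I" if "y \<in> N \<times> ?I" for y using that \<theta>_I[of "snd y" "fst y"] by auto
      show "?\<Gamma> (y, t) = ?\<Gamma> (y, t')" if y: "y \<in> K \<times> ?I" and t: "t \<in> ?I" "t' \<in> ?I" for y t t'
      proof -
        obtain x s where xs: "y = (x, s)" "x \<in> K" "s \<in> ?I" using y by blast
        have "T i (F2 (x, t), z (x, s)) = H (x, s)" if "t \<in> ?I" for t
          unfolding F2_K[OF xs(2) that] z_K[OF xs(2,3)] by (rule T_stratum[OF H_K[OF xs(2) that] H_K[OF xs(2,3)]])
        then show ?thesis using t xs(1) by simp
      qed
    qed simp
    then show ?thesis by (simp add: F'_def)
  qed
  have zN: "z (x, s) \<in> ?e" if "x \<in> N" "s \<in> ?I" for x s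
    by (rule subsetD[OF z(2) imageI[OF SigmaI[OF that]]])
  have F'_E: "F' (x, s) \<in> E \<and> \<pi> (F' (x, s)) = \<pi> (g x)" if "x \<in> N" "s \<in> ?I" for x s
  proof -
    have m: "(x, \<theta> x * s) \<in> M0" using that NC1 by (intro \<theta>M0) auto
    show ?thesis
      using T_in[OF iE F2_U[OF m that(1)] zN[OF that]] F2_E[OF m] by (simp add: F'_def)
  qed
  have F'_0: "F' (x, 0) = g x" if "x \<in> N" for x
  proof -
    have "x \<in> C1" "g x \<in> U i" using that by (auto simp: N_def)
    moreover have "z (x, 0) = r i (g x)" using z(3)[of "(x, 0)"] that F2_0[OF \<open>x \<in> C1\<close>] by (auto simp: S_def)
    ultimately show ?thesis using F2_0[of x] T_r[OF iE] by (simp add: F'_def)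
  qed
  have F'_V: "F' (x, s) = F1 (x, s)" if "x \<in> N" "x \<in> V" "x \<notin> K" "s \<in> ?I" for x s
  proof -
    have "\<theta> x = 1" using that by (auto simp: \<theta>_def V_def)
    moreover have "(x, s) \<in> S" using that by (auto simp: S_def)
    moreover have "F2 (x, s) = F1 (x, s)" using that VV' by (auto simp: F2_def)
    ultimately show ?thesis using z(3)[of "(x, s)"] T_r[OF iE F2_U[of x s]] SM0 that by (auto simp: F'_def)
  qed
  have F'_K: "F' (x, s) = H (x, s)" if "x \<in> K" "s \<in> ?I" for x s
  proof -
    have "F2 (x, \<theta> x * s) = H (x, \<theta> x * s)" by (rule F2_K[OF that(1) \<theta>_I[OF that(2)]])
    then show ?thesis
      using T_stratum[OF H_K[OF that(1) \<theta>_I[OF that(2), of x]] H_K[OF that]] z_K[OF that] by (simp add: F'_def)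
  qed
  have W2V: "W2 \<subseteq> V - K" by (auto simp: W2_def V_def)
  have DW2: "D1 - K \<subseteq> W2" using \<theta>0(4) by (auto simp: W2_def D1_def)
  \<comment> \<open>Outside \<open>N\<close> the old homotopy is kept, but only on the open set
    \<open>W2\<close>; as \<open>W2\<close> is contained in \<open>V - K\<close>, the two agree on
    the overlap.\<close>
  let ?F = "\<lambda>y. if fst y \<in> N then F' y else F1 y"
  have W2W1: "W2 \<subseteq> W1" using W2V VV' V'W by blast
  have "partial_extension \<Lambda> (N \<union> W2) ?F"
    unfolding partial_extension_def
  proof (intro conjI ballI)
    have NW: "openin (top_of_set C1) (N \<union> W2)" using opN opW2 by blast
    then show "openin (top_of_set C) (N \<union> W2)" using opC1 openin_trans by blast
    show "N \<union> W2 \<subseteq> g -` \<pi> -` \<Lambda>" using openin_imp_subset[OF NW] by (auto simp: C1_def)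
    show "D \<inter> g -` \<pi> -` \<Lambda> \<subseteq> N \<union> W2" using DW2 KN D_subset by (auto simp: D1_def C1_def)
    have eq: "(N \<union> W2) \<times> ?I = N \<times> ?I \<union> W2 \<times> ?I" by auto
    show "continuous_on ((N \<union> W2) \<times> ?I) ?F"
      unfolding eq
    proof (rule continuous_on_cases_local_open)
      have sub: "N \<times> ?I \<union> W2 \<times> ?I \<subseteq> C1 \<times> ?I" using NC1 by (auto simp: W2_def)
      have "openin (top_of_set (C1 \<times> ?I)) (N \<times> ?I)" using opN by (simp add: openin_Times)
      then show "openin (top_of_set (N \<times> ?I \<union> W2 \<times> ?I)) (N \<times> ?I)"
        by (rule openin_subset_trans) (use sub in auto)
      have "openin (top_of_set (C1 \<times> ?I)) (W2 \<times> ?I)" using opW2 by (simp add: openin_Times)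
      then show "openin (top_of_set (N \<times> ?I \<union> W2 \<times> ?I)) (W2 \<times> ?I)"
        by (rule openin_subset_trans) (use sub in auto)
      show "continuous_on (W2 \<times> ?I) F1" by (rule continuous_on_subset[OF W1(4)]) (use W2W1 in auto)
      show "F' y = F1 y" if "y \<in> N \<times> ?I \<and> fst y \<notin> N \<or> y \<in> W2 \<times> ?I \<and> fst y \<in> N" for y
        using that W2V F'_V[of "fst y" "snd y"] by (cases y) auto
    qed (rule F'_cont)
    show "?F (x, 0) = g x" if "x \<in> N \<union> W2" for x
      using that F'_0[of x] F1_0[of x] W2W1 by auto
    fix x s assume xs: "x \<in> N \<union> W2" "s \<in> ?I"
    show "?F (x, s) \<in> E" "\<pi> (?F (x, s)) = \<pi> (g x)"
      using xs F'_E[of x s] F1_E[of x s] W2W1 by auto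
  next
    fix x s assume xs: "x \<in> (N \<union> W2) \<inter> D" "s \<in> ?I"
    show "?F (x, s) = H (x, s)"
    proof (cases "x \<in> N")
      case True
      show ?thesis
      proof (cases "x \<in> K")
        case False
        then have "x \<in> D1 - K" using True xs NC1 by (auto simp: D1_def)
        then have "x \<in> W2" using DW2 by blast
        then have "x \<in> V" "x \<in> W1" using W2V W2W1 by blast+
        then show ?thesis using F'_V[OF True _ False xs(2)] F1_H[of x s] True xs by simp
      qed (use True F'_K xs in auto)
    next
      case False
      then show ?thesis using F1_H[of x s] xs W2W1 by auto
    qed
  qed
  then show ?thesis by blast
qed

text \<open>Induction on the number of strata in an upper set: a minimal one is taken away, which
  leaves an upper set, and is added back by the preceding step.\<close>

lemma partial_extension_exists:
  assumes "upper_set \<Lambda>"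
  shows "\<exists>W F. partial_extension \<Lambda> W F"
  using assms
proof (induction "card \<Lambda>" arbitrary: \<Lambda>)
  case 0
  then have "\<Lambda> = {}" using finite_subset[OF _ finite_strata] by (auto simp: upper_set_def)
  then show ?case by (auto simp: partial_extension_def intro!: exI[of _ "{}"])
next
  case (Suc n)
  have fin: "finite \<Lambda>" using Suc.prems finite_subset[OF _ finite_strata] by (auto simp: upper_set_def)
  moreover have "\<Lambda> \<noteq> {}" using Suc.hyps(2) by auto
  ultimately obtain i where i: "i \<in> \<Lambda>" "\<And>l. l \<in> \<Lambda> \<Longrightarrow> l \<le> i \<Longrightarrow> l = i"
    using finite_has_minimal[of \<Lambda>] by metis
  have "upper_set (\<Lambda> - {i})" by (rule upper_set_remove[OF Suc.prems i(2)])
  moreover have "n = card (\<Lambda> - {i})" using Suc.hyps(2) fin i(1) by simp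
  ultimately obtain W F where "partial_extension (\<Lambda> - {i}) W F" using Suc.hyps(1) by blast
  then show ?case using partial_extension_step[OF Suc.prems i] by blast
qed

text \<open>With all strata included, the partial extension lives on a neighbourhood of
  \<open>D\<close>. A Urysohn function that slows down time brings the homotopy to rest before it
  leaves that neighbourhood.\<close>

theorem stratified_homotopy_extension:
  obtains G where "continuous_on (C \<times> {0..1}) G" "\<And>x. x \<in> C \<Longrightarrow> G (x, 0) = g x"
    "\<And>x s. x \<in> D \<Longrightarrow> s \<in> {0..1} \<Longrightarrow> G (x, s) = H (x, s)"
    "\<And>x s. x \<in> C \<Longrightarrow> s \<in> {0..1} \<Longrightarrow> G (x, s) \<in> E \<and> \<pi> (G (x, s)) = \<pi> (g x)"
proof -
  let ?I = "{0..1::real}"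
  have "upper_set (\<pi> ` E)" by (auto simp: upper_set_def)
  then obtain W F where "partial_extension (\<pi> ` E) W F" using partial_extension_exists by blast
  moreover have "g x \<in> E" if "x \<in> D" for x using that D_subset g_in by blast
  ultimately have W: "openin (top_of_set C) W" "D \<subseteq> W" "continuous_on (W \<times> ?I) F"
    and F0: "\<And>x. x \<in> W \<Longrightarrow> F (x, 0) = g x"
    and FE: "\<And>x s. x \<in> W \<Longrightarrow> s \<in> ?I \<Longrightarrow> F (x, s) \<in> E \<and> \<pi> (F (x, s)) = \<pi> (g x)"
    and FH: "\<And>x s. x \<in> W \<Longrightarrow> x \<in> D \<Longrightarrow> s \<in> ?I \<Longrightarrow> F (x, s) = H (x, s)"
    unfolding partial_extension_def by blast+
  have "closedin (top_of_set C) (C - W)" using W(1) by (intro closedin_diff) simp_all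
  moreover have "(C - W) \<inter> D = {}" using W(2) by blast
  ultimately obtain \<theta>0 :: "'a \<Rightarrow> real" where \<theta>0: "continuous_on C \<theta>0" "\<And>x. 0 \<le> \<theta>0 x \<and> \<theta>0 x \<le> 1"
    "\<And>x. x \<in> C - W \<Longrightarrow> \<theta>0 x = 0" "\<And>x. x \<in> D \<Longrightarrow> \<theta>0 x = 1"
    by (rule Urysohn_metric[OF _ D_closed]) blast+
  \<comment> \<open>Zero as soon as \<open>\<theta>0\<close> is at most 1/2, so that the closed sets
    \<open>V\<close> and \<open>V0\<close> overlap only where the homotopy stands still.\<close>
  define \<theta> where "\<theta> x = max 0 (2 * \<theta>0 x - 1)" for x
  define V where "V = C \<inter> \<theta>0 -` {1/2..}"
  have clV: "closedin (top_of_set C) V"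
    unfolding V_def using \<theta>0(1) by (intro continuous_closedin_preimage) auto
  have VW: "V \<subseteq> W" using \<theta>0(3) by (force simp: V_def)
  have VC: "V \<subseteq> C" by (auto simp: V_def)
  define V0 where "V0 = C \<inter> \<theta>0 -` {..1/2}"
  have clV0: "closedin (top_of_set C) V0"
    unfolding V0_def using \<theta>0(1) by (intro continuous_closedin_preimage) auto
  have CV: "C = V \<union> V0" by (auto simp: V_def V0_def)
  have \<theta>_cont: "continuous_on C \<theta>" unfolding \<theta>_def using \<theta>0(1) by (intro continuous_intros)
  have \<theta>_01: "0 \<le> \<theta> x" "\<theta> x \<le> 1" for x using \<theta>0(2)[of x] by (auto simp: \<theta>_def)
  have \<theta>_I: "\<theta> x * s \<in> ?I" if "s \<in> ?I" for x s
    using that \<theta>_01[of x] by (auto intro!: mult_le_one mult_nonneg_nonneg)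
  let ?G = "\<lambda>y. if fst y \<in> V then F (fst y, \<theta> (fst y) * snd y) else g (fst y)"
  show thesis
  proof (rule that[of ?G])
    have eq: "C \<times> ?I = V \<times> ?I \<union> V0 \<times> ?I" using CV by auto
    show "continuous_on (C \<times> ?I) ?G"
      unfolding eq
    proof (rule continuous_on_cases_local)
      show "closedin (top_of_set (V \<times> ?I \<union> V0 \<times> ?I)) (V \<times> ?I)"
        "closedin (top_of_set (V \<times> ?I \<union> V0 \<times> ?I)) (V0 \<times> ?I)"
        using clV clV0 unfolding eq[symmetric] by (simp_all add: closedin_Times)
      show "continuous_on (V \<times> ?I) (\<lambda>y. F (fst y, \<theta> (fst y) * snd y))"
        by (intro continuous_on_compose2[OF W(3)] continuous_intros continuous_on_compose2[OF \<theta>_cont])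
          (use VW VC \<theta>_I in auto)
      show "continuous_on (V0 \<times> ?I) (\<lambda>y. g (fst y))"
        by (intro continuous_on_compose2[OF g_cont] continuous_intros) (auto simp: V0_def)
      show "F (fst y, \<theta> (fst y) * snd y) = g (fst y)"
        if "y \<in> V \<times> ?I \<and> fst y \<notin> V \<or> y \<in> V0 \<times> ?I \<and> fst y \<in> V" for y
      proof -
        from that have "fst y \<in> V" "\<theta>0 (fst y) = 1/2" by (auto simp: V_def V0_def)
        then have "\<theta> (fst y) = 0" by (simp add: \<theta>_def)
        then show ?thesis using F0 VW \<open>fst y \<in> V\<close> by auto
      qed
    qed
    show "?G (x, 0) = g x" if "x \<in> C" for x using F0[of x] VW by auto
    show "?G (x, s) = H (x, s)" if "x \<in> D" "s \<in> ?I" for x s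
    proof -
      have "\<theta> x = 1" "x \<in> V" using \<theta>0(4)[OF that(1)] that D_subset by (auto simp: \<theta>_def V_def)
      then show ?thesis using FH[of x s] W(2) that by auto
    qed
    show "?G (x, s) \<in> E \<and> \<pi> (?G (x, s)) = \<pi> (g x)" if "x \<in> C" "s \<in> ?I" for x s
      using that FE[of x "\<theta> x * s"] VW \<theta>_I[of s x] g_in[of x] by auto
  qed
qed

end

section \<open>Inner horns\<close>

lemma standard_simplex_iff:
  "t \<in> standard_simplex n \<longleftrightarrow> (\<forall>i. 0 \<le> t i) \<and> (\<forall>i>n. t i = 0) \<and> sum t {..n} = 1"
proof
  assume t: "(\<forall>i. 0 \<le> t i) \<and> (\<forall>i>n. t i = 0) \<and> sum t {..n} = 1"
  have "t i \<le> 1" for i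
  proof (cases "i \<le> n")
    case True
    then have "t i \<le> sum t {..n}" using t by (intro member_le_sum) auto
    then show ?thesis using t by simp
  qed (use t in auto)
  then show "t \<in> standard_simplex n" using t by (simp add: standard_simplex_def)
qed (simp add: standard_simplex_def)

lemma simplex_strat_eqI:
  assumes "p \<le> n" "t p \<noteq> 0" "\<And>i. p < i \<Longrightarrow> i \<le> n \<Longrightarrow> t i = 0"
  shows "simplex_strat n t = p"
  unfolding simplex_strat_def
  by (rule Max_eqI) (use assms not_le in auto)

lemma simplex_strat_props:
  assumes "t \<in> standard_simplex n"
  shows "simplex_strat n t \<le> n" "t (simplex_strat n t) \<noteq> 0" "\<And>i. simplex_strat n t < i \<Longrightarrow> t i = 0"
proof -
  have "{i. i \<le> n \<and> t i \<noteq> 0} \<noteq> {}"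
  proof
    assume "{i. i \<le> n \<and> t i \<noteq> 0} = {}"
    then have "sum t {..n} = 0" by (intro sum.neutral) auto
    then show False using assms by (simp add: standard_simplex_iff)
  qed
  then have "simplex_strat n t \<in> {i. i \<le> n \<and> t i \<noteq> 0}"
    unfolding simplex_strat_def by (intro Max_in) auto
  then show "simplex_strat n t \<le> n" "t (simplex_strat n t) \<noteq> 0" by auto
  fix i assume i: "simplex_strat n t < i"
  show "t i = 0"
  proof (rule ccontr)
    assume "t i \<noteq> 0"
    then have "i \<le> n" using assms by (metis standard_simplex_iff not_le)
    then have "i \<le> simplex_strat n t" unfolding simplex_strat_def using \<open>t i \<noteq> 0\<close> by (intro Max_ge) auto
    then show False using i by simp
  qed
qed

definition low :: "nat set \<Rightarrow> (nat \<Rightarrow> real) \<Rightarrow> real" where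
  "low S t = Min (t ` S)"

lemma continuous_on_low:
  assumes "finite S" "S \<noteq> {}"
  shows "continuous_on A (low S)"
  using assms
proof (induction rule: finite_ne_induct)
  case (singleton x)
  then show ?case by (simp add: low_def continuous_on_product_then_coordinatewise[OF continuous_on_id])
next
  case (insert x S)
  have "low (insert x S) = (\<lambda>t. min (t x) (low S t))"
  proof
    show "low (insert x S) t = min (t x) (low S t)" for t
      using insert(1,2) by (simp add: low_def)
  qed
  moreover have "continuous_on A (\<lambda>t. min (t x) (low S t))"
    by (intro continuous_intros insert continuous_on_product_then_coordinatewise[OF continuous_on_id])
  ultimately show ?case by simp
qed

lemma low_props:
  assumes "finite S" "S \<noteq> {}"
  shows "\<And>m. m \<in> S \<Longrightarrow> low S t \<le> t m" "\<exists>m\<in>S. t m = low S t"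
    and "(\<And>m. m \<in> S \<Longrightarrow> 0 \<le> t m) \<Longrightarrow> 0 \<le> low S t"
proof -
  show 1: "\<And>m. m \<in> S \<Longrightarrow> low S t \<le> t m" using assms by (auto simp: low_def)
  have "Min (t ` S) \<in> t ` S" using assms by (intro Min_in) auto
  then show 2: "\<exists>m\<in>S. t m = low S t" by (auto simp: low_def)
  show "0 \<le> low S t" if "\<And>m. m \<in> S \<Longrightarrow> 0 \<le> t m" using 2 that by metis
qed

text \<open>Moving towards the vertex \<open>j\<close> at the expense of the coordinates in \<open>S\<close>; at time \<open>a = 1\<close> the
  first of them vanishes.\<close>

definition push :: "nat set \<Rightarrow> nat \<Rightarrow> real \<Rightarrow> (nat \<Rightarrow> real) \<Rightarrow> nat \<Rightarrow> real" where
  "push S j a t = (\<lambda>m. if m \<in> S then t m - a * low S t else if m = j then t m + card S * (a * low S t) else t m)"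

lemma push_trivial: "low S t = 0 \<Longrightarrow> push S j a t = t"
  by (auto simp: push_def)

lemma push_0: "push S j 0 t = t"
  by (auto simp: push_def)

lemma continuous_on_push:
  assumes "finite S" "S \<noteq> {}"
  shows "continuous_on A (\<lambda>y. push S j (snd y) (fst y))"
proof (rule continuous_on_coordinatewise_then_product)
  fix m
  have l: "continuous_on A (\<lambda>y. low S (fst y))"
    by (rule continuous_on_compose2[OF continuous_on_low[OF assms, of UNIV] continuous_on_fst[OF continuous_on_id]]) simp
  have c: "continuous_on A (\<lambda>y. fst y m)"
    using continuous_on_product_then_coordinatewise[OF continuous_on_fst[OF continuous_on_id[of A]]] by simp
  show "continuous_on A (\<lambda>y. push S j (snd y) (fst y) m)"
    unfolding push_def using l c
    by (cases "m \<in> S"; cases "m = j"; simp;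
        intro continuous_on_diff continuous_on_add continuous_on_mult continuous_on_const continuous_on_snd continuous_on_id l c)
qed

text \<open>What is taken from the \<open>card S\<close> coordinates is put on \<open>j\<close>,
  which keeps the sum; and at most the minimum is subtracted, so no coordinate becomes
  negative.\<close>

lemma push_props:
  assumes S: "finite S" "S \<noteq> {}" "S \<subseteq> {..n}" "j \<le> n" "j \<notin> S" and t: "t \<in> standard_simplex n" and a: "a \<in> {0..1}"
  shows "push S j a t \<in> standard_simplex n"
    and "\<And>m. m \<in> S \<Longrightarrow> (1 - a) * low S t \<le> push S j a t m"
    and "t j + card S * (a * low S t) = push S j a t j"
    and "\<And>m. m \<notin> S \<Longrightarrow> m \<noteq> j \<Longrightarrow> push S j a t m = t m"
    and "\<exists>m\<in>S. push S j 1 t m = 0"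
    and "0 \<le> low S t"
proof -
  have t0: "0 \<le> t i" for i using t by (simp add: standard_simplex_iff)
  show low0: "0 \<le> low S t" using low_props(3)[OF S(1,2)] t0 by blast
  show ge: "(1 - a) * low S t \<le> push S j a t m" if "m \<in> S" for m
    using low_props(1)[OF S(1,2) that, of t] that by (simp add: push_def algebra_simps)
  show "t j + card S * (a * low S t) = push S j a t j" using S by (simp add: push_def)
  show oth: "push S j a t m = t m" if "m \<notin> S" "m \<noteq> j" for m using that by (simp add: push_def)
  show "\<exists>m\<in>S. push S j 1 t m = 0" using low_props(2)[OF S(1,2), of t] by (force simp: push_def)
  show "push S j a t \<in> standard_simplex n"
    unfolding standard_simplex_iff
  proof (intro conjI allI impI)
    fix i
    show "0 \<le> push S j a t i"
    proof (cases "i \<in> S")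
      case True
      have "0 \<le> (1 - a) * low S t" using a low0 by simp
      then show ?thesis using ge[OF True] by simp
    next
      case False
      then show ?thesis using t0[of i] a low0 by (auto simp: push_def)
    qed
    show "push S j a t i = 0" if "n < i"
      using that S t by (auto simp: push_def standard_simplex_iff)
  next
    have fin: "finite {..n}" by simp
    have split: "sum g {..n} = sum g S + (g j + sum g ({..n} - S - {j}))" for g :: "nat \<Rightarrow> real"
    proof -
      have "sum g {..n} = sum g S + sum g ({..n} - S)" using sum.subset_diff[OF S(3) fin, of g] by simp
      also have "sum g ({..n} - S) = g j + sum g ({..n} - S - {j})" using S by (intro sum.remove) auto
      finally show ?thesis .
    qed
    have "sum (push S j a t) S = sum t S - card S * (a * low S t)"
      by (simp add: push_def sum_subtractf)
    moreover have "push S j a t j = t j + card S * (a * low S t)" using S by (simp add: push_def)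
    moreover have "sum (push S j a t) ({..n} - S - {j}) = sum t ({..n} - S - {j})"
      by (rule sum.cong) (auto simp: push_def)
    ultimately have "sum (push S j a t) {..n} = sum t {..n}"
      using split[of "push S j a t"] split[of t] by simp
    then show "sum (push S j a t) {..n} = 1" using t by (simp add: standard_simplex_iff)
  qed
qed

definition horn :: "nat \<Rightarrow> nat \<Rightarrow> (nat \<Rightarrow> real) set" where
  "horn n j = {t \<in> standard_simplex n. \<exists>i\<le>n. i \<noteq> j \<and> t i = 0}"

lemma closed_standard_simplex: "closed (standard_simplex n)"
  using closedin_standard_simplex[of n] by (simp add: euclidean_product_topology)

lemma closed_coordinate_zero: "closed {t :: nat \<Rightarrow> real. t i = 0}"
  by (rule closed_Collect_eq) (auto intro: continuous_on_product_then_coordinatewise[OF continuous_on_id])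

lemma closed_horn: "closed (horn n j)"
proof -
  have "closed (standard_simplex n \<inter> (\<Union>i\<in>{..n} - {j}. {t. t i = 0}))"
    by (intro closed_Int closed_standard_simplex closed_UN ballI closed_coordinate_zero) simp
  moreover have "standard_simplex n \<inter> (\<Union>i\<in>{..n} - {j}. {t. t i = 0}) = horn n j"
    by (auto simp: horn_def)
  ultimately show ?thesis by simp
qed

context stratified_tubes
begin

text \<open>On \<open>\<Omega>\<close> the last nonzero coordinate has index at least
  \<open>j\<close>, and pushing the coordinates below \<open>j\<close> into \<open>j\<close> does
  not change that index. So \<open>f\<close> after the full push is defined on all of
  \<open>\<Omega>\<close> and lies in the right strata. On the horn it differs from
  \<open>f\<close>, but only by the homotopy of partial pushes; extending that homotopy repairs
  it.\<close>

lemma inner_horn_interior: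
  fixes f :: "(nat \<Rightarrow> real) \<Rightarrow> 'e"
  assumes j: "0 < j" "j < n"
    and f: "continuous_on (horn n j) f" "\<And>t. t \<in> horn n j \<Longrightarrow> f t \<in> E"
    and fA: "\<And>t. t \<in> horn n j \<Longrightarrow> \<pi> (f t) = A (simplex_strat n t)"
    and ext: "\<And>k. k \<in> \<pi> ` E \<Longrightarrow> absolute_extensor TYPE((nat \<Rightarrow> real) \<times> real) (E \<inter> \<pi> -` {k})"
  defines "\<Omega> \<equiv> {t \<in> standard_simplex n. j \<le> simplex_strat n t}"
  obtains G where "continuous_on \<Omega> G" "\<And>t. t \<in> horn n j \<inter> \<Omega> \<Longrightarrow> G t = f t"
    "\<And>t. t \<in> \<Omega> \<Longrightarrow> G t \<in> E \<and> \<pi> (G t) = A (simplex_strat n t)"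
proof -
  let ?S = "{..<j}"
  have S: "finite ?S" "?S \<noteq> {}" "?S \<subseteq> {..n}" "j \<le> n" "j \<notin> ?S" using j by auto
  note pp = push_props[OF S]
  have strat: "simplex_strat n (push ?S j a t) = simplex_strat n t"
    if t: "t \<in> \<Omega>" and a: "a \<in> {0..1}" for t a
  proof -
    have ts: "t \<in> standard_simplex n" "j \<le> simplex_strat n t" using t by (auto simp: \<Omega>_def)
    note sp = simplex_strat_props[OF ts(1)]
    show ?thesis
    proof (rule simplex_strat_eqI[OF sp(1)])
      show "push ?S j a t (simplex_strat n t) \<noteq> 0"
      proof (cases "simplex_strat n t = j")
        case True
        have "0 < t j" using sp(2) ts(1) unfolding True by (simp add: standard_simplex_iff less_le)
        moreover have "0 \<le> card ?S * (a * low ?S t)" using a pp(6)[OF ts(1) a] by (intro mult_nonneg_nonneg) auto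
        ultimately show ?thesis unfolding True using pp(3)[OF ts(1) a] by linarith
      next
        case False
        then show ?thesis using pp(4)[OF ts(1) a, of "simplex_strat n t"] sp(2) ts(2) by simp
      qed
      show "push ?S j a t i = 0" if "simplex_strat n t < i" "i \<le> n" for i
        using that sp(3)[OF that(1)] pp(4)[OF ts(1) a, of i] ts(2) by simp
    qed
  qed
  have \<Omega>s: "t \<in> standard_simplex n" if "t \<in> \<Omega>" for t using that by (simp add: \<Omega>_def)
  have horn1: "push ?S j 1 t \<in> horn n j" if t: "t \<in> \<Omega>" for t
  proof -
    obtain m where "m \<in> ?S" "push ?S j 1 t m = 0" using pp(5)[OF \<Omega>s[OF t], of 1] by auto
    then have "m \<le> n \<and> m \<noteq> j \<and> push ?S j 1 t m = 0" using j by auto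
    then show ?thesis using pp(1)[OF \<Omega>s[OF t], of 1] unfolding horn_def by auto
  qed
  \<comment> \<open>A horn point with a vanishing coordinate below \<open>j\<close> does not move at
    all; in the other case the vanishing coordinate is one that the push leaves alone.\<close>
  have horna: "push ?S j a t \<in> horn n j" if t: "t \<in> horn n j" and a: "a \<in> {0..1}" for t a
  proof -
    have ts: "t \<in> standard_simplex n" using t by (simp add: horn_def)
    obtain i where i: "i \<le> n" "i \<noteq> j" "t i = 0" using t by (auto simp: horn_def)
    show ?thesis
    proof (cases "i < j")
      case True
      then have "low ?S t \<le> 0" using low_props(1)[OF S(1,2), of i t] i by simp
      then have "low ?S t = 0" using pp(6)[OF ts a] by simp
      then show ?thesis using t by (simp add: push_trivial)
    next
      case False
      then have "push ?S j a t i = 0" using pp(4)[OF ts a, of i] i by simp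
      then show ?thesis using pp(1)[OF ts a] i by (auto simp: horn_def)
    qed
  qed
  define g where "g = (\<lambda>t. f (push ?S j 1 t))"
  \<comment> \<open>Time is reversed: at 0 the push is complete, at 1 it is the identity.\<close>
  define H where "H = (\<lambda>y. f (push ?S j (1 - snd y) (fst y)))"
  interpret homotopy_extension E \<pi> U r T \<Omega> "horn n j \<inter> \<Omega>" g H
  proof
    show "closedin (top_of_set \<Omega>) (horn n j \<inter> \<Omega>)"
      using closed_horn[of n j] by (metis closedin_closed_Int inf_commute)
    have c: "continuous_on B (\<lambda>t. push ?S j 1 t)" for B
      by (rule continuous_on_compose2[OF continuous_on_push[OF S(1,2), of UNIV j], of B "\<lambda>t. (t, 1)", simplified])
        (intro continuous_intros)
    show "continuous_on \<Omega> g"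
      unfolding g_def by (rule continuous_on_compose2[OF f(1) c]) (use horn1 in auto)
    show "g t \<in> E" if "t \<in> \<Omega>" for t unfolding g_def by (rule f(2)[OF horn1[OF that]])
    have c2: "continuous_on B (\<lambda>y. push ?S j (1 - snd y) (fst y))" for B :: "((nat \<Rightarrow> real) \<times> real) set"
      by (rule continuous_on_compose2[OF continuous_on_push[OF S(1,2), of UNIV j], of B "\<lambda>y. (fst y, 1 - snd y)", simplified])
        (intro continuous_intros)
    show "continuous_on ((horn n j \<inter> \<Omega>) \<times> {0..1}) H"
      unfolding H_def by (rule continuous_on_compose2[OF f(1) c2]) (use horna in auto)
    fix t assume t: "t \<in> horn n j \<inter> \<Omega>"
    show "H (t, 0) = g t" by (simp add: H_def g_def)
    fix s :: real assume s: "s \<in> {0..1}"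
    then have a: "1 - s \<in> {0..1}" by simp
    have h: "push ?S j (1 - s) t \<in> horn n j" using horna[OF _ a] t by blast
    show "H (t, s) \<in> E" unfolding H_def using f(2)[OF h] by simp
    have h1: "push ?S j 1 t \<in> horn n j" using horn1 t by blast
    show "\<pi> (H (t, s)) = \<pi> (g t)"
      unfolding H_def g_def using fA[OF h] fA[OF h1] strat[of t "1 - s"] strat[of t 1] t a by simp
  qed (rule ext)
  obtain G where G: "continuous_on (\<Omega> \<times> {0..1}) G"
    "\<And>t s. t \<in> horn n j \<inter> \<Omega> \<Longrightarrow> s \<in> {0..1} \<Longrightarrow> G (t, s) = H (t, s)"
    "\<And>t s. t \<in> \<Omega> \<Longrightarrow> s \<in> {0..1} \<Longrightarrow> G (t, s) \<in> E \<and> \<pi> (G (t, s)) = \<pi> (g t)"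
    by (rule stratified_homotopy_extension) blast
  show thesis
  proof (rule that[of "\<lambda>t. G (t, 1)"])
    show "continuous_on \<Omega> (\<lambda>t. G (t, 1))"
      by (rule continuous_on_compose2[OF G(1)]) (auto intro!: continuous_intros)
    show "G (t, 1) = f t" if "t \<in> horn n j \<inter> \<Omega>" for t
      using G(2)[OF that, of 1] by (simp add: H_def push_0)
    show "G (t, 1) \<in> E \<and> \<pi> (G (t, 1)) = A (simplex_strat n t)" if "t \<in> \<Omega>" for t
      using G(3)[OF that, of 1] fA[OF horn1[OF that]] strat[OF that, of 1] by (simp add: g_def)
  qed
qed

end

section \<open>Filling the geometric horn across the remaining face\<close>

lemma infdist_pos:
  assumes "closedin (top_of_set C) B" "x \<in> C" "x \<notin> B" "B \<noteq> {}"
  shows "0 < infdist x B"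
proof -
  obtain T where T: "closed T" "B = C \<inter> T" using assms(1) by (auto simp: closedin_closed)
  then have "x \<notin> closure B" using assms(2,3) closure_minimal[of B T] by auto
  then show ?thesis using assms(4) infdist_nonneg[of x B] in_closure_iff_infdist_zero[of B x] by (auto simp: less_le)
qed

text \<open>Half the distance from \<open>(x, 0)\<close> to \<open>B\<close> will do, because
  \<open>(x, lam x)\<close> is then too close to \<open>(x, 0)\<close> to be in \<open>B\<close>.
  Adding the top \<open>C \<times> {1}\<close> to \<open>B\<close> makes the set nonempty and gives
  the upper bound.\<close>

lemma continuous_small_parameter:
  fixes C :: "'a::metric_space set"
  assumes Q: "closedin (top_of_set (C \<times> {0..1::real})) B" and start: "\<And>x. x \<in> C \<Longrightarrow> (x, 0) \<notin> B"
  obtains lam where "continuous_on C lam" "\<And>x. x \<in> C \<Longrightarrow> 0 < lam x \<and> lam x \<le> 1 \<and> (x, lam x) \<notin> B"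
proof -
  let ?B = "B \<union> C \<times> {1}"
  define lam where "lam x = infdist (x, 0) ?B / 2" for x
  have cl: "closedin (top_of_set (C \<times> {0..1})) ?B"
  proof (rule closedin_Un[OF Q])
    show "closedin (top_of_set (C \<times> {0..1})) (C \<times> {1::real})" by (rule closedin_Times) (auto intro: closed_subset)
  qed
  show thesis
  proof (rule that[of lam])
    show "continuous_on C lam" unfolding lam_def by (intro continuous_intros) simp
    fix x assume x: "x \<in> C"
    have "0 < infdist (x, 0) ?B" by (rule infdist_pos[OF cl]) (use x start in auto)
    then have pos: "0 < lam x" by (simp add: lam_def)
    have "infdist (x, 0) ?B \<le> dist (x, 0) (x, 1::real)" by (rule infdist_le) (use x in simp)
    then have le: "lam x \<le> 1/2" by (simp add: lam_def dist_Pair_Pair)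
    have "(x, lam x) \<notin> ?B"
    proof
      assume "(x, lam x) \<in> ?B"
      then have "infdist (x, 0) ?B \<le> dist (x, 0) (x, lam x)" by (rule infdist_le)
      also have "\<dots> = lam x" using pos by (simp add: dist_Pair_Pair dist_real_def)
      finally show False using pos by (simp add: lam_def)
    qed
    then show "0 < lam x \<and> lam x \<le> 1 \<and> (x, lam x) \<notin> B" using pos le by simp
  qed
qed

context stratified_tubes
begin

text \<open>The filler over \<open>\<Omega>\<close> need not tend to \<open>f\<close> at the face
  \<open>\<Phi>\<close>, but on a thin neighbourhood \<open>W\<close> of the rest of the horn it
  does. The push of all coordinates except \<open>j\<close>, stopped shortly before it reaches the
  horn, maps the simplex into \<open>W \<union> \<Phi>\<close> and fixes the horn. Off the horn all
  coordinates other than \<open>j\<close> are positive and remain so, hence the index stays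
  \<open>n\<close>.\<close>

theorem inner_horn_filler:
  fixes f :: "(nat \<Rightarrow> real) \<Rightarrow> 'e"
  assumes j: "0 < j" "j < n"
    and f: "continuous_on (horn n j) f" "\<And>t. t \<in> horn n j \<Longrightarrow> f t \<in> E"
    and fA: "\<And>t. t \<in> horn n j \<Longrightarrow> \<pi> (f t) = A (simplex_strat n t)"
    and ext: "\<And>k. k \<in> \<pi> ` E \<Longrightarrow> absolute_extensor TYPE((nat \<Rightarrow> real) \<times> real) (E \<inter> \<pi> -` {k})"
  obtains G where "continuous_on (standard_simplex n) G" "\<And>t. t \<in> horn n j \<Longrightarrow> G t = f t"
    "\<And>t. t \<in> standard_simplex n \<Longrightarrow> G t \<in> E \<and> \<pi> (G t) = A (simplex_strat n t)"
proof -
  define \<Omega> where "\<Omega> = {t \<in> standard_simplex n. j \<le> simplex_strat n t}"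
  define \<Phi> where "\<Phi> = {t \<in> standard_simplex n. simplex_strat n t < j}"
  let ?D = "standard_simplex n"
  obtain G1 where G1: "continuous_on \<Omega> G1" "\<And>t. t \<in> horn n j \<inter> \<Omega> \<Longrightarrow> G1 t = f t"
    "\<And>t. t \<in> \<Omega> \<Longrightarrow> G1 t \<in> E \<and> \<pi> (G1 t) = A (simplex_strat n t)"
    by (rule inner_horn_interior[OF j f fA ext, folded \<Omega>_def]) blast+
  have \<Phi>_iff: "t \<in> \<Phi> \<longleftrightarrow> t \<in> ?D \<and> (\<forall>m\<in>{j..n}. t m = 0)" for t
  proof
    assume "t \<in> \<Phi>"
    then have t: "t \<in> ?D" "simplex_strat n t < j" by (auto simp: \<Phi>_def)
    then show "t \<in> ?D \<and> (\<forall>m\<in>{j..n}. t m = 0)" using simplex_strat_props(3)[OF t(1)] by auto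
  next
    assume t: "t \<in> ?D \<and> (\<forall>m\<in>{j..n}. t m = 0)"
    then have "t \<in> ?D" by simp
    note sp = simplex_strat_props(1,2)[OF this]
    have "\<not> j \<le> simplex_strat n t" using sp t by auto
    then show "t \<in> \<Phi>" using t by (simp add: \<Phi>_def)
  qed
  have cl\<Phi>: "closed \<Phi>"
  proof -
    have "closed (?D \<inter> (\<Inter>m\<in>{j..n}. {t. t m = 0}))"
      by (intro closed_Int closed_standard_simplex closed_INT ballI closed_coordinate_zero)
    moreover have "?D \<inter> (\<Inter>m\<in>{j..n}. {t. t m = 0}) = \<Phi>" using \<Phi>_iff by auto
    ultimately show ?thesis by simp
  qed
  have \<Phi>D: "\<Phi> \<subseteq> ?D" and \<Omega>\<Phi>: "\<Omega> = ?D - \<Phi>" by (auto simp: \<Phi>_def \<Omega>_def)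
  \<comment> \<open>Here \<open>j < n\<close> enters: the face opposite to \<open>n\<close> belongs
    to the horn, and it contains \<open>\<Phi>\<close>.\<close>
  have \<Phi>horn: "\<Phi> \<subseteq> horn n j"
  proof
    fix t assume "t \<in> \<Phi>"
    then have "t \<in> ?D" "t n = 0" using \<Phi>_iff[of t] j by auto
    then show "t \<in> horn n j" using j by (auto simp: horn_def)
  qed
  have hornD: "horn n j \<subseteq> ?D" by (auto simp: horn_def)
  have clK: "closedin (top_of_set ?D) \<Phi>" by (rule closed_subset[OF \<Phi>D cl\<Phi>])
  have opW: "openin (top_of_set ?D) \<Omega>" unfolding \<Omega>\<Phi> by (rule openin_diff[OF _ clK]) simp
  have sub: "horn n j - \<Phi> \<subseteq> \<Omega>" "\<Omega> \<inter> \<Phi> = {}" using \<Omega>\<Phi> hornD by auto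
  obtain W where W: "openin (top_of_set ?D) W" "W \<subseteq> \<Omega>" "horn n j - \<Phi> \<subseteq> W"
    "continuous_on (W \<union> \<Phi>) (\<lambda>t. if t \<in> \<Phi> then f t else G1 t)"
    by (rule thin_extension[OF clK \<Phi>horn opW sub G1(1) f(1)]) (use G1(2) sub in blast)+
  define G2 where "G2 = (\<lambda>t. if t \<in> \<Phi> then f t else G1 t)"
  let ?S = "{..n} - {j}"
  have "0 \<in> ?S" using j by auto
  then have S: "finite ?S" "?S \<noteq> {}" "?S \<subseteq> {..n}" "j \<le> n" "j \<notin> ?S" using j by auto
  note pp = push_props[OF S]
  have low_horn: "low ?S t = 0 \<longleftrightarrow> t \<in> horn n j" if "t \<in> ?D" for t
  proof
    assume "low ?S t = 0"
    then show "t \<in> horn n j" using low_props(2)[OF S(1,2), of t] that by (auto simp: horn_def)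
  next
    assume "t \<in> horn n j"
    then obtain i where "i \<in> ?S" "t i = 0" by (auto simp: horn_def)
    then have "low ?S t \<le> 0" using low_props(1)[OF S(1,2), of i t] by simp
    then show "low ?S t = 0" using pp(6)[OF that, of 0] by simp
  qed
  \<comment> \<open>The full push ends on the horn. For a point off the horn it makes the coordinate
    \<open>j\<close> positive, so its end is not in \<open>\<Phi>\<close>.\<close>
  have start: "push ?S j 1 t \<in> W" if t: "t \<in> \<Omega>" for t
  proof -
    have tD: "t \<in> ?D" using t by (simp add: \<Omega>_def)
    show ?thesis
    proof (cases "low ?S t = 0")
      case True
      then have "t \<in> horn n j - \<Phi>" using low_horn[OF tD] t sub(2) by blast
      then show ?thesis using W(3) push_trivial[OF True] by auto
    next
      case False
      then have "0 < low ?S t" using pp(6)[OF tD, of 0] by simp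
      moreover have "0 < real (card ?S)" using S(1,2) by (simp add: card_gt_0_iff)
      ultimately have "0 < card ?S * (1 * low ?S t)" by (intro mult_pos_pos) auto
      moreover have "0 \<le> t j" using tD by (simp add: standard_simplex_iff)
      ultimately have pj: "0 < push ?S j 1 t j" using pp(3)[OF tD, of 1] by simp
      have pD: "push ?S j 1 t \<in> ?D" using pp(1)[OF tD, of 1] by simp
      obtain m where "m \<in> ?S" "push ?S j 1 t m = 0" using pp(5)[OF tD, of 1] by auto
      then have "push ?S j 1 t \<in> horn n j" using pD by (auto simp: horn_def)
      moreover have "push ?S j 1 t \<notin> \<Phi>" using \<Phi>_iff pj j by force
      ultimately show ?thesis using W(3) by blast
    qed
  qed
  \<comment> \<open>\<open>snd y\<close> is the amount by which the push is stopped early;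
    \<open>B\<close> collects the cases in which the result misses \<open>W\<close>.\<close>
  define B where "B = {y \<in> \<Omega> \<times> {0..1::real}. push ?S j (1 - snd y) (fst y) \<notin> W}"
  have c2: "continuous_on V (\<lambda>y. push ?S j (1 - snd y) (fst y))" for V :: "((nat \<Rightarrow> real) \<times> real) set"
    by (rule continuous_on_compose2[OF continuous_on_push[OF S(1,2), of UNIV j], of V "\<lambda>y. (fst y, 1 - snd y)", simplified])
      (intro continuous_intros)
  have clB: "closedin (top_of_set (\<Omega> \<times> {0..1})) B"
  proof -
    have im: "(\<lambda>y. push ?S j (1 - snd y) (fst y)) \<in> \<Omega> \<times> {0..1} \<rightarrow> ?D"
      using pp(1) by (auto simp: \<Omega>_def)
    have "openin (top_of_set (\<Omega> \<times> {0..1})) ((\<Omega> \<times> {0..1}) \<inter> (\<lambda>y. push ?S j (1 - snd y) (fst y)) -` W)"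
      by (rule continuous_openin_preimage[OF c2 im W(1)])
    then have "closedin (top_of_set (\<Omega> \<times> {0..1})) ((\<Omega> \<times> {0..1}) - (\<Omega> \<times> {0..1}) \<inter> (\<lambda>y. push ?S j (1 - snd y) (fst y)) -` W)"
      by (rule closedin_diff[rotated]) simp
    moreover have "(\<Omega> \<times> {0..1}) - (\<Omega> \<times> {0..1}) \<inter> (\<lambda>y. push ?S j (1 - snd y) (fst y)) -` W = B"
      by (auto simp: B_def)
    ultimately show ?thesis by simp
  qed
  obtain lam where lam: "continuous_on \<Omega> lam" "\<And>t. t \<in> \<Omega> \<Longrightarrow> 0 < lam t \<and> lam t \<le> 1 \<and> (t, lam t) \<notin> B"
    by (rule continuous_small_parameter[OF clB]) (use start in \<open>auto simp: B_def\<close>)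
  \<comment> \<open>The value on \<open>\<Phi>\<close> is an arbitrary default, and
    \<open>\<tau>\<close> may jump there: the push does not move points of the horn.\<close>
  define \<tau> where "\<tau> t = (if t \<in> \<Omega> then 1 - lam t else 0)" for t
  have \<tau>I: "\<tau> t \<in> {0..1}" for t using lam(2)[of t] by (auto simp: \<tau>_def)
  define R where "R = (\<lambda>t. push ?S j (\<tau> t) t)"
  have R_horn: "R t = t" if "t \<in> horn n j" for t
    using low_horn[of t] that hornD by (auto simp: R_def push_trivial)
  have R_\<Omega>: "R t \<in> W" if "t \<in> \<Omega>" for t
    using lam(2)[OF that] that by (auto simp: R_def \<tau>_def B_def)
  have R_cont: "continuous_on ?D R"
  proof -
    have "continuous_on ?D (\<lambda>t. (\<lambda>y. push ?S j (snd y) (fst y)) (t, \<tau> t))"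
    proof (rule continuous_on_bounded_param[where J = "{0..1}" and K = \<Phi> and M = UNIV])
      show "continuous_on (?D - \<Phi>) \<tau>"
      proof (rule continuous_on_eq[of _ "\<lambda>t. 1 - lam t"])
        show "continuous_on (?D - \<Phi>) (\<lambda>t. 1 - lam t)"
          using lam(1) unfolding \<Omega>\<Phi> by (intro continuous_intros)
        show "1 - lam t = \<tau> t" if "t \<in> ?D - \<Phi>" for t using that \<Omega>\<Phi> by (simp add: \<tau>_def)
      qed
      show "continuous_on UNIV (\<lambda>y. push ?S j (snd y) (fst y))" by (rule continuous_on_push[OF S(1,2)])
      show "push ?S j (snd (t, a)) (fst (t, a)) = push ?S j (snd (t, a')) (fst (t, a'))" if "t \<in> \<Phi>" for t a a'
      proof -
        have "low ?S t = 0" using low_horn[of t] that \<Phi>horn \<Phi>D by blast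
        then show ?thesis by (simp add: push_trivial)
      qed
    qed (use clK \<tau>I in auto)
    then show ?thesis by (simp add: R_def)
  qed
  have R_in: "R t \<in> W \<union> \<Phi>" if "t \<in> ?D" for t
  proof (cases "t \<in> \<Phi>")
    case True
    then show ?thesis using R_horn[of t] \<Phi>horn by auto
  next
    case False
    then show ?thesis using R_\<Omega>[of t] that \<Omega>\<Phi> by blast
  qed
  show thesis
  proof (rule that[of "\<lambda>t. G2 (R t)"])
    show "continuous_on ?D (\<lambda>t. G2 (R t))"
      by (rule continuous_on_compose2[OF W(4)[folded G2_def] R_cont]) (use R_in in auto)
    show 1: "G2 (R t) = f t" if "t \<in> horn n j" for t
    proof (cases "t \<in> \<Phi>")
      case False
      then have "t \<in> horn n j \<inter> \<Omega>" using that \<Omega>\<Phi> hornD by auto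
      then show ?thesis using G1(2) R_horn[OF that] False by (simp add: G2_def)
    qed (use R_horn[OF that] in \<open>simp add: G2_def\<close>)
    show "G2 (R t) \<in> E \<and> \<pi> (G2 (R t)) = A (simplex_strat n t)" if t: "t \<in> ?D" for t
    proof (cases "t \<in> horn n j")
      case True
      then show ?thesis using 1[OF True] f(2)[OF True] fA[OF True] by simp
    next
      case False
      then have "t \<in> \<Omega>" using t \<Omega>\<Phi> \<Phi>horn by blast
      have RW: "R t \<in> W" by (rule R_\<Omega>[OF \<open>t \<in> \<Omega>\<close>])
      then have R\<Omega>: "R t \<in> \<Omega>" "R t \<notin> \<Phi>" using W(2) sub(2) by blast+
      have nS: "n \<in> ?S" using j by auto
      have "t n \<noteq> 0" using False t j by (auto simp: horn_def)
      then have st: "simplex_strat n t = n" by (intro simplex_strat_eqI) auto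
      have lp: "0 < low ?S t" using low_horn[OF t] False pp(6)[OF t, of 0] by simp
      have "0 < (1 - \<tau> t) * low ?S t" using lam(2)[OF \<open>t \<in> \<Omega>\<close>] \<open>t \<in> \<Omega>\<close> lp by (simp add: \<tau>_def)
      also have "\<dots> \<le> R t n" unfolding R_def by (rule pp(2)[OF t \<tau>I nS])
      finally have "simplex_strat n (R t) = n" by (intro simplex_strat_eqI) auto
      then show ?thesis using G1(3)[OF R\<Omega>(1)] R\<Omega>(2) st by (simp add: G2_def)
    qed
  qed
qed

end

section \<open>Operators on simplices, and the passage from \<open>Horn\<close> to the geometric
  horn\<close>

lemma ord_maps_iff: "\<alpha> \<in> ord_maps m n \<longleftrightarrow> \<alpha> \<in> extensional {..m} \<and> (\<forall>a\<le>m. \<alpha> a \<le> n) \<and> mono_on {..m} \<alpha>"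
  by (auto simp: ord_maps_def PiE_def Pi_def)

lemma ord_maps_mono: "\<alpha> \<in> ord_maps m n \<Longrightarrow> a \<le> b \<Longrightarrow> b \<le> m \<Longrightarrow> \<alpha> a \<le> \<alpha> b"
  by (auto simp: ord_maps_iff mono_on_def)

lemma simplex_op_in:
  assumes \<alpha>: "\<alpha> \<in> ord_maps m n" and t: "t \<in> standard_simplex m"
  shows "simplex_op m \<alpha> t \<in> standard_simplex n"
  unfolding standard_simplex_iff
proof (intro conjI allI impI)
  show "0 \<le> simplex_op m \<alpha> t i" for i
    unfolding simplex_op_def using t by (intro sum_nonneg) (simp add: standard_simplex_iff)
  show "simplex_op m \<alpha> t i = 0" if "n < i" for i
  proof -
    have "{a \<in> {..m}. \<alpha> a = i} = {}" using \<alpha> that by (auto simp: ord_maps_iff)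
    then show ?thesis by (simp only: simplex_op_def sum.empty)
  qed
  have "(\<Sum>j\<in>{..n}. \<Sum>i\<in>{i \<in> {..m}. \<alpha> i = j}. t i) = (\<Sum>i\<in>{..m}. t i)"
    using \<alpha> by (intro sum.group) (auto simp: ord_maps_iff)
  then show "sum (simplex_op m \<alpha> t) {..n} = 1"
    using t by (simp add: simplex_op_def standard_simplex_iff)
qed

lemma simplex_op_compose:
  assumes \<beta>: "\<beta> \<in> ord_maps k m"
  shows "simplex_op k (compose {..k} \<alpha> \<beta>) t = simplex_op m \<alpha> (simplex_op k \<beta> t)"
proof
  fix j
  have "(\<Sum>b\<in>{b \<in> {..m}. \<alpha> b = j}. \<Sum>i\<in>{i \<in> {i \<in> {..k}. \<alpha> (\<beta> i) = j}. \<beta> i = b}. t i) = (\<Sum>i\<in>{i \<in> {..k}. \<alpha> (\<beta> i) = j}. t i)"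
    using \<beta> by (intro sum.group) (auto simp: ord_maps_iff)
  moreover have "(\<Sum>i\<in>{i \<in> {i \<in> {..k}. \<alpha> (\<beta> i) = j}. \<beta> i = b}. t i) = (\<Sum>i\<in>{i \<in> {..k}. \<beta> i = b}. t i)"
    if "b \<in> {b \<in> {..m}. \<alpha> b = j}" for b
    using that by (intro sum.cong) auto
  moreover have "{i \<in> {..k}. compose {..k} \<alpha> \<beta> i = j} = {i \<in> {..k}. \<alpha> (\<beta> i) = j}"
    by (auto simp: compose_def)
  ultimately show "simplex_op k (compose {..k} \<alpha> \<beta>) t j = simplex_op m \<alpha> (simplex_op k \<beta> t) j"
    by (simp add: simplex_op_def)
qed

lemma simplex_op_id:
  assumes "t \<in> standard_simplex n"
  shows "simplex_op n (\<lambda>i\<in>{..n}. i) t = t"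
proof
  fix j
  show "simplex_op n (\<lambda>i\<in>{..n}. i) t j = t j"
  proof (cases "j \<le> n")
    case True
    then have "{i \<in> {..n}. (\<lambda>i\<in>{..n}. i) i = j} = {j}" by auto
    then show ?thesis by (simp add: simplex_op_def)
  next
    case False
    then have "{i \<in> {..n}. (\<lambda>i\<in>{..n}. i) i = j} = {}" by auto
    then show ?thesis using assms False by (simp only: simplex_op_def sum.empty) (simp add: standard_simplex_iff)
  qed
qed

lemma top_powertop: "subtopology (powertop_real UNIV) A = top_of_set A"
  by (simp add: euclidean_product_topology)

lemma continuous_on_simplex_op: "continuous_on A (simplex_op m \<alpha>)"
proof (rule continuous_on_coordinatewise_then_product)
  fix j
  show "continuous_on A (\<lambda>t. simplex_op m \<alpha> t j)"
    unfolding simplex_op_def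
    by (intro continuous_on_sum continuous_on_product_then_coordinatewise[OF continuous_on_id])
qed

lemma continuous_map_simplex_op:
  assumes "\<alpha> \<in> ord_maps m n"
  shows "continuous_map (top_of_set (standard_simplex m)) (top_of_set (standard_simplex n)) (simplex_op m \<alpha>)"
  using continuous_on_simplex_op simplex_op_in[OF assms] by auto

text \<open>Coordinates are nonnegative, so nothing cancels in the sums over the fibres of \<alpha>,
  and by monotonicity the last nonzero coordinate goes to the last nonzero coordinate. This makes
  \<open>Exit\<close> closed under the operators.\<close>

lemma simplex_strat_op:
  assumes \<alpha>: "\<alpha> \<in> ord_maps m n" and t: "t \<in> standard_simplex m"
  shows "simplex_strat n (simplex_op m \<alpha> t) = \<alpha> (simplex_strat m t)"
proof -
  let ?p = "simplex_strat m t"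
  note sp = simplex_strat_props[OF t]
  have t0: "0 \<le> t i" for i using t by (simp add: standard_simplex_iff)
  show ?thesis
  proof (rule simplex_strat_eqI)
    show "\<alpha> ?p \<le> n" using \<alpha> sp(1) by (simp add: ord_maps_iff)
    have "t ?p \<le> simplex_op m \<alpha> t (\<alpha> ?p)"
      unfolding simplex_op_def using sp(1) t0 by (intro member_le_sum) auto
    moreover have "0 < t ?p" using sp(2) t0[of ?p] by simp
    ultimately show "simplex_op m \<alpha> t (\<alpha> ?p) \<noteq> 0" by simp
    show "simplex_op m \<alpha> t i = 0" if "\<alpha> ?p < i" "i \<le> n" for i
      unfolding simplex_op_def
    proof (rule sum.neutral, rule ballI)
      fix a assume a: "a \<in> {a \<in> {..m}. \<alpha> a = i}"
      have "\<not> a \<le> ?p"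
      proof
        assume "a \<le> ?p"
        then have "\<alpha> a \<le> \<alpha> ?p" by (rule ord_maps_mono[OF \<alpha> _ sp(1)])
        then show False using a that by simp
      qed
      then show "t a = 0" using sp(3) by simp
    qed
  qed
qed

lemma Exit_simplices:
  "\<sigma> \<in> simplices (Exit X \<pi>) n \<longleftrightarrow> continuous_map (top_of_set (standard_simplex n)) X \<sigma> \<and> \<sigma> \<in> extensional (standard_simplex n) \<and>
     (\<exists>\<alpha>. \<alpha> \<in> {..n} \<rightarrow> face_poset X \<pi> \<and> mono_on {..n} \<alpha> \<and> (\<forall>t\<in>standard_simplex n. \<pi> (\<sigma> t) = \<alpha> (simplex_strat n t)))"
  by (auto simp: Exit_def Sing_def singular_simplex_def top_powertop)

lemma Exit_act: "act (Exit X \<pi>) m n \<alpha> \<sigma> = restrict (\<sigma> \<circ> simplex_op m \<alpha>) (standard_simplex m)"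
  by (simp add: Exit_def Sing_def)

lemma Exit_act_in:
  assumes \<alpha>: "\<alpha> \<in> ord_maps m n" and \<sigma>: "\<sigma> \<in> simplices (Exit X \<pi>) n"
  shows "act (Exit X \<pi>) m n \<alpha> \<sigma> \<in> simplices (Exit X \<pi>) m"
proof -
  obtain A where A: "A \<in> {..n} \<rightarrow> face_poset X \<pi>" "mono_on {..n} A" "\<And>t. t \<in> standard_simplex n \<Longrightarrow> \<pi> (\<sigma> t) = A (simplex_strat n t)"
    and c: "continuous_map (top_of_set (standard_simplex n)) X \<sigma>"
    using \<sigma> unfolding Exit_simplices by blast
  have "continuous_map (top_of_set (standard_simplex m)) X (\<sigma> \<circ> simplex_op m \<alpha>)"
    by (rule continuous_map_compose[OF continuous_map_simplex_op[OF \<alpha>] c])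
  then have "continuous_map (top_of_set (standard_simplex m)) X (restrict (\<sigma> \<circ> simplex_op m \<alpha>) (standard_simplex m))"
    by (rule continuous_map_eq) simp
  moreover have "(\<lambda>i. A (\<alpha> i)) \<in> {..m} \<rightarrow> face_poset X \<pi>" using A(1) \<alpha> by (auto simp: ord_maps_iff Pi_iff)
  moreover have "mono_on {..m} (\<lambda>i. A (\<alpha> i))"
  proof (rule mono_onI)
    fix a b assume "a \<in> {..m}" "b \<in> {..m}" "a \<le> b"
    then show "A (\<alpha> a) \<le> A (\<alpha> b)"
      using ord_maps_mono[OF \<alpha>, of a b] \<alpha> by (intro mono_onD[OF A(2)]) (auto simp: ord_maps_iff)
  qed
  moreover have "\<pi> (restrict (\<sigma> \<circ> simplex_op m \<alpha>) (standard_simplex m) t) = A (\<alpha> (simplex_strat m t))"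
    if "t \<in> standard_simplex m" for t
    using that A(3)[OF simplex_op_in[OF \<alpha> that]] simplex_strat_op[OF \<alpha> that] by simp
  ultimately show ?thesis unfolding Exit_act Exit_simplices by (intro conjI exI[of _ "\<lambda>i. A (\<alpha> i)"]) auto
qed

lemma simplicial_set_Exit: "simplicial_set (Exit X \<pi>)"
  unfolding simplicial_set_def
proof (intro conjI allI ballI)
  show "act (Exit X \<pi>) m n \<alpha> \<in> simplices (Exit X \<pi>) n \<rightarrow> simplices (Exit X \<pi>) m" if "\<alpha> \<in> ord_maps m n" for m n \<alpha>
    using Exit_act_in[OF that] by blast
  show "act (Exit X \<pi>) n n (\<lambda>i\<in>{..n}. i) \<sigma> = \<sigma>" if "\<sigma> \<in> simplices (Exit X \<pi>) n" for n \<sigma>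
  proof (rule extensionalityI[of _ "standard_simplex n"])
    show "act (Exit X \<pi>) n n (\<lambda>i\<in>{..n}. i) \<sigma> \<in> extensional (standard_simplex n)" by (simp add: Exit_act)
    show "\<sigma> \<in> extensional (standard_simplex n)" using that by (simp add: Exit_simplices)
    show "act (Exit X \<pi>) n n (\<lambda>i\<in>{..n}. i) \<sigma> t = \<sigma> t" if "t \<in> standard_simplex n" for t
      unfolding Exit_act using that by (simp add: simplex_op_id[OF that])
  qed
  fix l m n \<beta> \<alpha> \<sigma>
  assume \<beta>: "\<beta> \<in> ord_maps l m" and "\<alpha> \<in> ord_maps m n" and "\<sigma> \<in> simplices (Exit X \<pi>) n"
  show "act (Exit X \<pi>) l n (compose {..l} \<alpha> \<beta>) \<sigma> = act (Exit X \<pi>) l m \<beta> (act (Exit X \<pi>) m n \<alpha> \<sigma>)"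
    unfolding Exit_act using simplex_op_in[OF \<beta>]
    by (intro restrict_ext) (simp add: simplex_op_compose[OF \<beta>])
qed

definition coface :: "nat \<Rightarrow> nat \<Rightarrow> nat \<Rightarrow> nat" where
  "coface m i = (\<lambda>a\<in>{..m}. if a < i then a else Suc a)"

text \<open>On the face where coordinate \<open>i\<close> vanishes, this is the inverse of the
  affine map induced by \<open>coface m i\<close>.\<close>

definition omit :: "nat \<Rightarrow> (nat \<Rightarrow> real) \<Rightarrow> nat \<Rightarrow> real" where
  "omit i t = (\<lambda>a. if a < i then t a else t (Suc a))"

lemma coface_ord_maps: "i \<le> Suc m \<Longrightarrow> coface m i \<in> ord_maps m (Suc m)"
  by (auto simp: ord_maps_iff coface_def mono_on_def)

lemma coface_image: "i \<le> Suc m \<Longrightarrow> coface m i ` {..m} = {..Suc m} - {i}"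
proof
  show "coface m i ` {..m} \<subseteq> {..Suc m} - {i}" if "i \<le> Suc m" by (auto simp: coface_def)
  show "{..Suc m} - {i} \<subseteq> coface m i ` {..m}" if "i \<le> Suc m"
  proof
    fix b assume b: "b \<in> {..Suc m} - {i}"
    show "b \<in> coface m i ` {..m}"
    proof (cases "b < i")
      case True
      then show ?thesis using b that by (intro image_eqI[of _ _ b]) (auto simp: coface_def)
    next
      case False
      then show ?thesis using b by (intro image_eqI[of _ _ "b - 1"]) (auto simp: coface_def)
    qed
  qed
qed

lemma inj_on_coface: "inj_on (coface m i) {..m}"
  by (auto simp: inj_on_def coface_def split: if_splits)

lemma omit_coface: "a \<le> m \<Longrightarrow> omit i t a = t (coface m i a)"
  by (simp add: omit_def coface_def)

lemma omit_in:
  assumes t: "t \<in> standard_simplex (Suc m)" and i: "i \<le> Suc m" "t i = 0"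
  shows "omit i t \<in> standard_simplex m"
  unfolding standard_simplex_iff
proof (intro conjI allI impI)
  show "0 \<le> omit i t a" for a using t by (simp add: omit_def standard_simplex_iff)
  show "omit i t a = 0" if "m < a" for a using t i that by (auto simp: omit_def standard_simplex_iff)
  have "sum (omit i t) {..m} = (\<Sum>a\<le>m. t (coface m i a))" by (intro sum.cong) (auto simp: omit_coface)
  also have "\<dots> = sum t (coface m i ` {..m})" by (simp add: sum.reindex[OF inj_on_coface] o_def)
  also have "\<dots> = sum t ({..Suc m} - {i})" using coface_image[OF i(1)] by simp
  also have "\<dots> = sum t {..Suc m}" using i by (simp add: sum_diff1)
  finally show "sum (omit i t) {..m} = 1" using t by (simp only: standard_simplex_iff)
qed

lemma simplex_op_coface:
  assumes "a \<le> m"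
  shows "simplex_op m (coface m i) t (coface m i a) = t a"
proof -
  have "{b \<in> {..m}. coface m i b = coface m i a} = {a}"
    using inj_on_coface[of m i] assms by (auto simp: inj_on_def)
  then show ?thesis by (simp add: simplex_op_def)
qed

lemma simplex_op_coface_out:
  assumes "b \<notin> coface m i ` {..m}"
  shows "simplex_op m (coface m i) t b = 0"
proof -
  have "{a \<in> {..m}. coface m i a = b} = {}" using assms by auto
  then show ?thesis by (simp only: simplex_op_def sum.empty)
qed

lemma simplex_op_omit:
  assumes t: "t \<in> standard_simplex (Suc m)" and i: "i \<le> Suc m" "t i = 0"
  shows "simplex_op m (coface m i) (omit i t) = t"
proof
  fix b
  show "simplex_op m (coface m i) (omit i t) b = t b"
  proof (cases "b \<in> coface m i ` {..m}")
    case True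
    then obtain a where "a \<le> m" "b = coface m i a" by auto
    then show ?thesis by (simp add: simplex_op_coface omit_coface)
  next
    case False
    then have "b = i \<or> Suc m < b" unfolding coface_image[OF i(1)] by auto
    then have "t b = 0" using i t by (auto simp: standard_simplex_iff)
    then show ?thesis using simplex_op_coface_out[OF False] by simp
  qed
qed

lemma omit_simplex_op:
  assumes s: "s \<in> standard_simplex m" and i: "i \<le> Suc m"
  shows "omit i (simplex_op m (coface m i) s) = s"
proof
  fix a
  show "omit i (simplex_op m (coface m i) s) a = s a"
  proof (cases "a \<le> m")
    case True
    then show ?thesis by (simp add: omit_coface simplex_op_coface)
  next
    case False
    then have "omit i (simplex_op m (coface m i) s) a = simplex_op m (coface m i) s (Suc a)"
      using i by (simp add: omit_def)
    also have "\<dots> = 0" by (rule simplex_op_coface_out) (use False coface_image[OF i] in auto)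
    finally show ?thesis using s False by (simp add: standard_simplex_iff)
  qed
qed

text \<open>The cosimplicial identity. With \<open>omit_omit\<close> it describes the
  codimension-two face in which two facets meet.\<close>

lemma coface_coface:
  assumes "i < i'"
  shows "compose {..p} (coface (Suc p) i') (coface p i) = compose {..p} (coface (Suc p) i) (coface p (i' - 1))"
  using assms by (auto simp: compose_def coface_def fun_eq_iff)

lemma omit_omit:
  assumes "i < i'"
  shows "omit (i' - 1) (omit i t) = omit i (omit i' t)"
  using assms by (auto simp: omit_def fun_eq_iff)

text \<open>An operator that misses the vertex \<open>i\<close> lands in the facet opposite to
  \<open>i\<close>. Hence a simplicial map on a horn is determined by its values on the facets of
  the horn.\<close>

lemma coface_factor:
  assumes \<alpha>: "\<alpha> \<in> ord_maps k (Suc m)" and i: "i \<le> Suc m" "i \<notin> \<alpha> ` {..k}"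
  obtains \<beta> where "\<beta> \<in> ord_maps k m" "\<alpha> = compose {..k} (coface m i) \<beta>"
proof
  let ?\<beta> = "\<lambda>a\<in>{..k}. if \<alpha> a < i then \<alpha> a else \<alpha> a - 1"
  have ne: "\<alpha> a \<noteq> i" if "a \<le> k" for a using i(2) that by auto
  have le: "\<alpha> a \<le> Suc m" if "a \<le> k" for a using \<alpha> that by (simp add: ord_maps_iff)
  show "?\<beta> \<in> ord_maps k m"
    unfolding ord_maps_iff
  proof (intro conjI allI impI)
    show "?\<beta> a \<le> m" if "a \<le> k" for a using le[OF that] ne[OF that] i(1) that by auto
    show "mono_on {..k} ?\<beta>"
    proof (rule mono_onI)
      fix a b assume ab: "a \<in> {..k}" "b \<in> {..k}" "a \<le> b"
      then have "\<alpha> a \<le> \<alpha> b" using ord_maps_mono[OF \<alpha>] by simp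
      then show "?\<beta> a \<le> ?\<beta> b" using ab ne[of a] ne[of b] by auto
    qed
  qed simp
  show "\<alpha> = compose {..k} (coface m i) ?\<beta>"
  proof (rule extensionalityI[of _ "{..k}"])
    show "\<alpha> \<in> extensional {..k}" using \<alpha> by (simp add: ord_maps_iff)
    show "compose {..k} (coface m i) ?\<beta> \<in> extensional {..k}" by (rule compose_extensional)
    fix a assume a: "a \<in> {..k}"
    then have "\<alpha> a \<noteq> i" "\<alpha> a \<le> Suc m" using ne le by auto
    then show "\<alpha> a = compose {..k} (coface m i) ?\<beta> a"
      using a i(1) by (auto simp: compose_def coface_def)
  qed
qed

text \<open>The values of a simplicial map on the facets glue to one continuous map on the geometric
  horn, whose strata are read off from the vertices. A geometric filler is then a simplex of
  \<open>Exit\<close>, and this simplex represents the required map on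
  \<open>Delta n\<close>.\<close>

lemma quasi_category_ExitI:
  fixes X :: "'x topology" and \<pi> :: "'x \<Rightarrow> 'l::order"
  assumes fill: "\<And>n j f A. 0 < j \<Longrightarrow> j < n \<Longrightarrow> continuous_map (top_of_set (horn n j)) X f \<Longrightarrow>
      (\<And>t. t \<in> horn n j \<Longrightarrow> \<pi> (f t) = A (simplex_strat n t)) \<Longrightarrow>
      \<exists>G. continuous_map (top_of_set (standard_simplex n)) X G \<and> (\<forall>t\<in>horn n j. G t = f t) \<and>
        (\<forall>t\<in>standard_simplex n. \<pi> (G t) = A (simplex_strat n t))"
  shows "quasi_category (Exit X \<pi>)"
  unfolding quasi_category_def
proof (intro conjI allI impI simplicial_set_Exit)
  fix n j F
  assume j: "0 < j \<and> j < n" and F: "simplicial_map (Horn n j) (Exit X \<pi>) F"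
  \<comment> \<open>An inner horn has \<open>n\<close> at least 2, so the facets, of dimension
    \<open>p + 1\<close>, have faces of dimension \<open>p\<close> in common.\<close>
  obtain p where p: "n = Suc (Suc p)" using j by (metis Suc_lessE less_imp_Suc_add)
  let ?m = "Suc p"
  let ?d = "coface ?m"
  let ?valid = "\<lambda>i. i \<le> n \<and> i \<noteq> j"
  have F_in: "F k \<alpha> \<in> simplices (Exit X \<pi>) k" if "\<alpha> \<in> simplices (Horn n j) k" for k \<alpha>
    using F that unfolding simplicial_map_def by blast
  have F_act: "F k (compose {..k} \<alpha> \<beta>) = restrict (F m \<alpha> \<circ> simplex_op k \<beta>) (standard_simplex k)"
    if "\<beta> \<in> ord_maps k m" "\<alpha> \<in> simplices (Horn n j) m" for k m \<alpha> \<beta>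
  proof -
    have "F k (act (Horn n j) k m \<beta> \<alpha>) = act (Exit X \<pi>) k m \<beta> (F m \<alpha>)"
      using F that unfolding simplicial_map_def by blast
    then show ?thesis by (simp add: Horn_def Exit_act)
  qed
  have d_horn: "?d i \<in> simplices (Horn n j) ?m" if "?valid i" for i
  proof -
    have "i \<notin> ?d i ` {..?m}" using coface_image[of i ?m] that p by auto
    then have "\<not> {..n} \<subseteq> insert j (?d i ` {..?m})" using that by blast
    then show ?thesis using coface_ord_maps[of i ?m] that p by (simp add: Horn_def)
  qed
  have act_at: "F k (compose {..k} (?d i) \<beta>) t = F ?m (?d i) (simplex_op k \<beta> t)"
    if "?valid i" "\<beta> \<in> ord_maps k ?m" "t \<in> standard_simplex k" for i k \<beta> t
    using F_act[OF that(2) d_horn[OF that(1)]] that(3) by simp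
  \<comment> \<open>Two facets agree on their intersection: both values are those of
    \<open>F\<close> on the common face of dimension \<open>p\<close>, reached by two factorizations
    of the same operator.\<close>
  have less: "F ?m (?d i) (omit i t) = F ?m (?d i') (omit i' t)"
    if v: "?valid i" "?valid i'" and ii: "i < i'" and t: "t \<in> standard_simplex n" "t i = 0" "t i' = 0" for i i' t
  proof -
    have i'': "i' - 1 \<le> Suc p" "i \<le> Suc p" using v p ii by auto
    define u where "u = omit i (omit i' t)"
    have o1: "omit i' t \<in> standard_simplex ?m" by (rule omit_in) (use t v p in auto)
    have o2: "omit i t \<in> standard_simplex ?m" by (rule omit_in) (use t v p in auto)
    have z1: "omit i' t i = 0" using ii t by (simp add: omit_def)
    have z2: "omit i t (i' - 1) = 0" using ii t by (simp add: omit_def)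
    have u: "u \<in> standard_simplex p" unfolding u_def by (rule omit_in[OF o1 i''(2) z1])
    have e1: "simplex_op p (coface p i) u = omit i' t" unfolding u_def by (rule simplex_op_omit[OF o1 i''(2) z1])
    have e2: "simplex_op p (coface p (i' - 1)) u = omit i t"
      unfolding u_def omit_omit[OF ii, symmetric] by (rule simplex_op_omit[OF o2 i''(1) z2])
    have "F ?m (?d i') (omit i' t) = F p (compose {..p} (?d i') (coface p i)) u"
      using act_at[OF v(2) coface_ord_maps[OF i''(2)] u] e1 by simp
    also have "\<dots> = F p (compose {..p} (?d i) (coface p (i' - 1))) u"
      unfolding coface_coface[OF ii] ..
    also have "\<dots> = F ?m (?d i) (omit i t)"
      using act_at[OF v(1) coface_ord_maps[OF i''(1)] u] e2 by simp
    finally show ?thesis by simp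
  qed
  \<comment> \<open>A point may lie in several facets; by the agreement just shown, every choice
    gives the same value.\<close>
  define f where "f t = (let i = (SOME i. ?valid i \<and> t i = 0) in F ?m (?d i) (omit i t))" for t
  have f_eq: "f t = F ?m (?d i) (omit i t)" if v: "?valid i" and t: "t \<in> standard_simplex n" "t i = 0" for i t
  proof -
    let ?i = "SOME i. ?valid i \<and> t i = 0"
    have s: "?valid ?i \<and> t ?i = 0" by (rule someI[of _ i]) (use v t in blast)
    consider "?i < i" | "?i = i" | "i < ?i" by linarith
    then have "F ?m (?d ?i) (omit ?i t) = F ?m (?d i) (omit i t)"
    proof cases
      case 1
      then show ?thesis using less[of ?i i t] s v t by blast
    next
      case 3
      then show ?thesis using less[of i ?i t] s v t by metis
    qed simp
    then show ?thesis by (simp add: f_def Let_def)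
  qed
  have f_face: "f (simplex_op ?m (?d i) s) = F ?m (?d i) s" if v: "?valid i" and s: "s \<in> standard_simplex ?m" for i s
  proof -
    have "simplex_op ?m (?d i) s \<in> standard_simplex n"
      using simplex_op_in[OF coface_ord_maps s, of i] v p by simp
    moreover have "simplex_op ?m (?d i) s i = 0"
      by (rule simplex_op_coface_out) (use coface_image[of i ?m] v p in auto)
    ultimately show ?thesis using f_eq[OF v] omit_simplex_op[OF s, of i] v p by simp
  qed
  define \<Delta>f where "\<Delta>f i = {t \<in> standard_simplex n. t i = 0}" for i
  have horn_eq: "horn n j = (\<Union>i\<in>{i. ?valid i}. \<Delta>f i)" by (auto simp: horn_def \<Delta>f_def)
  have cont: "continuous_map (top_of_set (horn n j)) X f"
  proof (rule continuous_map_proper_cover[where I = "{i. ?valid i}" and K = "\<lambda>i. top_of_set (\<Delta>f i)" and q = "\<lambda>i t. t"])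
    show "finite {i. ?valid i}" by simp
    fix i assume "i \<in> {i. ?valid i}"
    then have v: "?valid i" by simp
    have "closed (\<Delta>f i)"
    proof -
      have "closed (standard_simplex n \<inter> {t. t i = 0})"
        by (intro closed_Int closed_standard_simplex closed_coordinate_zero)
      moreover have "standard_simplex n \<inter> {t. t i = 0} = \<Delta>f i" by (auto simp: \<Delta>f_def)
      ultimately show ?thesis by simp
    qed
    moreover have "\<Delta>f i \<subseteq> horn n j" using v horn_eq by blast
    ultimately have "closedin (top_of_set (horn n j)) (\<Delta>f i)" by (intro closed_subset)
    then have "proper_map (subtopology (top_of_set (horn n j)) (\<Delta>f i)) (top_of_set (horn n j)) (\<lambda>t. t)"
      by (rule proper_map_closed_inclusion)
    moreover have "subtopology (top_of_set (horn n j)) (\<Delta>f i) = top_of_set (\<Delta>f i)"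
      using \<open>\<Delta>f i \<subseteq> horn n j\<close> by (simp add: subtopology_subtopology Int_absorb1)
    ultimately show "proper_map (top_of_set (\<Delta>f i)) (top_of_set (horn n j)) (\<lambda>t. t)" by simp
    have "continuous_on (\<Delta>f i) (omit i)"
    proof (rule continuous_on_coordinatewise_then_product)
      fix a
      show "continuous_on (\<Delta>f i) (\<lambda>t. omit i t a)"
        unfolding omit_def by (cases "a < i") (auto intro: continuous_on_product_then_coordinatewise[OF continuous_on_id])
    qed
    moreover have "omit i t \<in> standard_simplex ?m" if "t \<in> \<Delta>f i" for t
      by (rule omit_in) (use that v p in \<open>auto simp: \<Delta>f_def\<close>)
    ultimately have o: "continuous_map (top_of_set (\<Delta>f i)) (top_of_set (standard_simplex ?m)) (omit i)" by auto
    have "continuous_map (top_of_set (standard_simplex ?m)) X (F ?m (?d i))"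
      using F_in[OF d_horn[OF v]] by (simp add: Exit_simplices)
    from continuous_map_compose[OF o this]
    show "continuous_map (top_of_set (\<Delta>f i)) X (\<lambda>t. f t)"
      by (rule continuous_map_eq) (use f_eq[OF v] in \<open>auto simp: \<Delta>f_def\<close>)
  qed (use horn_eq in auto)
  let ?v = "\<lambda>a b. if b = (a::nat) then 1 else 0 :: real"
  \<comment> \<open>The poset map is read off at the vertices, all of which lie on the horn. Within
    a facet the stratum depends only on the index of the last nonzero coordinate, so every point has
    the stratum of a vertex.\<close>
  define A where "A a = \<pi> (f (?v a))" for a
  have face: "\<exists>\<alpha>. \<alpha> \<in> {..?m} \<rightarrow> face_poset X \<pi> \<and> mono_on {..?m} \<alpha> \<and>
      (\<forall>t\<in>standard_simplex n. t i = 0 \<longrightarrow> \<pi> (f t) = \<alpha> (simplex_strat ?m (omit i t)))" if v: "?valid i" for i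
  proof -
    obtain \<alpha> where \<alpha>: "\<alpha> \<in> {..?m} \<rightarrow> face_poset X \<pi>" "mono_on {..?m} \<alpha>"
      "\<And>s. s \<in> standard_simplex ?m \<Longrightarrow> \<pi> (F ?m (?d i) s) = \<alpha> (simplex_strat ?m s)"
      using F_in[OF d_horn[OF v]] unfolding Exit_simplices by blast
    have "\<pi> (f t) = \<alpha> (simplex_strat ?m (omit i t))" if "t \<in> standard_simplex n" "t i = 0" for t
      using f_eq[OF v that] \<alpha>(3)[OF omit_in[of t ?m i]] that v p by simp
    then show ?thesis using \<alpha> by blast
  qed
  have coface_strat: "coface ?m i (simplex_strat ?m (omit i t)) = simplex_strat n t"
    if v: "?valid i" and t: "t \<in> standard_simplex n" "t i = 0" for i t
  proof -
    have o: "omit i t \<in> standard_simplex ?m" by (rule omit_in) (use t v p in auto)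
    have "simplex_strat n (simplex_op ?m (coface ?m i) (omit i t)) = coface ?m i (simplex_strat ?m (omit i t))"
      using simplex_strat_op[OF coface_ord_maps o, of i] v p by simp
    then show ?thesis using simplex_op_omit[of t ?m i] t v p by simp
  qed
  have v_in: "?v a \<in> standard_simplex n" if "a \<le> n" for a using that by simp
  have v_strat: "simplex_strat n (?v a) = a" if "a \<le> n" for a
    by (rule simplex_strat_eqI) (use that in auto)
  have strat_inj: "simplex_strat ?m (omit i t) = simplex_strat ?m (omit i t')"
    if v: "?valid i" and t: "t \<in> standard_simplex n" "t i = 0" "t' \<in> standard_simplex n" "t' i = 0"
      and eq: "simplex_strat n t = simplex_strat n t'" for i t t'
  proof (rule inj_onD[OF inj_on_coface[of ?m i]])
    show "coface ?m i (simplex_strat ?m (omit i t)) = coface ?m i (simplex_strat ?m (omit i t'))"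
      using coface_strat[OF v t(1,2)] coface_strat[OF v t(3,4)] eq by simp
    have "omit i t \<in> standard_simplex ?m" "omit i t' \<in> standard_simplex ?m"
      by (rule omit_in; use t v p in auto)+
    then show "simplex_strat ?m (omit i t) \<in> {..?m}" "simplex_strat ?m (omit i t') \<in> {..?m}"
      using simplex_strat_props(1) by simp_all
  qed
  have fA: "\<pi> (f t) = A (simplex_strat n t)" if t: "t \<in> horn n j" for t
  proof -
    obtain i where i: "?valid i" "t \<in> standard_simplex n" "t i = 0" using t by (auto simp: horn_def)
    obtain \<alpha> where \<alpha>: "\<And>t. t \<in> standard_simplex n \<Longrightarrow> t i = 0 \<Longrightarrow> \<pi> (f t) = \<alpha> (simplex_strat ?m (omit i t))"
      using face[OF i(1)] by blast
    let ?a = "simplex_strat n t"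
    have a: "?a \<le> n" "t ?a \<noteq> 0" using simplex_strat_props[OF i(2)] by auto
    then have "?a \<noteq> i" using i(3) by auto
    then have z: "?v ?a i = 0" by simp
    have "simplex_strat ?m (omit i t) = simplex_strat ?m (omit i (?v ?a))"
      by (rule strat_inj[OF i v_in[OF a(1)] z v_strat[OF a(1), symmetric]])
    then show ?thesis
      unfolding A_def \<alpha>[OF i(2,3)] \<alpha>[OF v_in[OF a(1)] z] by (rule arg_cong)
  qed
  have A_face: "A a \<in> face_poset X \<pi>" if "a \<le> n" for a
  proof -
    \<comment> \<open>Both 0 and \<open>n\<close> differ from the inner vertex \<open>j\<close>, and
      each vertex lies on the facet opposite to one of them.\<close>
    define i where "i = (if a = n then 0 else n)"
    have i: "?valid i" "i \<noteq> a" using j by (auto simp: i_def)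
    have "?v a \<in> horn n j" using v_in[OF that] i unfolding horn_def by auto
    then have "f (?v a) \<in> topspace X" using continuous_map_image_subset_topspace[OF cont] by auto
    then show ?thesis by (simp add: A_def face_poset_def)
  qed
  have A_step: "A a \<le> A (Suc a)" if a: "Suc a \<le> n" for a
  proof -
    \<comment> \<open>The edge from \<open>a\<close> to \<open>Suc a\<close> lies on the facet
      opposite to 0, or, for \<open>a = 0\<close>, on the one opposite to \<open>n\<close>, because
      \<open>n\<close> is at least 2.\<close>
    define i where "i = (if a = 0 then n else 0)"
    have i: "?valid i" "i \<noteq> a" "i \<noteq> Suc a" using j p by (auto simp: i_def)
    obtain \<alpha> where \<alpha>: "mono_on {..?m} \<alpha>"
      "\<And>t. t \<in> standard_simplex n \<Longrightarrow> t i = 0 \<Longrightarrow> \<pi> (f t) = \<alpha> (simplex_strat ?m (omit i t))"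
      using face[OF i(1)] by blast
    let ?s = "\<lambda>a. simplex_strat ?m (omit i (?v a))"
    have s: "?s b \<le> ?m" "coface ?m i (?s b) = b" if "b \<le> n" "b \<noteq> i" for b
    proof -
      have z: "?v b i = 0" using that by simp
      have "omit i (?v b) \<in> standard_simplex ?m" by (rule omit_in) (use v_in[OF that(1)] z i(1) p in simp_all)
      then show "?s b \<le> ?m" by (rule simplex_strat_props(1))
      show "coface ?m i (?s b) = b" using coface_strat[OF i(1) v_in[OF that(1)] z] v_strat[OF that(1)] by simp
    qed
    have "?s a \<le> ?s (Suc a)"
    proof (rule ccontr)
      assume "\<not> ?s a \<le> ?s (Suc a)"
      then have "coface ?m i (?s (Suc a)) \<le> coface ?m i (?s a)"
        using s(1)[of a] a i by (intro ord_maps_mono[OF coface_ord_maps]) (use i(1) p in auto)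
      then show False using s(2)[of a] s(2)[of "Suc a"] a i by auto
    qed
    then have "\<alpha> (?s a) \<le> \<alpha> (?s (Suc a))"
      using s(1)[of a] s(1)[of "Suc a"] a i by (intro mono_onD[OF \<alpha>(1)]) auto
    moreover have "\<pi> (f (?v b)) = \<alpha> (?s b)" if "b \<le> n" "b \<noteq> i" for b
      by (rule \<alpha>(2)[OF v_in[OF that(1)]]) (use that(2) in simp)
    ultimately show ?thesis unfolding A_def using a i(2,3) by simp
  qed
  have A_mono: "A a \<le> A b" if "a \<le> b" "b \<le> n" for a b
    using that
  proof (induction b rule: dec_induct)
    case (step b)
    then show ?case using A_step[of b] by (meson Suc_leD order_trans)
  qed simp
  obtain G where G: "continuous_map (top_of_set (standard_simplex n)) X G" "\<And>t. t \<in> horn n j \<Longrightarrow> G t = f t"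
    "\<And>t. t \<in> standard_simplex n \<Longrightarrow> \<pi> (G t) = A (simplex_strat n t)"
    using fill[OF _ _ cont fA] j by blast
  define \<sigma> where "\<sigma> = restrict G (standard_simplex n)"
  have \<sigma>: "\<sigma> \<in> simplices (Exit X \<pi>) n"
    unfolding Exit_simplices
  proof (intro conjI exI[of _ A])
    show "continuous_map (top_of_set (standard_simplex n)) X \<sigma>"
      using G(1) by (rule continuous_map_eq) (simp add: \<sigma>_def)
    show "mono_on {..n} A" by (rule mono_onI) (use A_mono in auto)
  qed (use A_face G(3) in \<open>auto simp: \<sigma>_def\<close>)
  \<comment> \<open>The map represented by \<sigma> in the sense of the Yoneda lemma.\<close>
  let ?G = "\<lambda>m \<alpha>. act (Exit X \<pi>) m n \<alpha> \<sigma>"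
  show "\<exists>G. simplicial_map (Delta n) (Exit X \<pi>) G \<and> (\<forall>m. \<forall>\<alpha>\<in>simplices (Horn n j) m. G m \<alpha> = F m \<alpha>)"
  proof (intro exI[of _ ?G] conjI allI ballI)
    show "simplicial_map (Delta n) (Exit X \<pi>) ?G"
      unfolding simplicial_map_def
    proof (intro conjI allI ballI)
      show "?G m \<in> simplices (Delta n) m \<rightarrow> simplices (Exit X \<pi>) m" for m
        using Exit_act_in[OF _ \<sigma>] by (auto simp: Delta_def)
      show "?G k (act (Delta n) k m \<beta> \<alpha>) = act (Exit X \<pi>) k m \<beta> (?G m \<alpha>)"
        if "\<beta> \<in> ord_maps k m" "\<alpha> \<in> simplices (Delta n) m" for k m \<beta> \<alpha>
        using simplicial_set_Exit[of X \<pi>] that \<sigma> unfolding simplicial_set_def by (simp add: Delta_def)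
    qed
    fix k \<alpha> assume a: "\<alpha> \<in> simplices (Horn n j) k"
    then have \<alpha>: "\<alpha> \<in> ord_maps k n" "\<not> {..n} \<subseteq> insert j (\<alpha> ` {..k})" by (auto simp: Horn_def)
    then obtain i where i: "?valid i" "i \<notin> \<alpha> ` {..k}" by auto
    obtain \<beta> where \<beta>: "\<beta> \<in> ord_maps k ?m" "\<alpha> = compose {..k} (?d i) \<beta>"
      using coface_factor[of \<alpha> k ?m i] \<alpha>(1) i p by auto
    show "?G k \<alpha> = F k \<alpha>"
    proof (rule extensionalityI[of _ "standard_simplex k"])
      show "?G k \<alpha> \<in> extensional (standard_simplex k)" by (simp add: Exit_act)
      show "F k \<alpha> \<in> extensional (standard_simplex k)" using F_in[OF a] by (simp add: Exit_simplices)
      fix t assume t: "t \<in> standard_simplex k"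
      let ?s = "simplex_op k \<beta> t"
      have s: "?s \<in> standard_simplex ?m" by (rule simplex_op_in[OF \<beta>(1) t])
      have op: "simplex_op k \<alpha> t = simplex_op ?m (?d i) ?s" unfolding \<beta>(2) by (rule simplex_op_compose[OF \<beta>(1)])
      have \<alpha>t: "simplex_op k \<alpha> t \<in> standard_simplex n" by (rule simplex_op_in[OF \<alpha>(1) t])
      have "simplex_op k \<alpha> t i = 0"
        unfolding op by (rule simplex_op_coface_out) (use coface_image[of i ?m] i p in auto)
      then have "simplex_op k \<alpha> t \<in> horn n j" using \<alpha>t i(1) by (auto simp: horn_def)
      then have "?G k \<alpha> t = f (simplex_op ?m (?d i) ?s)"
        using t \<alpha>t G(2) op by (simp add: Exit_act \<sigma>_def)
      also have "\<dots> = F ?m (?d i) ?s" by (rule f_face[OF i(1) s])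
      also have "\<dots> = F k \<alpha> t" using act_at[OF i(1) \<beta>(1) t] \<beta>(2) by simp
      finally show "?G k \<alpha> t = F k \<alpha> t" .
    qed
  qed
qed

section \<open>Tubes around the strata of a CNSSS\<close>

text \<open>Of the spheres, the tubes use only compactness and the Hausdorff property, so they are
  built for whole cones on arbitrary bases \<open>S l\<close> of this kind.\<close>

locale full_cone_cnsss =
  cnsss X \<pi> S \<pi>S "\<lambda>l. cone_carrier (S l)" \<phi> P b c
  for X :: "'x topology"
    and \<pi> :: "'x \<Rightarrow> 'l::order"
    and S :: "'l \<Rightarrow> 's topology"
    and \<pi>S :: "'l \<Rightarrow> 's \<Rightarrow> 'm::order"
    and \<phi> :: "'l \<Rightarrow> 's cone_point \<Rightarrow> 'x"
    and P :: "'l \<Rightarrow> 'l \<Rightarrow> 'p topology"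
    and b :: "'l \<Rightarrow> 'l \<Rightarrow> 'p \<times> 's cone_point \<Rightarrow> 's cone_point"
    and c :: "'l \<Rightarrow> 'l \<Rightarrow> 'l \<Rightarrow> 'p \<times> 'p \<Rightarrow> 'p" +
  assumes finite_face_poset: "finite (face_poset X \<pi>)"
    and Hausdorff_X: "Hausdorff_space X"
    and compact_S: "\<And>l. l \<in> face_poset X \<pi> \<Longrightarrow> compact_space (S l)"
    and Hausdorff_S: "\<And>l. l \<in> face_poset X \<pi> \<Longrightarrow> Hausdorff_space (S l)"
begin

abbreviation "faces \<equiv> face_poset X \<pi>"
abbreviation "bd \<equiv> bd_pair X \<pi>"
abbreviation "disk l \<equiv> cone_topology (S l)"
abbreviation "points l \<equiv> cone_carrier (S l)"
abbreviation "core l \<equiv> aster_interior (points l)"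
abbreviation "rim l \<equiv> aster_boundary (points l)"

section \<open>Cells, decomposition of the rims, and compactness of the parameter spaces\<close>

lemma disk_compact: "l \<in> faces \<Longrightarrow> compact_space (disk l)"
  by (simp add: compact_space_cone compact_S)

lemma disk_Hausdorff: "l \<in> faces \<Longrightarrow> Hausdorff_space (disk l)"
  by (simp add: Hausdorff_space_cone Hausdorff_S)

lemma core_subset: "core l \<subseteq> points l"
  by (auto simp: aster_interior_def)

lemma rim_subset: "rim l \<subseteq> points l"
  by (auto simp: aster_boundary_def)

lemma core_rim: "core l \<inter> rim l = {}"
  by (auto simp: aster_interior_def)

lemma core_or_rim: "x \<in> points l \<Longrightarrow> x \<in> core l \<or> x \<in> rim l"
  by (auto simp: aster_interior_def)

lemma None_core [simp]: "None \<in> core l"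
  by (auto simp: aster_interior_def aster_boundary_def)

lemma subtopology_disk [simp]: "subtopology (disk l) (points l) = disk l"
  by (metis subtopology_topspace topspace_cone_topology)

lemma \<phi>_quotient:
  assumes "l \<in> faces"
  shows "quotient_map (disk l) (subtopology X (stratum_closure X \<pi> l)) (\<phi> l)"
  using stellar[OF assms] by (simp add: stellar_structure_def)

lemma \<phi>_homeo:
  assumes "l \<in> faces"
  shows "homeomorphic_map (subtopology (disk l) (core l)) (subtopology X (stratum X \<pi> l)) (\<phi> l)"
  using stellar[OF assms] by (simp add: stellar_structure_def)

lemma \<phi>_cont: "l \<in> faces \<Longrightarrow> continuous_map (disk l) X (\<phi> l)"
  using quotient_imp_continuous_map[OF \<phi>_quotient] continuous_map_into_fulltopology by blast

lemma \<phi>_in: "l \<in> faces \<Longrightarrow> x \<in> points l \<Longrightarrow> \<phi> l x \<in> topspace X"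
  using continuous_map_image_subset_topspace[OF \<phi>_cont, of l] by auto

lemma \<phi>_image_core: "l \<in> faces \<Longrightarrow> \<phi> l ` core l = stratum X \<pi> l"
proof -
  assume l: "l \<in> faces"
  have "topspace (subtopology (disk l) (core l)) = core l" using core_subset by auto
  moreover have "topspace (subtopology X (stratum X \<pi> l)) = stratum X \<pi> l" by (auto simp: stratum_def)
  ultimately show ?thesis using homeomorphic_imp_surjective_map[OF \<phi>_homeo[OF l]] by simp
qed

lemma \<pi>_\<phi>_core: "l \<in> faces \<Longrightarrow> x \<in> core l \<Longrightarrow> \<pi> (\<phi> l x) = l"
  using \<phi>_image_core by (auto simp: stratum_def)

lemma \<phi>_inj:
  assumes "l \<in> faces" "x \<in> core l" "y \<in> core l" "\<phi> l x = \<phi> l y"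
  shows "x = y"
proof -
  have "inj_on (\<phi> l) (topspace (subtopology (disk l) (core l)))"
    using homeomorphic_imp_injective_map[OF \<phi>_homeo[OF assms(1)]] .
  then show ?thesis using assms core_subset by (auto simp: inj_on_def)
qed

lemma \<phi>_surj:
  assumes "x \<in> topspace X"
  obtains y where "y \<in> core (\<pi> x)" "\<phi> (\<pi> x) y = x"
proof -
  have "\<pi> x \<in> faces" using assms by (auto simp: face_poset_def)
  then have "x \<in> \<phi> (\<pi> x) ` core (\<pi> x)"
    using \<phi>_image_core[of "\<pi> x"] assms by (simp add: stratum_def)
  then show thesis using that by (elim imageE) simp
qed

lemma \<phi>_proper: "l \<in> faces \<Longrightarrow> proper_map (disk l) X (\<phi> l)"
  by (intro continuous_imp_proper_map disk_compact Hausdorff_imp_kc_space Hausdorff_X \<phi>_cont)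

lemma bd_faces: "bd m l \<Longrightarrow> m \<in> faces \<and> l \<in> faces"
  by (simp add: bd_pair_def)

lemma bd_less:
  assumes "bd m l"
  shows "m < l"
proof -
  obtain x where x: "x \<in> stratum X \<pi> m"
    using assms by (auto simp: bd_pair_def face_poset_def stratum_def)
  then obtain m' where "m' < l" "x \<in> stratum X \<pi> m'"
    using assms boundary_covered[of l] by (auto simp: bd_pair_def)
  then show ?thesis using x by (auto simp: stratum_def)
qed

lemma bd_trans:
  assumes "bd k m" "bd m l"
  shows "bd k l"
proof -
  have "stratum X \<pi> m \<subseteq> stratum_closure X \<pi> l" using assms(2) by (auto simp: bd_pair_def stratum_boundary_def)
  then have "stratum_closure X \<pi> m \<subseteq> stratum_closure X \<pi> l"
    by (simp add: stratum_closure_def closure_of_minimal)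
  then have "stratum X \<pi> k \<subseteq> stratum_closure X \<pi> l"
    using assms(1) by (auto simp: bd_pair_def stratum_boundary_def)
  moreover have "k \<noteq> l" using bd_less[OF assms(1)] bd_less[OF assms(2)] by auto
  ultimately show ?thesis
    using assms by (auto simp: bd_pair_def stratum_boundary_def stratum_def)
qed

lemma b_cont:
  assumes "bd m l"
  shows "continuous_map (prod_topology (P m l) (disk m)) (subtopology (disk l) (rim l)) (b m l)"
  using b_morphism[OF assms] by (simp add: strict_strat_morphism_def)

lemma b_in: "bd m l \<Longrightarrow> p \<in> topspace (P m l) \<Longrightarrow> x \<in> points m \<Longrightarrow> b m l (p, x) \<in> rim l"
  using continuous_map_image_subset_topspace[OF b_cont, of m l] by auto

lemma b_inj:
  assumes "bd m l" "p \<in> topspace (P m l)" "p' \<in> topspace (P m l)" "x \<in> core m" "x' \<in> core m"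
    "b m l (p, x) = b m l (p', x')"
  shows "p = p' \<and> x = x'"
proof -
  have "inj_on (b m l) (topspace (prod_topology (P m l) (subtopology (disk m) (core m))))"
    using b_homeo[OF assms(1)] unfolding embedding_map_def by (rule homeomorphic_imp_injective_map)
  moreover have "topspace (prod_topology (P m l) (subtopology (disk m) (core m))) = topspace (P m l) \<times> core m"
    using core_subset by auto
  ultimately have "inj_on (b m l) (topspace (P m l) \<times> core m)" by simp
  then have "(p, x) = (p', x')"
    by (rule inj_onD) (use assms in auto)
  then show ?thesis by simp
qed

lemma rimE:
  assumes "l \<in> faces" "y \<in> rim l"
  obtains m p x where "bd m l" "p \<in> topspace (P m l)" "x \<in> core m" "y = b m l (p, x)"
  using assms(2) unfolding boundary_union[OF assms(1)] by auto

text \<open>The map \<open>\<phi> l\<close> sends the point to \<open>\<phi> m x\<close> in the open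
  cell \<open>m\<close>, so \<open>m\<close> is the stratum of the image; given \<open>m\<close>,
  the map \<open>b m l\<close> is injective on the part over the core.\<close>

lemma rim_decomp_unique:
  assumes 1: "bd m l" "p \<in> topspace (P m l)" "x \<in> core m"
    and 2: "bd m' l" "p' \<in> topspace (P m' l)" "x' \<in> core m'"
    and eq: "b m l (p, x) = b m' l (p', x')"
  shows "m = m' \<and> p = p' \<and> x = x'"
proof -
  have "x \<in> points m" "x' \<in> points m'" using 1(3) 2(3) core_subset by blast+
  then have "\<phi> m x = \<phi> m' x'"
    using \<phi>_b[OF 1(1,2), of x] \<phi>_b[OF 2(1,2), of x'] eq by simp
  then have "m = m'"
    using \<pi>_\<phi>_core[of m x] \<pi>_\<phi>_core[of m' x'] bd_faces[OF 1(1)] bd_faces[OF 2(1)] 1(3) 2(3) by auto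
  moreover have "p = p' \<and> x = x'"
    using b_inj[OF 1(1,2)] 1 2 eq \<open>m = m'\<close> by blast
  ultimately show ?thesis by simp
qed

lemma \<pi>_\<phi>_rim:
  assumes "l \<in> faces" "y \<in> rim l"
  shows "\<pi> (\<phi> l y) < l"
proof -
  obtain m p x where "bd m l" "p \<in> topspace (P m l)" "x \<in> core m" "y = b m l (p, x)"
    using rimE[OF assms] .
  then show ?thesis
    using \<phi>_b[of m l p x] \<pi>_\<phi>_core[of m x] bd_faces[of m l] bd_less[of m l] core_subset[of m] by auto
qed

lemma finite_bd: "finite {m. bd m l}"
  by (rule finite_subset[OF _ finite_face_poset]) (auto simp: bd_pair_def)

text \<open>Compactness of the parameter spaces is not an axiom. It holds because
  \<open>b m l\<close> embeds \<open>P m l\<close>, paired with the apex, onto a closed subset of a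
  compact cone. The proper maps used later depend on it.\<close>

lemma compact_P:
  assumes bd: "bd m l"
  shows "compact_space (P m l)"
proof -
  let ?A = "prod_topology (P m l) (subtopology (disk m) (core m))"
  have top: "topspace ?A = topspace (P m l) \<times> core m"
    using core_subset by auto
  have ml: "m \<in> faces" "l \<in> faces" using bd_faces[OF bd] by auto
  obtain g where g: "homeomorphic_maps ?A (subtopology (subtopology (disk l) (rim l)) (b m l ` topspace ?A)) (b m l) g"
    using b_homeo[OF bd] unfolding embedding_map_def homeomorphic_map_maps by blast
  \<comment> \<open>The centres of the copies of the cone of \<open>m\<close> in the rim. They are
    the rim points that \<open>\<phi> l\<close> maps to the centre of the cell \<open>m\<close>,
    which shows that they form a closed set.\<close>
  let ?C = "b m l ` (topspace (P m l) \<times> {None})"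
  have C: "?C = {y \<in> points l. \<phi> l y = \<phi> m None} \<inter> rim l"
  proof
    show "?C \<subseteq> {y \<in> points l. \<phi> l y = \<phi> m None} \<inter> rim l"
    proof (rule image_subsetI, clarify)
      fix p assume p: "p \<in> topspace (P m l)"
      have "b m l (p, None) \<in> rim l" using b_in[OF bd p] by simp
      then show "b m l (p, None) \<in> {y \<in> points l. \<phi> l y = \<phi> m None} \<inter> rim l"
        using rim_subset \<phi>_b[OF bd p] by auto
    qed
    show "{y \<in> points l. \<phi> l y = \<phi> m None} \<inter> rim l \<subseteq> ?C"
    proof
      fix y assume y: "y \<in> {y \<in> points l. \<phi> l y = \<phi> m None} \<inter> rim l"
      then obtain m' p x where d: "bd m' l" "p \<in> topspace (P m' l)" "x \<in> core m'" "y = b m' l (p, x)"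
        using rimE[OF ml(2), of y] by auto
      then have e: "\<phi> m' x = \<phi> m None" using y \<phi>_b[OF d(1,2)] core_subset[of m'] by auto
      then have "m' = m"
        using \<pi>_\<phi>_core[OF _ d(3)] \<pi>_\<phi>_core[OF ml(1) None_core] bd_faces[OF d(1)] by auto
      moreover from this e have "x = None" using \<phi>_inj[OF ml(1), of x None] d(3) by simp
      ultimately show "y \<in> ?C" using d by auto
    qed
  qed
  have "closedin (disk l) {y \<in> topspace (disk l). \<phi> l y \<in> {\<phi> m None}}"
    using \<phi>_in[OF ml(1), of None] by (intro closedin_continuous_map_preimage[OF \<phi>_cont[OF ml(2)]] closedin_Hausdorff_singleton Hausdorff_X) auto
  then have "closedin (disk l) ?C"
    unfolding C using closedin_aster_boundary[of "S l"] by (intro closedin_Int) auto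
  then have "compactin (disk l) ?C"
    using closedin_compact_space[OF disk_compact[OF ml(2)]] by blast
  moreover have Csub: "?C \<subseteq> rim l" unfolding C by simp
  moreover have "?C \<subseteq> b m l ` topspace ?A" unfolding top by (intro image_mono) auto
  ultimately have "compactin (subtopology (subtopology (disk l) (rim l)) (b m l ` topspace ?A)) ?C"
    by (simp add: compactin_subtopology)
  moreover have "continuous_map (subtopology (subtopology (disk l) (rim l)) (b m l ` topspace ?A)) (P m l) (fst \<circ> g)"
    using g by (intro continuous_map_compose[OF _ continuous_map_fst]) (auto simp: homeomorphic_maps_def)
  ultimately have "compactin (P m l) ((fst \<circ> g) ` ?C)"
    by (rule image_compactin)
  moreover have "(fst \<circ> g) (b m l (p, None)) = p" if "p \<in> topspace (P m l)" for p
  proof -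
    have "(p, None) \<in> topspace ?A" unfolding top using that by simp
    then have "g (b m l (p, None)) = (p, None)" using g unfolding homeomorphic_maps_def by blast
    then show ?thesis by simp
  qed
  then have "(fst \<circ> g) ` ?C = topspace (P m l)" by force
  ultimately show ?thesis by (simp add: compact_space_def)
qed

lemma b_proper:
  assumes "bd m l"
  shows "proper_map (prod_topology (P m l) (disk m)) (subtopology (disk l) (rim l)) (b m l)"
  using bd_faces[OF assms]
  by (intro continuous_imp_proper_map b_cont[OF assms] Hausdorff_imp_kc_space Hausdorff_space_subtopology disk_Hausdorff)
    (simp_all add: compact_space_prod_topology compact_P[OF assms] disk_compact)

lemma rim_cover:
  assumes "l \<in> faces"
  shows "topspace (subtopology (disk l) (rim l)) \<subseteq>
    (\<Union>m\<in>{m. bd m l}. b m l ` topspace (prod_topology (P m l) (disk m)))"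
proof
  fix y assume "y \<in> topspace (subtopology (disk l) (rim l))"
  then obtain m p x where "bd m l" "p \<in> topspace (P m l)" "x \<in> core m" "y = b m l (p, x)"
    using rimE[OF assms, of y] by auto
  then show "y \<in> (\<Union>m\<in>{m. bd m l}. b m l ` topspace (prod_topology (P m l) (disk m)))"
    using core_subset[of m] by auto
qed

end

section \<open>Tubes inside the cones\<close>

text \<open>The direction is kept and the cone parameter replaced. At the apex the direction is
  unspecified, so this is only applied to other points.\<close>

definition radial :: "real \<Rightarrow> 's cone_point \<Rightarrow> 's cone_point" where
  "radial t w = Some (t, snd (the w))"

lemma radial_Some [simp]: "radial t (Some (u, y)) = Some (t, y)"
  by (simp add: radial_def)

lemma radial_radial [simp]: "radial t (radial u w) = radial t w"
  by (simp add: radial_def)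

context full_cone_cnsss
begin

text \<open>
  \<open>coord k l x z a f\<close> states that \<open>x\<close> in the cone of \<open>l\<close> leads to the point \<open>z\<close> inside the cone of \<open>k\<close>,
  that \<open>a\<close> is the greatest radial coordinate met on the way, and that \<open>f (z', s)\<close> is the point
  obtained by replacing \<open>z\<close> by \<open>z'\<close> and multiplying the radial coordinates by \<open>s\<close>. The radial
  coordinate of \<open>Some (t, y)\<close> is \<open>(1 - t) / t\<close>, which admits multiplication by every \<open>s \<ge> 0\<close>.
\<close>

inductive coord :: "'l \<Rightarrow> 'l \<Rightarrow> 's cone_point \<Rightarrow> 's cone_point \<Rightarrow> real \<Rightarrow> ('s cone_point \<times> real \<Rightarrow> 's cone_point) \<Rightarrow> bool"
  for k where
  base: "k \<in> faces \<Longrightarrow> x \<in> core k \<Longrightarrow> coord k k x x 0 fst"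
| step: "bd m l \<Longrightarrow> p \<in> topspace (P m l) \<Longrightarrow> x \<in> core m \<Longrightarrow> b m l (p, x) = Some (1, y) \<Longrightarrow> 0 < t \<Longrightarrow> t \<le> 1 \<Longrightarrow>
    coord k m x z a f \<Longrightarrow>
    coord k l (Some (t, y)) z (max ((1 - t) / t) a) (\<lambda>q. radial (t / (t + snd q * (1 - t))) (b m l (p, f q)))"

lemma coord_le: "coord k l x z a f \<Longrightarrow> k \<le> l \<and> k \<in> faces \<and> l \<in> faces \<and> 0 \<le> a \<and> z \<in> core k"
proof (induction rule: coord.induct)
  case (step m l p x y t z a f)
  then show ?case using bd_less[OF step(1)] bd_faces[OF step(1)] by auto
qed auto

lemma rim_iff: "y \<in> rim l \<longleftrightarrow> (\<exists>u. y = Some (1, u) \<and> u \<in> topspace (S l))"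
  by (auto simp: aster_boundary_cone)

lemma core_iff: "x \<in> core l \<longleftrightarrow> x = None \<or> (\<exists>t u. x = Some (t, u) \<and> 0 < t \<and> t < 1 \<and> u \<in> topspace (S l))"
proof (cases x)
  case (Some v)
  then show ?thesis by (cases v) (auto simp: aster_interior_cone Some_in_cone_carrier)
qed (simp add: aster_interior_cone)

lemma coord_in: "coord k l x z a f \<Longrightarrow> x \<in> points l"
proof (induction rule: coord.induct)
  case (base x)
  then show ?case using core_subset by blast
next
  case (step m l p x y t z a f)
  have "b m l (p, x) \<in> rim l" by (rule b_in[OF step(1,2) subsetD[OF core_subset step(3)]])
  then have "Some (1, y) \<in> rim l" unfolding step(4) .
  then show ?case using step(5,6) by (simp add: rim_iff Some_in_cone_carrier)
qed

text \<open>The way down from a point to the cell \<open>k\<close> is deterministic, because rim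
  points decompose uniquely; and the two rules exclude each other, since the second leads strictly
  above \<open>k\<close>. This justifies the definite descriptions that follow.\<close>

lemma coord_unique:
  assumes "coord k l x z a f" "coord k l x z' a' f'"
  shows "z = z' \<and> a = a' \<and> f = f'"
  using assms
proof (induction arbitrary: z' a' f' rule: coord.induct)
  case (base x)
  from base(3) show ?case
  proof cases
    case (step m p x' y t a f)
    then show ?thesis using coord_le[OF step(10)] bd_less[OF step(4)] by auto
  qed auto
next
  case (step m l p x y t z a f)
  from step(9) show ?case
  proof cases
    case base
    then show ?thesis using coord_le[OF step(7)] bd_less[OF step(1)] by auto
  next
    case st: (step m' p' x' a' f')
    have eq: "m = m' \<and> p = p' \<and> x = x'"
      by (rule rim_decomp_unique[OF step(1-3) st(3-5)]) (use step(4) st(6) in simp)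
    then have "z = z' \<and> a = a' \<and> f = f'" using step(8) st(9) by auto
    then show ?thesis using st eq by simp
  qed
qed

definition tube :: "'l \<Rightarrow> 'l \<Rightarrow> 's cone_point set" where
  "tube k l = {x. \<exists>z a f. coord k l x z a f}"

definition tube_proj :: "'l \<Rightarrow> 'l \<Rightarrow> 's cone_point \<Rightarrow> 's cone_point" where
  "tube_proj k l x = (THE z. \<exists>a f. coord k l x z a f)"

definition tube_height :: "'l \<Rightarrow> 'l \<Rightarrow> 's cone_point \<Rightarrow> real" where
  "tube_height k l x = (THE a. \<exists>z f. coord k l x z a f)"

definition tube_move :: "'l \<Rightarrow> 'l \<Rightarrow> 's cone_point \<Rightarrow> 's cone_point \<times> real \<Rightarrow> 's cone_point" where
  "tube_move k l x = (THE f. \<exists>z a. coord k l x z a f)"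

lemma coordD:
  assumes "coord k l x z a f"
  shows "x \<in> tube k l" "tube_proj k l x = z" "tube_height k l x = a" "tube_move k l x = f"
proof -
  show "x \<in> tube k l" unfolding tube_def using assms by blast
  show "tube_proj k l x = z"
    unfolding tube_proj_def by (rule the_equality) (use assms coord_unique[OF assms] in blast)+
  show "tube_height k l x = a"
    unfolding tube_height_def by (rule the_equality) (use assms coord_unique[OF assms] in blast)+
  show "tube_move k l x = f"
    unfolding tube_move_def by (rule the_equality) (use assms coord_unique[OF assms] in blast)+
qed

lemma tubeE:
  assumes "x \<in> tube k l"
  shows "coord k l x (tube_proj k l x) (tube_height k l x) (tube_move k l x)"
proof -
  obtain z a f where c: "coord k l x z a f" using assms unfolding tube_def mem_Collect_eq by (elim exE)
  show ?thesis unfolding coordD(2-4)[OF c] by (rule c)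
qed

lemma tube_subset: "tube k l \<subseteq> points l"
  using coord_in by (auto simp: tube_def)

lemma tube_le: "x \<in> tube k l \<Longrightarrow> k \<le> l"
  using coord_le by (auto simp: tube_def)

lemma tube_height_nonneg: "x \<in> tube k l \<Longrightarrow> 0 \<le> tube_height k l x"
  using coord_le tubeE by blast

lemma tube_proj_in: "x \<in> tube k l \<Longrightarrow> tube_proj k l x \<in> core k"
  using coord_le tubeE by blast

lemma tube_self:
  assumes "k \<in> faces"
  shows "tube k k = core k"
    and "\<And>x. x \<in> core k \<Longrightarrow> tube_proj k k x = x"
    and "\<And>x. x \<in> core k \<Longrightarrow> tube_height k k x = 0"
    and "\<And>x q. x \<in> core k \<Longrightarrow> tube_move k k x q = fst q"
proof -
  show "tube k k = core k"
  proof
    show "core k \<subseteq> tube k k" using coord.base[OF assms] by (auto simp: tube_def)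
    show "tube k k \<subseteq> core k"
    proof
      fix x assume "x \<in> tube k k"
      from tubeE[OF this] show "x \<in> core k"
      proof cases
        case (step m p x' y t a f)
        then show ?thesis using coord_le[OF step(10)] bd_less[OF step(4)] by auto
      qed
    qed
  qed
qed (use coordD[OF coord.base[OF assms]] in auto)

text \<open>Along a ray only the outermost radial coordinate changes. For
  \<open>k \<noteq> l\<close> membership in the tube can therefore be decided on the rim, where that
  coordinate is 0.\<close>

lemma tube_radial_rim:
  assumes "k \<noteq> l" "0 < t" "t \<le> 1" "w \<in> rim l"
  shows "radial t w \<in> tube k l \<longleftrightarrow> w \<in> tube k l"
    and "w \<in> tube k l \<Longrightarrow> tube_proj k l (radial t w) = tube_proj k l w"
    and "w \<in> tube k l \<Longrightarrow> tube_height k l (radial t w) = max ((1 - t) / t) (tube_height k l w)"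
    and "w \<in> tube k l \<Longrightarrow> tube_move k l (radial t w) q = radial (t / (t + snd q * (1 - t))) (tube_move k l w q)"
proof -
  obtain y where y: "w = Some (1, y)" using assms(4) by (auto simp: rim_iff)
  { fix u assume "Some (u, y) \<in> tube k l" "0 < u" "u \<le> 1"
    then have "coord k l (Some (u, y)) (tube_proj k l (Some (u, y))) (tube_height k l (Some (u, y))) (tube_move k l (Some (u, y)))"
      using tubeE by blast
    then have "\<exists>m p x z a f. bd m l \<and> p \<in> topspace (P m l) \<and> x \<in> core m \<and> b m l (p, x) = Some (1, y) \<and> coord k m x z a f"
      by cases (use assms(1) in blast)+ }
  note inv = this
  { fix m p x z a f assume d: "bd m l" "p \<in> topspace (P m l)" "x \<in> core m" "b m l (p, x) = Some (1, y)" "coord k m x z a f"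
    then have c: "coord k l (Some (u, y)) z (max ((1 - u) / u) a) (\<lambda>q. radial (u / (u + snd q * (1 - u))) (b m l (p, f q)))"
      if "0 < u" "u \<le> 1" for u
      using that by (intro coord.step) auto
    have a: "0 \<le> a" using coord_le[OF d(5)] by simp
    note c1 = coordD[OF c[of 1]] and ct = coordD[OF c[OF assms(2,3)]]
    have "radial t w \<in> tube k l \<and> w \<in> tube k l \<and> tube_proj k l (radial t w) = tube_proj k l w \<and>
      tube_height k l (radial t w) = max ((1 - t) / t) (tube_height k l w) \<and>
      tube_move k l (radial t w) q = radial (t / (t + snd q * (1 - t))) (tube_move k l w q)"
      using c1 ct a y by simp }
  note main = this
  have ex: "\<exists>m p x z a f. bd m l \<and> p \<in> topspace (P m l) \<and> x \<in> core m \<and> b m l (p, x) = Some (1, y) \<and> coord k m x z a f"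
    if "radial t w \<in> tube k l \<or> w \<in> tube k l"
    using that inv[of t] inv[of 1] assms(2,3) y by auto
  show "radial t w \<in> tube k l \<longleftrightarrow> w \<in> tube k l" using ex main by blast
  show "w \<in> tube k l \<Longrightarrow> tube_proj k l (radial t w) = tube_proj k l w" using ex main by blast
  show "w \<in> tube k l \<Longrightarrow> tube_height k l (radial t w) = max ((1 - t) / t) (tube_height k l w)" using ex main by blast
  show "w \<in> tube k l \<Longrightarrow> tube_move k l (radial t w) q = radial (t / (t + snd q * (1 - t))) (tube_move k l w q)" using ex main by blast
qed

abbreviation "moves k \<equiv> core k \<times> {0::real..}"

lemma radial_in: "w \<in> rim l \<Longrightarrow> 0 < t \<Longrightarrow> t \<le> 1 \<Longrightarrow> radial t w \<in> points l"
  by (auto simp: rim_iff Some_in_cone_carrier)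

lemma radial_1: "w \<in> rim l \<Longrightarrow> radial 1 w = w"
  by (auto simp: rim_iff)

text \<open>The radial coordinate \<open>u = (1 - t) / t\<close> has inverse
  \<open>t = 1 / (1 + u)\<close>, so multiplying it by \<open>s\<close> turns \<open>t\<close> into
  \<open>t / (t + s * (1 - t))\<close>. The last two claims say that the coordinate is scaled and
  that scalings compose; scale 0 leads to the rim, \<open>t = 1\<close>.\<close>

lemma scaled_height:
  fixes t s :: real
  assumes "0 < t" "t \<le> 1" "0 \<le> s"
  shows "0 < t / (t + s * (1 - t))" "t / (t + s * (1 - t)) \<le> 1"
    "(1 - t / (t + s * (1 - t))) / (t / (t + s * (1 - t))) = s * ((1 - t) / t)"
    "0 \<le> s' \<Longrightarrow> t / (t + s * (1 - t)) / (t / (t + s * (1 - t)) + s' * (1 - t / (t + s * (1 - t)))) = t / (t + (s * s') * (1 - t))"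
proof -
  have pos: "0 < t + s * (1 - t)" using assms by (simp add: add_pos_nonneg)
  show 1: "0 < t / (t + s * (1 - t))" using assms pos by simp
  show "t / (t + s * (1 - t)) \<le> 1" using assms pos by simp
  have eq: "1 - t / (t + s * (1 - t)) = s * (1 - t) / (t + s * (1 - t))"
    using pos by (simp add: field_simps)
  show "(1 - t / (t + s * (1 - t))) / (t / (t + s * (1 - t))) = s * ((1 - t) / t)"
    unfolding eq using pos by simp
  show "t / (t + s * (1 - t)) / (t / (t + s * (1 - t)) + s' * (1 - t / (t + s * (1 - t)))) = t / (t + (s * s') * (1 - t))"
    if "0 \<le> s'"
  proof -
    have "t / (t + s * (1 - t)) + s' * (1 - t / (t + s * (1 - t))) = (t + (s * s') * (1 - t)) / (t + s * (1 - t))"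
      unfolding eq by (simp only: add_divide_distrib times_divide_eq_right mult.assoc mult.left_commute[of s'])
    then show ?thesis using pos by simp
  qed
qed

lemma coord_move_in: "coord k l x z a f \<Longrightarrow> q \<in> moves k \<Longrightarrow> f q \<in> points l"
proof (induction rule: coord.induct)
  case (base x)
  then show ?case by (auto intro: subsetD[OF core_subset])
next
  case (step m l p x y t z a f)
  then have "b m l (p, f q) \<in> rim l" by (intro b_in) auto
  then show ?case using scaled_height(1,2)[OF step(5,6), of "snd q"] step.prems by (intro radial_in) auto
qed

lemma tube_move_in: "x \<in> tube k l \<Longrightarrow> q \<in> moves k \<Longrightarrow> tube_move k l x q \<in> points l"
  using coord_move_in tubeE by blast

text \<open>A rim point takes the second rule of \<open>coord\<close> with \<open>t = 1\<close>,
  whose radial coordinate 0 contributes nothing to the maximum.\<close>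

lemma tube_b_core:
  assumes "bd m l" "p \<in> topspace (P m l)" "x \<in> core m"
  shows "b m l (p, x) \<in> tube k l \<longleftrightarrow> x \<in> tube k m"
    and "x \<in> tube k m \<Longrightarrow> tube_proj k l (b m l (p, x)) = tube_proj k m x"
    and "x \<in> tube k m \<Longrightarrow> tube_height k l (b m l (p, x)) = tube_height k m x"
    and "x \<in> tube k m \<Longrightarrow> q \<in> moves k \<Longrightarrow> tube_move k l (b m l (p, x)) q = b m l (p, tube_move k m x q)"
proof -
  have xm: "x \<in> points m" using assms(3) core_subset by blast
  have w: "b m l (p, x) \<in> rim l" by (rule b_in[OF assms(1,2) xm])
  then obtain y where y: "b m l (p, x) = Some (1, y)" by (auto simp: rim_iff)
  { assume x: "x \<in> tube k m"
    have "coord k l (Some (1, y)) (tube_proj k m x) (max ((1 - 1) / 1) (tube_height k m x))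
        (\<lambda>q. radial (1 / (1 + snd q * (1 - 1))) (b m l (p, tube_move k m x q)))"
      by (rule coord.step[OF assms y _ _ tubeE[OF x]]) auto
    then have "coord k l (Some (1, y)) (tube_proj k m x) (tube_height k m x) (\<lambda>q. radial 1 (b m l (p, tube_move k m x q)))"
      using tube_height_nonneg[OF x] by simp
    moreover have "radial 1 (b m l (p, tube_move k m x q)) = b m l (p, tube_move k m x q)" if "q \<in> moves k"
      using tube_move_in[OF x that] by (intro radial_1[OF b_in[OF assms(1,2)]])
    ultimately have "b m l (p, x) \<in> tube k l \<and> tube_proj k l (b m l (p, x)) = tube_proj k m x \<and>
      tube_height k l (b m l (p, x)) = tube_height k m x \<and>
      (q \<in> moves k \<longrightarrow> tube_move k l (b m l (p, x)) q = b m l (p, tube_move k m x q))"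
      using coordD y by auto }
  note main = this
  have "x \<in> tube k m" if t: "b m l (p, x) \<in> tube k l"
    using tubeE[OF t]
  proof cases
    case base
    then show ?thesis using w core_rim by auto
  next
    case (step m' p' x' y' t a f)
    have "m = m' \<and> p = p' \<and> x = x'"
      by (rule rim_decomp_unique[OF assms step(4-6)]) (use step(1,7) y in simp)
    then show ?thesis using coordD(1)[OF step(10)] by simp
  qed
  then show "b m l (p, x) \<in> tube k l \<longleftrightarrow> x \<in> tube k m" using main by blast
  show "x \<in> tube k m \<Longrightarrow> tube_proj k l (b m l (p, x)) = tube_proj k m x"
    "x \<in> tube k m \<Longrightarrow> tube_height k l (b m l (p, x)) = tube_height k m x"
    "x \<in> tube k m \<Longrightarrow> q \<in> moves k \<Longrightarrow> tube_move k l (b m l (p, x)) q = b m l (p, tube_move k m x q)"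
    using main by blast+
qed

lemma bd_cl: "bd m l \<Longrightarrow> cl_pair X \<pi> m l"
proof -
  assume bd: "bd m l"
  then have "stratum X \<pi> m \<subseteq> stratum_closure X \<pi> l" by (auto simp: bd_pair_def stratum_boundary_def)
  then have "stratum_closure X \<pi> m \<subseteq> stratum_closure X \<pi> l"
    by (simp add: stratum_closure_def closure_of_minimal)
  then show ?thesis using bd by (simp add: cl_pair_def bd_pair_def)
qed

lemma c_in:
  assumes "bd m k" "bd k l" "p \<in> topspace (P k l)" "q \<in> topspace (P m k)"
  shows "c m k l (p, q) \<in> topspace (P m l)"
  using continuous_map_image_subset_topspace[OF c_continuous[OF bd_cl[OF assms(1)] bd_cl[OF assms(2)]]] assms(3,4)
  by auto

text \<open>If \<open>x\<close> lies on the rim of its own cone, it is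
  \<open>b m' m (p', x')\<close> with \<open>x'\<close> in a core, and \<open>b_b\<close> merges the
  two steps into one with a parameter given by \<open>c\<close>. The case of core points then
  applies to both descriptions. Compatibility on rims is what the continuity proofs need.\<close>

lemma tube_b:
  assumes "bd m l" "p \<in> topspace (P m l)" "x \<in> points m"
  shows "b m l (p, x) \<in> tube k l \<longleftrightarrow> x \<in> tube k m"
    and "x \<in> tube k m \<Longrightarrow> tube_proj k l (b m l (p, x)) = tube_proj k m x"
    and "x \<in> tube k m \<Longrightarrow> tube_height k l (b m l (p, x)) = tube_height k m x"
    and "x \<in> tube k m \<Longrightarrow> q \<in> moves k \<Longrightarrow> tube_move k l (b m l (p, x)) q = b m l (p, tube_move k m x q)"
proof -
  have "(b m l (p, x) \<in> tube k l \<longleftrightarrow> x \<in> tube k m) \<and>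
    (x \<in> tube k m \<longrightarrow> tube_proj k l (b m l (p, x)) = tube_proj k m x \<and>
      tube_height k l (b m l (p, x)) = tube_height k m x \<and>
      (q \<in> moves k \<longrightarrow> tube_move k l (b m l (p, x)) q = b m l (p, tube_move k m x q)))"
  proof (cases "x \<in> core m")
    case True
    then show ?thesis using tube_b_core[OF assms(1,2) True] by blast
  next
    case False
    then have "x \<in> rim m" using assms(3) core_or_rim by blast
    then obtain m' p' x' where d: "bd m' m" "p' \<in> topspace (P m' m)" "x' \<in> core m'" "x = b m' m (p', x')"
      using rimE bd_faces[OF assms(1)] by metis
    have x': "x' \<in> points m'" using d(3) core_subset by blast
    have m'l: "bd m' l" by (rule bd_trans[OF d(1) assms(1)])
    let ?c = "c m' m l (p, p')"
    have c: "?c \<in> topspace (P m' l)" by (rule c_in[OF d(1) assms(1,2) d(2)])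
    have eq: "b m l (p, b m' m (p', v)) = b m' l (?c, v)" if "v \<in> points m'" for v
      by (rule b_b[OF d(1) assms(1,2) d(2) that])
    note 1 = tube_b_core[OF m'l c d(3)] and 2 = tube_b_core[OF d(1-3)]
    show ?thesis
      unfolding d(4) eq[OF x']
    proof (intro conjI impI)
      show "b m' l (?c, x') \<in> tube k l \<longleftrightarrow> b m' m (p', x') \<in> tube k m" using 1(1) 2(1) by simp
      assume "b m' m (p', x') \<in> tube k m"
      then have x't: "x' \<in> tube k m'" using 2(1) by simp
      show "tube_proj k l (b m' l (?c, x')) = tube_proj k m (b m' m (p', x'))"
        "tube_height k l (b m' l (?c, x')) = tube_height k m (b m' m (p', x'))"
        using 1 2 x't by simp_all
      assume q: "q \<in> moves k"
      show "tube_move k l (b m' l (?c, x')) q = b m l (p, tube_move k m (b m' m (p', x')) q)"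
        unfolding 1(4)[OF x't q] 2(4)[OF x't q] by (rule eq[OF tube_move_in[OF x't q], symmetric])
    qed
  qed
  then show "b m l (p, x) \<in> tube k l \<longleftrightarrow> x \<in> tube k m"
    and "x \<in> tube k m \<Longrightarrow> tube_proj k l (b m l (p, x)) = tube_proj k m x"
    and "x \<in> tube k m \<Longrightarrow> tube_height k l (b m l (p, x)) = tube_height k m x"
    and "x \<in> tube k m \<Longrightarrow> q \<in> moves k \<Longrightarrow> tube_move k l (b m l (p, x)) q = b m l (p, tube_move k m x q)"
    by blast+
qed

lemma tube_induct [consumes 1, case_names core radial]:
  assumes "x \<in> tube k l"
    and "\<And>x. k \<in> faces \<Longrightarrow> x \<in> core k \<Longrightarrow> Q k x"
    and "\<And>m l p x t. bd m l \<Longrightarrow> k \<noteq> l \<Longrightarrow> p \<in> topspace (P m l) \<Longrightarrow> x \<in> core m \<Longrightarrow> x \<in> tube k m \<Longrightarrow> 0 < t \<Longrightarrow> t \<le> 1 \<Longrightarrow>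
      Q m x \<Longrightarrow> Q l (radial t (b m l (p, x)))"
  shows "Q l x"
  using tubeE[OF assms(1)]
proof (induction rule: coord.induct)
  case (base x)
  then show ?case using assms(2) by blast
next
  case (step m l p x y t z a f)
  have "k \<noteq> l" using coord_le[OF step(7)] bd_less[OF step(1)] by auto
  then have "Q l (radial t (b m l (p, x)))"
    using assms(3)[OF step(1) _ step(2,3) coordD(1)[OF step(7)] step(5,6,8)] by blast
  then show ?case using step(4) by simp
qed

text \<open>These are the laws of a conical tube inside one cone: base point and height can be set
  independently, moves compose by multiplying scales, and scale 0 ends in the stratum. A positive
  scale keeps core points in the core, hence in their stratum. All of it is proved in one induction
  along the way down to \<open>k\<close>.\<close>

lemma tube_move_props:
  assumes "x \<in> tube k l" "z \<in> core k" "0 \<le> s"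
  shows "tube_move k l x (z, s) \<in> tube k l \<and> tube_proj k l (tube_move k l x (z, s)) = z \<and>
    tube_height k l (tube_move k l x (z, s)) = s * tube_height k l x \<and>
    (\<forall>z'\<in>core k. \<forall>s'\<ge>0. tube_move k l (tube_move k l x (z, s)) (z', s') = tube_move k l x (z', s * s')) \<and>
    tube_move k l x (tube_proj k l x, 1) = x \<and>
    \<phi> l (tube_move k l x (z, 0)) = \<phi> k z \<and>
    (0 < s \<and> x \<in> core l \<longrightarrow> tube_move k l x (z, s) \<in> core l)"
  using assms(1)
proof (induction rule: tube_induct)
  case (core x)
  then show ?case using tube_self[OF core(1)] assms(2) by simp
next
  case (radial m l p x t)
  let ?w = "b m l (p, x)"
  have xm: "x \<in> points m" using radial(4) core_subset by blast
  have w: "?w \<in> rim l" by (rule b_in[OF radial(1,3) xm])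
  note tb = tube_b[OF radial(1,3)]
  have wt: "?w \<in> tube k l" using tb(1)[OF xm] radial(5) by simp
  note rr = tube_radial_rim[OF radial(2) _ _ w]
  define t' where "t' = t / (t + s * (1 - t))"
  note sh = scaled_height[OF radial(6,7) assms(3), folded t'_def]
  have q: "(z, s) \<in> moves k" using assms by simp
  let ?x' = "tube_move k m x (z, s)"
  have x': "?x' \<in> points m" using tube_move_in[OF radial(5) q] .
  have x't: "?x' \<in> tube k m" using radial(8) by simp
  have w': "b m l (p, ?x') \<in> rim l" by (rule b_in[OF radial(1,3) x'])
  have w't: "b m l (p, ?x') \<in> tube k l" using tb(1)[OF x'] x't by simp
  note rr' = tube_radial_rim[OF radial(2) _ _ w']
  have mv: "tube_move k l (radial u ?w) (v, r) = radial (u / (u + r * (1 - u))) (b m l (p, tube_move k m x (v, r)))"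
    if "0 < u" "u \<le> 1" "v \<in> core k" "0 \<le> r" for u v r
    using rr(4)[OF that(1,2) wt] tb(4)[OF xm radial(5)] that by simp
  have eq: "tube_move k l (radial t ?w) (z, s) = radial t' (b m l (p, ?x'))"
    using mv[OF radial(6,7) assms(2,3)] by (simp add: t'_def)
  show ?case
  proof (intro conjI ballI allI impI)
    show "tube_move k l (radial t ?w) (z, s) \<in> tube k l"
      unfolding eq using rr'(1)[OF sh(1,2)] w't by simp
    show "tube_proj k l (tube_move k l (radial t ?w) (z, s)) = z"
      unfolding eq rr'(2)[OF sh(1,2) w't] tb(2)[OF x' x't] using radial(8) by simp
    show "tube_height k l (tube_move k l (radial t ?w) (z, s)) = s * tube_height k l (radial t ?w)"
      unfolding eq rr'(3)[OF sh(1,2) w't] tb(3)[OF x' x't] rr(3)[OF radial(6,7) wt] tb(3)[OF xm radial(5)] sh(3)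
      using radial(8) assms(3) by (simp add: max_mult_distrib_left)
    show "tube_move k l (tube_move k l (radial t ?w) (z, s)) (z', s') = tube_move k l (radial t ?w) (z', s * s')"
      if "z' \<in> core k" "0 \<le> s'" for z' s'
    proof -
      have "tube_move k l (radial t' (b m l (p, ?x'))) (z', s') = radial (t' / (t' + s' * (1 - t'))) (tube_move k l (b m l (p, ?x')) (z', s'))"
        using rr'(4)[OF sh(1,2) w't] by simp
      also have "tube_move k l (b m l (p, ?x')) (z', s') = b m l (p, tube_move k m ?x' (z', s'))"
        using tb(4)[OF x' x't] that by simp
      also have "tube_move k m ?x' (z', s') = tube_move k m x (z', s * s')"
        using radial(8) that by blast
      also have "t' / (t' + s' * (1 - t')) = t / (t + (s * s') * (1 - t))" using sh(4)[OF that(2)] .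
      finally show ?thesis
        unfolding eq using mv[OF radial(6,7) that(1), of "s * s'"] assms(3) that(2) by simp
    qed
    show "tube_move k l (radial t ?w) (tube_proj k l (radial t ?w), 1) = radial t ?w"
      unfolding rr(2)[OF radial(6,7) wt] tb(2)[OF xm radial(5)]
      using mv[OF radial(6,7) tube_proj_in[OF radial(5)], of 1] radial(8) by simp
    have z0: "(z, 0) \<in> moves k" using assms by simp
    have y0: "tube_move k m x (z, 0) \<in> points m" using tube_move_in[OF radial(5) z0] .
    \<comment> \<open>Scale 0 changes the cone parameter to 1, so the result is on the rim and its
      image in \<open>X\<close> is computed in the cone of \<open>m\<close>.\<close>
    have "tube_move k l (radial t ?w) (z, 0) = b m l (p, tube_move k m x (z, 0))"
      using mv[OF radial(6,7) assms(2), of 0] radial(6) radial_1[OF b_in[OF radial(1,3) y0]] by simp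
    then show "\<phi> l (tube_move k l (radial t ?w) (z, 0)) = \<phi> k z"
      using \<phi>_b[OF radial(1,3) y0] radial(8) by simp
    assume s: "0 < s \<and> radial t ?w \<in> core l"
    obtain u where u: "?w = Some (1, u)" using w by (auto simp: rim_iff)
    obtain u' where u': "b m l (p, ?x') = Some (1, u')" "u' \<in> topspace (S l)" using w' by (auto simp: rim_iff)
    have "t < 1" using s u by (auto simp: core_iff)
    then have "t' < 1" using s radial(6) by (simp add: t'_def divide_less_eq add_pos_nonneg)
    then show "tube_move k l (radial t ?w) (z, s) \<in> core l"
      unfolding eq u'(1) using sh(1) u'(2) by (simp add: core_iff)
  qed
qed

text \<open>A core point that is reached by the second rule has \<open>t < 1\<close>, and its
  outermost radial coordinate is already positive.\<close>

lemma tube_height_0: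
  assumes "x \<in> tube k l" "x \<in> core l" "tube_height k l x = 0"
  shows "k = l"
  using tubeE[OF assms(1)]
proof cases
  case (step m p x' y t a f)
  then have "t < 1" using assms(2) by (auto simp: core_iff)
  then have "0 < (1 - t) / t" using step by simp
  then show ?thesis using step(2) assms(3) by simp
qed auto

end

section \<open>Openness, continuity and compactness for the tubes in the cones\<close>

lemma openin_nonapex: "openin (cone_topology S) (cone_carrier S - {None})"
proof -
  have "cone_carrier S - {None} = {x \<in> topspace (cone_topology S). cone_height x \<in> {0<..}}"
    by (auto simp: cone_carrier_def)
  then show ?thesis
    using openin_continuous_map_preimage[OF continuous_map_cone_height, of "{0<..}" S] by simp
qed

lemma continuous_map_snd_the:
  "continuous_map (subtopology (cone_topology S) (cone_carrier S - {None})) S (\<lambda>x. snd (the x))"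
  using continuous_map_compose[OF continuous_map_the continuous_map_snd] by (simp add: o_def)

lemma continuous_map_radial:
  assumes "continuous_map A (top_of_set {0<..1}) t"
    and "continuous_map A (subtopology (cone_topology S) (cone_carrier S - {None})) w"
  shows "continuous_map A (cone_topology S) (\<lambda>x. radial (t x) (w x))"
proof -
  have "continuous_map A S (\<lambda>x. snd (the (w x)))"
    using continuous_map_compose[OF assms(2) continuous_map_snd_the] by (simp add: o_def)
  then have "continuous_map A (prod_topology (top_of_set {0<..1}) S) (\<lambda>x. (t x, snd (the (w x))))"
    using assms(1) by (simp add: continuous_map_pairedI)
  from continuous_map_compose[OF this continuous_map_Some] show ?thesis
    by (simp add: o_def radial_def)
qed

lemma radial_self: "x \<in> cone_carrier S \<Longrightarrow> x \<noteq> None \<Longrightarrow> radial (cone_height x) (radial 1 x) = x"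
  by (auto simp: cone_carrier_def)

lemma radial_1_rim: "x \<in> cone_carrier S - {None} \<Longrightarrow> radial 1 x \<in> aster_boundary (cone_carrier S)"
  unfolding aster_boundary_cone by (auto simp: cone_carrier_def)

lemma nonapex_height: "x \<in> cone_carrier S - {None} \<Longrightarrow> 0 < cone_height x \<and> cone_height x \<le> 1"
  by (auto simp: cone_carrier_def)

lemma continuous_map_fst_fst: "continuous_map (prod_topology (prod_topology A B) C) A (\<lambda>y. fst (fst y))"
  using continuous_map_compose[OF continuous_map_fst continuous_map_fst, of A B C] by (simp add: o_def)

lemma continuous_map_snd_fst: "continuous_map (prod_topology (prod_topology A B) C) B (\<lambda>y. snd (fst y))"
  using continuous_map_compose[OF continuous_map_fst continuous_map_snd, of A B C] by (simp add: o_def)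

context full_cone_cnsss
begin

text \<open>Induction on the number of cells in the boundary, which drops strictly because the face
  relation is transitive and irreflexive.\<close>

lemma bd_induct [case_names less]:
  assumes "\<And>l. (\<And>m. bd m l \<Longrightarrow> Q m) \<Longrightarrow> Q l"
  shows "Q l"
proof (induction "card {m. bd m l}" arbitrary: l rule: less_induct)
  case less
  show ?case
  proof (rule assms)
    fix m assume m: "bd m l"
    have "{k. bd k m} \<subset> {k. bd k l}"
      using bd_trans[OF _ m] m bd_less[of m m] by blast
    then show "Q m" by (intro less psubset_card_mono finite_bd)
  qed
qed

abbreviation "moves_top k \<equiv> prod_topology (subtopology (disk k) (core k)) (top_of_set {0::real..})"

lemma topspace_core [simp]: "topspace (subtopology (disk k) (core k)) = core k"
  using core_subset[of k] by auto

text \<open>The last clause is the source of compact slices: over a single point of the core, the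
  part of the tube of height at most 1 is compact.\<close>

definition tame_tube :: "'l \<Rightarrow> 'l \<Rightarrow> bool" where
  "tame_tube k l \<longleftrightarrow> openin (disk l) (tube k l) \<and>
     continuous_map (subtopology (disk l) (tube k l)) (subtopology (disk k) (core k)) (tube_proj k l) \<and>
     continuous_map (subtopology (disk l) (tube k l)) euclideanreal (tube_height k l) \<and>
     continuous_map (prod_topology (subtopology (disk l) (tube k l)) (moves_top k)) (disk l) (\<lambda>y. tube_move k l (fst y) (snd y)) \<and>
     (\<forall>z\<in>core k. compactin (disk l) {x \<in> tube k l. tube_proj k l x = z \<and> tube_height k l x \<le> 1})"

lemma rim_nonapex: "rim l \<subseteq> points l - {None}"
  by (auto simp: rim_iff Some_in_cone_carrier)

lemma tube_nonapex: "k \<noteq> l \<Longrightarrow> tube k l \<subseteq> points l - {None}"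
proof
  fix x assume k: "k \<noteq> l" and x: "x \<in> tube k l"
  from tubeE[OF x] have "x \<noteq> None" by cases (use k in auto)
  then show "x \<in> points l - {None}" using x tube_subset by blast
qed

lemma continuous_map_radial_1:
  "continuous_map (subtopology (disk l) (points l - {None})) (subtopology (disk l) (rim l)) (radial 1)"
proof -
  have "continuous_map (subtopology (disk l) (points l - {None})) (disk l) (\<lambda>x. radial 1 x)"
    by (rule continuous_map_radial) auto
  then show ?thesis
    unfolding continuous_map_in_subtopology using radial_1_rim by (auto simp del: Diff_iff)
qed

lemma subtopology_rim_tube:
  "subtopology (subtopology (disk l) (rim l)) (tube k l) = subtopology (disk l) (rim l \<inter> tube k l)"
  by (simp add: subtopology_subtopology)

lemma subtopology_prod_snd: "subtopology (prod_topology A B) (topspace A \<times> T) = prod_topology A (subtopology B T)"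
  by (simp add: subtopology_Times)

lemma b_proper_tube:
  assumes "bd m l"
  shows "proper_map (prod_topology (P m l) (subtopology (disk m) (tube k m))) (subtopology (disk l) (rim l \<inter> tube k l)) (b m l)"
proof -
  have "{x \<in> topspace (prod_topology (P m l) (disk m)). b m l x \<in> tube k l} = topspace (P m l) \<times> tube k m"
    using tube_b(1)[OF assms] tube_subset[of k m] by auto
  from proper_map_restriction[OF b_proper[OF assms] this] show ?thesis
    by (simp only: subtopology_prod_snd subtopology_rim_tube)
qed

lemma rim_tube_cover:
  assumes "l \<in> faces"
  shows "rim l \<inter> tube k l \<subseteq> (\<Union>m\<in>{m. bd m l}. b m l ` (topspace (P m l) \<times> tube k m))"
proof
  fix y assume y: "y \<in> rim l \<inter> tube k l"
  then obtain m p x where d: "bd m l" "p \<in> topspace (P m l)" "x \<in> core m" "y = b m l (p, x)"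
    using rimE[OF assms, of y] by blast
  then have "x \<in> tube k m" using tube_b_core(1)[OF d(1-3)] y by simp
  then show "y \<in> (\<Union>m\<in>{m. bd m l}. b m l ` (topspace (P m l) \<times> tube k m))" using d by blast
qed

lemma topspace_tube [simp]: "topspace (subtopology (disk l) (tube k l)) = tube k l"
  using tube_subset[of k l] by auto

lemma tame_tube_self:
  assumes "k \<in> faces"
  shows "tame_tube k k"
  unfolding tame_tube_def
proof (intro conjI ballI)
  note t = tube_self[OF assms]
  show "openin (disk k) (tube k k)" unfolding t(1) by (rule openin_aster_interior)
  have cs: "topspace (subtopology (disk k) (core k)) = core k" using core_subset by auto
  show "continuous_map (subtopology (disk k) (tube k k)) (subtopology (disk k) (core k)) (tube_proj k k)"
    unfolding t(1) by (rule continuous_map_eq[OF continuous_map_id]) (use cs t(2) in auto)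
  show "continuous_map (subtopology (disk k) (tube k k)) euclideanreal (tube_height k k)"
    unfolding t(1) by (rule continuous_map_eq[of _ _ "\<lambda>x. 0"]) (use cs t(3) in auto)
  have "continuous_map (prod_topology (subtopology (disk k) (core k)) (moves_top k)) (subtopology (disk k) (core k)) (\<lambda>y. fst (snd y))"
    by (rule continuous_map_compose[OF continuous_map_snd continuous_map_fst, unfolded o_def])
  then have "continuous_map (prod_topology (subtopology (disk k) (core k)) (moves_top k)) (disk k) (\<lambda>y. fst (snd y))"
    by (rule continuous_map_into_fulltopology)
  then show "continuous_map (prod_topology (subtopology (disk k) (tube k k)) (moves_top k)) (disk k) (\<lambda>y. tube_move k k (fst y) (snd y))"
    unfolding t(1) by (rule continuous_map_eq) (use cs t(4) in auto)
  fix z assume "z \<in> core k"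
  then have "{x \<in> tube k k. tube_proj k k x = z \<and> tube_height k k x \<le> 1} = {z}"
    unfolding t(1) using t(2,3) by auto
  then show "compactin (disk k) {x \<in> tube k k. tube_proj k k x = z \<and> tube_height k k x \<le> 1}"
    using \<open>z \<in> core k\<close> core_subset[of k] by auto
qed

lemma rim_tube_top: "topspace (subtopology (disk l) (rim l \<inter> tube k l)) = rim l \<inter> tube k l"
  using rim_subset[of l] by auto

text \<open>The rim is covered by the proper maps \<open>b m l\<close> from finitely many products
  \<open>P m l \<times> D m\<close>, and \<open>tube_b\<close> says that the tube data pull back
  along them to the tube data of the smaller cones, without dependence on the parameter except in
  the moves.\<close>

lemma tame_rim:
  assumes l: "l \<in> faces" and IH: "\<And>m. bd m l \<Longrightarrow> tame_tube k m"
  shows "openin (subtopology (disk l) (rim l)) (rim l \<inter> tube k l)"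
    and "continuous_map (subtopology (disk l) (rim l \<inter> tube k l)) (subtopology (disk k) (core k)) (tube_proj k l)"
    and "continuous_map (subtopology (disk l) (rim l \<inter> tube k l)) euclideanreal (tube_height k l)"
    and "continuous_map (prod_topology (subtopology (disk l) (rim l \<inter> tube k l)) (moves_top k)) (subtopology (disk l) (rim l)) (\<lambda>y. tube_move k l (fst y) (snd y))"
    and "z \<in> core k \<Longrightarrow> compactin (disk l) {x \<in> rim l \<inter> tube k l. tube_proj k l x = z \<and> tube_height k l x \<le> 1}"
proof -
  note cov = rim_tube_cover[OF l, of k]
  have cov': "topspace (subtopology (disk l) (rim l \<inter> tube k l)) \<subseteq>
    (\<Union>m\<in>{m. bd m l}. b m l ` topspace (prod_topology (P m l) (subtopology (disk m) (tube k m))))"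
    using cov by (simp only: rim_tube_top topspace_prod_topology topspace_tube)
  have bt: "b m l (p, x) \<in> rim l \<inter> tube k l" if "bd m l" "p \<in> topspace (P m l)" "x \<in> tube k m" for m p x
    using b_in[OF that(1,2), of x] tube_b(1)[OF that(1,2), of x k] that(3) tube_subset[of k m] by blast
  show "openin (subtopology (disk l) (rim l)) (rim l \<inter> tube k l)"
  proof (rule openin_proper_cover[OF finite_bd b_proper rim_cover[OF l]])
    fix m assume "m \<in> {m. bd m l}"
    then have m: "bd m l" by simp
    have "{x \<in> topspace (prod_topology (P m l) (disk m)). b m l x \<in> rim l \<inter> tube k l} = topspace (P m l) \<times> tube k m"
      using tube_b(1)[OF m] b_in[OF m] tube_subset[of k m] by auto
    moreover have "openin (prod_topology (P m l) (disk m)) (topspace (P m l) \<times> tube k m)"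
      using IH[OF m] unfolding tame_tube_def openin_prod_Times_iff by blast
    ultimately show "openin (prod_topology (P m l) (disk m)) {x \<in> topspace (prod_topology (P m l) (disk m)). b m l x \<in> rim l \<inter> tube k l}"
      by simp
  qed (use rim_subset[of l] in auto)
  show "continuous_map (subtopology (disk l) (rim l \<inter> tube k l)) (subtopology (disk k) (core k)) (tube_proj k l)"
  proof (rule continuous_map_proper_cover[OF finite_bd b_proper_tube cov'])
    fix m assume "m \<in> {m. bd m l}"
    then have m: "bd m l" by simp
    then have "continuous_map (subtopology (disk m) (tube k m)) (subtopology (disk k) (core k)) (tube_proj k m)"
      using IH[OF m] by (simp only: tame_tube_def)
    then have "continuous_map (prod_topology (P m l) (subtopology (disk m) (tube k m))) (subtopology (disk k) (core k)) (tube_proj k m \<circ> snd)"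
      by (rule continuous_map_compose[OF continuous_map_snd])
    then show "continuous_map (prod_topology (P m l) (subtopology (disk m) (tube k m))) (subtopology (disk k) (core k)) (\<lambda>x. tube_proj k l (b m l x))"
      by (rule continuous_map_eq) (use tube_b(2)[OF m] tube_subset[of k m] in auto)
  qed simp
  show "continuous_map (subtopology (disk l) (rim l \<inter> tube k l)) euclideanreal (tube_height k l)"
  proof (rule continuous_map_proper_cover[OF finite_bd b_proper_tube cov'])
    fix m assume "m \<in> {m. bd m l}"
    then have m: "bd m l" by simp
    then have "continuous_map (subtopology (disk m) (tube k m)) euclideanreal (tube_height k m)"
      using IH[OF m] by (simp only: tame_tube_def)
    then have "continuous_map (prod_topology (P m l) (subtopology (disk m) (tube k m))) euclideanreal (tube_height k m \<circ> snd)"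
      by (rule continuous_map_compose[OF continuous_map_snd])
    then show "continuous_map (prod_topology (P m l) (subtopology (disk m) (tube k m))) euclideanreal (\<lambda>x. tube_height k l (b m l x))"
      by (rule continuous_map_eq) (use tube_b(3)[OF m] tube_subset[of k m] in auto)
  qed simp
  \<comment> \<open>The space of moves is not compact in general, but the product of a proper map
    with its identity is still proper.\<close>
  show "continuous_map (prod_topology (subtopology (disk l) (rim l \<inter> tube k l)) (moves_top k)) (subtopology (disk l) (rim l)) (\<lambda>y. tube_move k l (fst y) (snd y))"
  proof (rule continuous_map_proper_cover[OF finite_bd,
        where K = "\<lambda>m. prod_topology (prod_topology (P m l) (subtopology (disk m) (tube k m))) (moves_top k)"
          and q = "\<lambda>m (x, q). (b m l x, id q)"])
    fix m assume "m \<in> {m. bd m l}"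
    then have m: "bd m l" by simp
    let ?D = "prod_topology (prod_topology (P m l) (subtopology (disk m) (tube k m))) (moves_top k)"
    show "proper_map (prod_topology (prod_topology (P m l) (subtopology (disk m) (tube k m))) (moves_top k))
      (prod_topology (subtopology (disk l) (rim l \<inter> tube k l)) (moves_top k)) (\<lambda>(x, q). (b m l x, id q))"
      unfolding proper_map_prod using b_proper_tube[OF m] proper_map_id by blast
    have "continuous_map (prod_topology (subtopology (disk m) (tube k m)) (moves_top k)) (disk m) (\<lambda>y. tube_move k m (fst y) (snd y))"
      using IH[OF m] by (simp only: tame_tube_def)
    moreover have "continuous_map (prod_topology (prod_topology (P m l) (subtopology (disk m) (tube k m))) (moves_top k))
       (prod_topology (subtopology (disk m) (tube k m)) (moves_top k)) (\<lambda>y. (snd (fst y), snd y))"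
      by (rule continuous_map_pairedI[OF continuous_map_snd_fst continuous_map_snd])
    ultimately have "continuous_map ?D (disk m) ((\<lambda>y. tube_move k m (fst y) (snd y)) \<circ> (\<lambda>y. (snd (fst y), snd y)))"
      by (rule continuous_map_compose[rotated])
    then have "continuous_map ?D (disk m) (\<lambda>y. tube_move k m (snd (fst y)) (snd y))"
      by (simp only: o_def fst_conv snd_conv)
    then have "continuous_map ?D (prod_topology (P m l) (disk m)) (\<lambda>y. (fst (fst y), tube_move k m (snd (fst y)) (snd y)))"
      by (rule continuous_map_pairedI[OF continuous_map_fst_fst])
    then have c: "continuous_map ?D (subtopology (disk l) (rim l)) (b m l \<circ> (\<lambda>y. (fst (fst y), tube_move k m (snd (fst y)) (snd y))))"
      by (rule continuous_map_compose[OF _ b_cont[OF m]])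
    show "continuous_map ?D (subtopology (disk l) (rim l))
      (\<lambda>x. tube_move k l (fst ((\<lambda>(x, q). (b m l x, id q)) x)) (snd ((\<lambda>(x, q). (b m l x, id q)) x)))"
    proof (rule continuous_map_eq[OF c])
      fix y assume "y \<in> topspace (prod_topology (prod_topology (P m l) (subtopology (disk m) (tube k m))) (moves_top k))"
      then have "y \<in> (topspace (P m l) \<times> tube k m) \<times> moves k"
        by (simp only: topspace_prod_topology topspace_tube topspace_core topspace_euclidean_subtopology)
      then obtain v q where vq: "y = (v, q)" "v \<in> topspace (P m l) \<times> tube k m" "q \<in> moves k" by (rule SigmaE)
      from vq(2) obtain p x where px: "v = (p, x)" "p \<in> topspace (P m l)" "x \<in> tube k m" by (rule SigmaE)
      have y: "y = ((p, x), q)" "p \<in> topspace (P m l)" "x \<in> tube k m" "q \<in> moves k"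
        using vq px by simp_all
      have xm: "x \<in> points m" using y(3) tube_subset by blast
      show "(b m l \<circ> (\<lambda>y. (fst (fst y), tube_move k m (snd (fst y)) (snd y)))) y =
         tube_move k l (fst ((\<lambda>(x, q). (b m l x, id q)) y)) (snd ((\<lambda>(x, q). (b m l x, id q)) y))"
        using tube_b(4)[OF m y(2) xm y(3,4)] by (simp add: y(1))
    qed
  next
    show "topspace (prod_topology (subtopology (disk l) (rim l \<inter> tube k l)) (moves_top k)) \<subseteq>
      (\<Union>m\<in>{m. bd m l}. (\<lambda>(x, q). (b m l x, id q)) ` topspace (prod_topology (prod_topology (P m l) (subtopology (disk m) (tube k m))) (moves_top k)))"
    proof
      fix y assume "y \<in> topspace (prod_topology (subtopology (disk l) (rim l \<inter> tube k l)) (moves_top k))"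
      then have "y \<in> (rim l \<inter> tube k l) \<times> moves k"
        by (simp only: topspace_prod_topology rim_tube_top topspace_core topspace_euclidean_subtopology)
      then obtain w q where y: "y = (w, q)" "w \<in> rim l \<inter> tube k l" "q \<in> moves k" by (rule SigmaE)
      have "w \<in> (\<Union>m\<in>{m. bd m l}. b m l ` (topspace (P m l) \<times> tube k m))" by (rule subsetD[OF cov y(2)])
      then obtain m v where m: "m \<in> {m. bd m l}" and v: "v \<in> topspace (P m l) \<times> tube k m" "w = b m l v" by (elim UN_E imageE)
      show "y \<in> (\<Union>m\<in>{m. bd m l}. (\<lambda>(x, q). (b m l x, id q)) ` topspace (prod_topology (prod_topology (P m l) (subtopology (disk m) (tube k m))) (moves_top k)))"
      proof (rule UN_I[OF m], rule image_eqI[of _ _ "(v, q)"])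
        show "y = (case (v, q) of (x, q) \<Rightarrow> (b m l x, id q))" using y(1) v(2) by simp
        show "(v, q) \<in> topspace (prod_topology (prod_topology (P m l) (subtopology (disk m) (tube k m))) (moves_top k))"
          using v(1) y(3) by (simp only: topspace_prod_topology topspace_tube topspace_core topspace_euclidean_subtopology mem_Sigma_iff)
      qed
    qed
  qed
  show "compactin (disk l) {x \<in> rim l \<inter> tube k l. tube_proj k l x = z \<and> tube_height k l x \<le> 1}" if z: "z \<in> core k"
  proof -
    let ?C = "\<lambda>m. {x \<in> tube k m. tube_proj k m x = z \<and> tube_height k m x \<le> 1}"
    have eq: "{x \<in> rim l \<inter> tube k l. tube_proj k l x = z \<and> tube_height k l x \<le> 1} = (\<Union>m\<in>{m. bd m l}. b m l ` (topspace (P m l) \<times> ?C m))"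
    proof
      show "{x \<in> rim l \<inter> tube k l. tube_proj k l x = z \<and> tube_height k l x \<le> 1} \<subseteq> (\<Union>m\<in>{m. bd m l}. b m l ` (topspace (P m l) \<times> ?C m))"
      proof
        fix y assume y: "y \<in> {x \<in> rim l \<inter> tube k l. tube_proj k l x = z \<and> tube_height k l x \<le> 1}"
        then obtain m p x where d: "bd m l" "p \<in> topspace (P m l)" "x \<in> tube k m" "y = b m l (p, x)" using cov by blast
        then have "x \<in> ?C m" using tube_b(2,3)[OF d(1,2)] y tube_subset[of k m] by auto
        then show "y \<in> (\<Union>m\<in>{m. bd m l}. b m l ` (topspace (P m l) \<times> ?C m))" using d by blast
      qed
      show "(\<Union>m\<in>{m. bd m l}. b m l ` (topspace (P m l) \<times> ?C m)) \<subseteq> {x \<in> rim l \<inter> tube k l. tube_proj k l x = z \<and> tube_height k l x \<le> 1}"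
      proof (rule UN_least, rule image_subsetI, clarify)
        fix m p x assume d: "bd m l" "p \<in> topspace (P m l)" "x \<in> tube k m" "tube_height k m x \<le> 1" "z = tube_proj k m x"
        then show "b m l (p, x) \<in> rim l \<inter> tube k l \<and> tube_proj k l (b m l (p, x)) = tube_proj k m x \<and> tube_height k l (b m l (p, x)) \<le> 1"
          using tube_b(2,3)[OF d(1,2)] tube_subset[of k m] bt[OF d(1-3)] by auto
      qed
    qed
    have "compactin (disk l) (b m l ` (topspace (P m l) \<times> ?C m))" if m: "bd m l" for m
    proof (rule image_compactin)
      show "continuous_map (prod_topology (P m l) (disk m)) (disk l) (b m l)"
        using b_cont[OF m] by (rule continuous_map_into_fulltopology)
      have "compactin (disk m) (?C m)" using IH[OF m] z by (simp only: tame_tube_def)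
      moreover have "compactin (P m l) (topspace (P m l))" using compact_P[OF m] by (simp add: compact_space_def)
      ultimately show "compactin (prod_topology (P m l) (disk m)) (topspace (P m l) \<times> ?C m)"
        by (simp add: compactin_Times)
    qed
    then show ?thesis unfolding eq using finite_bd by (intro compactin_Union) auto
  qed
qed

text \<open>For \<open>k \<noteq> l\<close> the tube avoids the apex and is the preimage of its rim
  part under radial projection. All data are those of the projected point, corrected by the cone
  parameter, so they inherit continuity from the rim.\<close>

lemma tame_tube_step:
  assumes l: "l \<in> faces" and kl: "k \<noteq> l" and IH: "\<And>m. bd m l \<Longrightarrow> tame_tube k m"
  shows "tame_tube k l"
proof -
  note R = tame_rim[OF l IH]
  let ?N = "points l - {None}"
  let ?T = "subtopology (disk l) (tube k l)"
  have rt: "radial 1 x \<in> rim l \<inter> tube k l \<longleftrightarrow> x \<in> tube k l" if "x \<in> ?N" for x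
    using tube_radial_rim(1)[OF kl _ _ radial_1_rim[OF that], of "cone_height x"] nonapex_height[OF that]
      radial_self[of x "S l"] radial_1_rim[OF that] that by auto
  have eqs: "tube_proj k l x = tube_proj k l (radial 1 x)"
      "tube_height k l x = max ((1 - cone_height x) / cone_height x) (tube_height k l (radial 1 x))"
      "tube_move k l x q = radial (cone_height x / (cone_height x + snd q * (1 - cone_height x))) (tube_move k l (radial 1 x) q)"
    if "x \<in> tube k l" for x q
  proof -
    have N: "x \<in> ?N" using that tube_nonapex[OF kl] by blast
    have w: "radial 1 x \<in> rim l" "radial 1 x \<in> tube k l" using rt[OF N] that by auto
    have t: "0 < cone_height x" "cone_height x \<le> 1" using nonapex_height[OF N] by auto
    have x: "radial (cone_height x) (radial 1 x) = x" using N by (intro radial_self) auto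
    note r = tube_radial_rim[OF kl t w(1)]
    show "tube_proj k l x = tube_proj k l (radial 1 x)" using r(2)[OF w(2)] x by simp
    show "tube_height k l x = max ((1 - cone_height x) / cone_height x) (tube_height k l (radial 1 x))" using r(3)[OF w(2)] x by simp
    show "tube_move k l x q = radial (cone_height x / (cone_height x + snd q * (1 - cone_height x))) (tube_move k l (radial 1 x) q)"
      using r(4)[OF w(2), of q] x by simp
  qed
  have push: "continuous_map ?T (subtopology (disk l) (rim l \<inter> tube k l)) (radial 1)"
  proof -
    have "continuous_map ?T (subtopology (disk l) (rim l)) (radial 1)"
      using continuous_map_radial_1 tube_nonapex[OF kl] by (rule continuous_map_from_subtopology_mono)
    moreover have "radial 1 x \<in> rim l \<inter> tube k l" if "x \<in> tube k l" for x
      using rt[of x] that tube_nonapex[OF kl] by blast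
    ultimately show ?thesis
      unfolding continuous_map_in_subtopology topspace_tube by blast
  qed
  have ht: "continuous_map ?T (top_of_set {0<..1}) cone_height"
  proof -
    have "cone_height x \<in> {0<..1}" if "x \<in> tube k l" for x
      using nonapex_height[OF subsetD[OF tube_nonapex[OF kl] that]] by simp
    then show ?thesis
      using continuous_map_from_subtopology[OF continuous_map_cone_height]
      unfolding continuous_map_in_subtopology topspace_tube by blast
  qed
  have htr: "continuous_map ?T euclideanreal cone_height"
    using ht by (rule continuous_map_into_fulltopology)
  show ?thesis
    unfolding tame_tube_def
  proof (intro conjI ballI)
    have "topspace (subtopology (disk l) ?N) = ?N" by auto
    then have "tube k l = {x \<in> topspace (subtopology (disk l) ?N). radial 1 x \<in> rim l \<inter> tube k l}"
      using rt tube_nonapex[OF kl] by blast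
    then have "openin (subtopology (disk l) ?N) (tube k l)"
      using openin_continuous_map_preimage[OF continuous_map_radial_1 R(1)] by simp
    then show "openin (disk l) (tube k l)" using openin_nonapex by (rule openin_trans_full)
    have "continuous_map ?T (subtopology (disk k) (core k)) (tube_proj k l \<circ> radial 1)"
      by (rule continuous_map_compose[OF push R(2)])
    then show "continuous_map ?T (subtopology (disk k) (core k)) (tube_proj k l)"
      by (rule continuous_map_eq) (simp only: topspace_tube o_def eqs(1))
    have c1: "continuous_map ?T euclideanreal (\<lambda>x. (1 - cone_height x) / cone_height x)"
      by (intro continuous_map_real_divide continuous_map_diff htr continuous_map_const[THEN iffD2] disjI2)
        (use tube_nonapex[OF kl] nonapex_height in force)+
    have c2: "continuous_map ?T euclideanreal (\<lambda>x. tube_height k l (radial 1 x))"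
      using continuous_map_compose[OF push R(3)] by (simp add: o_def)
    have "continuous_map ?T euclideanreal (\<lambda>x. max ((1 - cone_height x) / cone_height x) (tube_height k l (radial 1 x)))"
      by (rule continuous_map_real_max[OF c1 c2])
    then show "continuous_map ?T euclideanreal (tube_height k l)"
      by (rule continuous_map_eq) (simp only: topspace_tube eqs(2))
    let ?M = "prod_topology ?T (moves_top k)"
    let ?t = "\<lambda>y. cone_height (fst y) / (cone_height (fst y) + snd (snd y) * (1 - cone_height (fst y)))"
    have f: "continuous_map ?M euclideanreal (\<lambda>y. cone_height (fst y))"
      using continuous_map_compose[OF continuous_map_fst htr, of "moves_top k"] by (simp add: o_def)
    have s: "continuous_map ?M euclideanreal (\<lambda>y. snd (snd y))"
    proof -
      have "continuous_map (moves_top k) euclideanreal snd"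
        by (rule continuous_map_into_fulltopology[OF continuous_map_snd])
      then show ?thesis using continuous_map_compose[OF continuous_map_snd, of "moves_top k" euclideanreal snd ?T] by (simp add: o_def)
    qed
    have My: "0 < ?t y \<and> ?t y \<le> 1 \<and> 0 < cone_height (fst y) + snd (snd y) * (1 - cone_height (fst y))" if "y \<in> topspace ?M" for y
    proof -
      have y: "fst y \<in> tube k l" "0 \<le> snd (snd y)" using that by (auto simp only: topspace_prod_topology topspace_tube topspace_core topspace_euclidean_subtopology mem_Times_iff atLeast_iff)
      then have h: "0 < cone_height (fst y)" "cone_height (fst y) \<le> 1" using tube_nonapex[OF kl] nonapex_height by blast+
      then show ?thesis using scaled_height(1,2)[OF h y(2)] y(2) by (simp add: add_pos_nonneg)
    qed
    have "continuous_map ?M euclideanreal ?t"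
    proof (intro continuous_map_real_divide continuous_map_add continuous_map_real_mult continuous_map_diff f s continuous_map_const[THEN iffD2] disjI2)
      show "cone_height (fst y) + snd (snd y) * (1 - cone_height (fst y)) \<noteq> 0" if "y \<in> topspace ?M" for y
        using My[OF that] by linarith
    qed simp
    then have tt: "continuous_map ?M (top_of_set {0<..1}) ?t"
      using My by (auto simp only: continuous_map_in_subtopology Pi_iff greaterThanAtMost_iff)
    have "continuous_map ?M (prod_topology (subtopology (disk l) (rim l \<inter> tube k l)) (moves_top k)) (\<lambda>y. (radial 1 (fst y), snd y))"
      using continuous_map_pairedI[OF continuous_map_compose[OF continuous_map_fst push] continuous_map_snd] by (simp add: o_def)
    from continuous_map_compose[OF this R(4)]
    have "continuous_map ?M (subtopology (disk l) (rim l)) (\<lambda>y. tube_move k l (radial 1 (fst y)) (snd y))"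
      by (simp add: o_def)
    then have "continuous_map ?M (subtopology (disk l) ?N) (\<lambda>y. tube_move k l (radial 1 (fst y)) (snd y))"
      using rim_nonapex[of l] by (auto simp only: continuous_map_in_subtopology Pi_iff)
    from continuous_map_radial[OF tt this]
    show "continuous_map ?M (disk l) (\<lambda>y. tube_move k l (fst y) (snd y))"
    proof (rule continuous_map_eq)
      fix y assume "y \<in> topspace ?M"
      then have "fst y \<in> tube k l" by (simp only: topspace_prod_topology topspace_tube mem_Times_iff)
      then show "radial (?t y) (tube_move k l (radial 1 (fst y)) (snd y)) = tube_move k l (fst y) (snd y)"
        using eqs(3)[of "fst y" "snd y"] by simp
    qed
    fix z assume z: "z \<in> core k"
    let ?C = "{x \<in> rim l \<inter> tube k l. tube_proj k l x = z \<and> tube_height k l x \<le> 1}"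
    have Crim: "?C \<subseteq> rim l" by blast
    \<comment> \<open>The bound 1/2 appears because \<open>(1 - t) / t\<close> is at most 1 exactly
      for \<open>t\<close> at least 1/2.\<close>
    have eq: "{x \<in> tube k l. tube_proj k l x = z \<and> tube_height k l x \<le> 1} = (\<lambda>y. radial (fst y) (snd y)) ` ({1/2..1::real} \<times> ?C)"
    proof
      show "{x \<in> tube k l. tube_proj k l x = z \<and> tube_height k l x \<le> 1} \<subseteq> (\<lambda>y. radial (fst y) (snd y)) ` ({1/2..1::real} \<times> ?C)"
      proof
        fix x assume x: "x \<in> {x \<in> tube k l. tube_proj k l x = z \<and> tube_height k l x \<le> 1}"
        then have N: "x \<in> ?N" using tube_nonapex[OF kl] by blast
        have w: "radial 1 x \<in> rim l \<inter> tube k l" using rt[OF N] x by simp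
        have h: "(1 - cone_height x) / cone_height x \<le> 1" "tube_height k l (radial 1 x) \<le> 1" "tube_proj k l (radial 1 x) = z"
          using x eqs(1,2)[of x] by auto
        have "1/2 \<le> cone_height x" "cone_height x \<le> 1" using h(1) nonapex_height[OF N] by (auto simp: field_simps)
        then have "(cone_height x, radial 1 x) \<in> {1/2..1::real} \<times> ?C" using w h by simp
        moreover have "x = radial (cone_height x) (radial 1 x)" using N radial_self[of x "S l"] by auto
        ultimately show "x \<in> (\<lambda>y. radial (fst y) (snd y)) ` ({1/2..1::real} \<times> ?C)" by (metis (no_types, lifting) fst_conv image_eqI snd_conv)
      qed
      show "(\<lambda>y. radial (fst y) (snd y)) ` ({1/2..1::real} \<times> ?C) \<subseteq> {x \<in> tube k l. tube_proj k l x = z \<and> tube_height k l x \<le> 1}"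
      proof (rule image_subsetI)
        fix y assume y: "y \<in> {1/2..1::real} \<times> ?C"
        then have t: "0 < fst y" "fst y \<le> 1" "1/2 \<le> fst y" and w: "snd y \<in> rim l" "snd y \<in> tube k l" "tube_proj k l (snd y) = z" "tube_height k l (snd y) \<le> 1"
          by auto
        have "(1 - fst y) / fst y \<le> 1" using t by (simp add: divide_le_eq)
        then show "radial (fst y) (snd y) \<in> {x \<in> tube k l. tube_proj k l x = z \<and> tube_height k l x \<le> 1}"
          using tube_radial_rim[OF kl t(1,2) w(1)] w by simp
      qed
    qed
    have "continuous_map (prod_topology (top_of_set {0<..1}) (subtopology (disk l) ?N)) (disk l) (\<lambda>y. radial (fst y) (snd y))"
      by (rule continuous_map_radial[OF continuous_map_fst continuous_map_snd])
    moreover have "compactin (disk l) ?C"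
      by (rule R(5)[OF _ z])
    then have "compactin (subtopology (disk l) ?N) ?C"
      unfolding compactin_subtopology using rim_nonapex[of l] by blast
    then have "compactin (prod_topology (top_of_set {0<..1}) (subtopology (disk l) ?N)) ({1/2..1::real} \<times> ?C)"
      by (auto simp: compactin_Times compactin_subtopology)
    ultimately show "compactin (disk l) {x \<in> tube k l. tube_proj k l x = z \<and> tube_height k l x \<le> 1}"
      unfolding eq by (rule image_compactin[rotated])
  qed
qed

lemma tame_tube:
  assumes "k \<in> faces" "l \<in> faces"
  shows "tame_tube k l"
  using assms(2)
proof (induction l rule: bd_induct)
  case (less l)
  show ?case
  proof (cases "k = l")
    case True
    then show ?thesis using tame_tube_self[OF assms(1)] by simp
  next
    case False
    then show ?thesis using tame_tube_step[OF less.prems False] less.IH bd_faces by blast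
  qed
qed

end

text \<open>
  \<open>r\<close> is the projection onto the stratum \<open>k\<close>, \<open>h\<close> the height above it, and \<open>N x (z, s)\<close> lies over \<open>z\<close>
  at \<open>s\<close> times the height of \<open>x\<close>.
\<close>

definition conical_tube ::
  "'x topology \<Rightarrow> ('x \<Rightarrow> 'l::order) \<Rightarrow> 'l \<Rightarrow> 'x set \<Rightarrow> ('x \<Rightarrow> 'x) \<Rightarrow> ('x \<Rightarrow> real) \<Rightarrow> ('x \<Rightarrow> 'x \<times> real \<Rightarrow> 'x) \<Rightarrow> bool" where
  "conical_tube X \<pi> k U r h N \<longleftrightarrow>
     openin X U \<and> stratum X \<pi> k \<subseteq> U \<and> (\<forall>x\<in>U. k \<le> \<pi> x) \<and>
     continuous_map (subtopology X U) (subtopology X (stratum X \<pi> k)) r \<and>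
     continuous_map (subtopology X U) euclideanreal h \<and>
     continuous_map (prod_topology (subtopology X U) (prod_topology (subtopology X (stratum X \<pi> k)) (top_of_set {0..})))
       X (\<lambda>y. N (fst y) (snd y)) \<and>
     (\<forall>z\<in>stratum X \<pi> k. compactin X {x \<in> U. r x = z \<and> h x \<le> 1}) \<and>
     (\<forall>x\<in>U. 0 \<le> h x \<and> (h x = 0 \<longleftrightarrow> \<pi> x = k) \<and> (\<pi> x = k \<longrightarrow> r x = x) \<and> N x (r x, 1) = x \<and>
       (\<forall>z\<in>stratum X \<pi> k. N x (z, 0) = z \<and> (\<forall>s\<ge>0. N x (z, s) \<in> U \<and> r (N x (z, s)) = z \<and> h (N x (z, s)) = s * h x \<and>
         (0 < s \<longrightarrow> \<pi> (N x (z, s)) = \<pi> x) \<and>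
         (\<forall>z'\<in>stratum X \<pi> k. \<forall>s'\<ge>0. N (N x (z, s)) (z', s') = N x (z', s * s')))))"

section \<open>Descent of the tubes from the cones to \<open>X\<close>\<close>

context full_cone_cnsss
begin

definition lift :: "'x \<Rightarrow> 's cone_point" where
  "lift x = (THE y. y \<in> core (\<pi> x) \<and> \<phi> (\<pi> x) y = x)"

lemma face_in: "x \<in> topspace X \<Longrightarrow> \<pi> x \<in> faces"
  by (auto simp: face_poset_def)

lemma lift_\<phi>:
  assumes "l \<in> faces" "y \<in> core l"
  shows "lift (\<phi> l y) = y"
  unfolding lift_def \<pi>_\<phi>_core[OF assms]
  by (rule the_equality) (use assms \<phi>_inj[OF assms(1)] in auto)

lemma lift_in:
  assumes "x \<in> topspace X"
  shows "lift x \<in> core (\<pi> x)" "\<phi> (\<pi> x) (lift x) = x"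
proof -
  obtain y where y: "y \<in> core (\<pi> x)" "\<phi> (\<pi> x) y = x" using \<phi>_surj[OF assms] .
  then have "lift x = y" using lift_\<phi>[OF face_in[OF assms] y(1)] by simp
  then show "lift x \<in> core (\<pi> x)" "\<phi> (\<pi> x) (lift x) = x" using y by simp_all
qed

lemma continuous_map_lift:
  assumes k: "k \<in> faces"
  shows "continuous_map (subtopology X (stratum X \<pi> k)) (subtopology (disk k) (core k)) lift"
proof -
  obtain g where g: "homeomorphic_maps (subtopology (disk k) (core k)) (subtopology X (stratum X \<pi> k)) (\<phi> k) g"
    using \<phi>_homeo[OF k] unfolding homeomorphic_map_maps by blast
  then have "continuous_map (subtopology X (stratum X \<pi> k)) (subtopology (disk k) (core k)) g"
    by (simp add: homeomorphic_maps_def)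
  then show ?thesis
  proof (rule continuous_map_eq)
    fix x assume "x \<in> topspace (subtopology X (stratum X \<pi> k))"
    then have x: "x \<in> \<phi> k ` core k" by (simp add: \<phi>_image_core[OF k] stratum_def)
    then obtain y where y: "y \<in> core k" "x = \<phi> k y" by blast
    have "g (\<phi> k y) = y" using g y(1) by (simp only: homeomorphic_maps_def topspace_core)
    then show "g x = lift x" using lift_\<phi>[OF k y(1)] y(2) by simp
  qed
qed

definition nbhd :: "'l \<Rightarrow> 'x set" where
  "nbhd k = {x \<in> topspace X. lift x \<in> tube k (\<pi> x)}"

definition nbhd_proj :: "'l \<Rightarrow> 'x \<Rightarrow> 'x" where
  "nbhd_proj k x = \<phi> k (tube_proj k (\<pi> x) (lift x))"

definition nbhd_height :: "'l \<Rightarrow> 'x \<Rightarrow> real" where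
  "nbhd_height k x = tube_height k (\<pi> x) (lift x)"

definition nbhd_shift :: "'l \<Rightarrow> 'x \<Rightarrow> 's cone_point \<times> real \<Rightarrow> 'x" where
  "nbhd_shift k x q = \<phi> (\<pi> x) (tube_move k (\<pi> x) (lift x) q)"

definition nbhd_move :: "'l \<Rightarrow> 'x \<Rightarrow> 'x \<times> real \<Rightarrow> 'x" where
  "nbhd_move k x q = nbhd_shift k x (lift (fst q), snd q)"

text \<open>The data on \<open>X\<close> are defined through the cell that contains the point, that
  is, through cores. By \<open>\<phi>_b\<close> and \<open>tube_b\<close> the same formulas hold on
  the rims of larger cones. So they are valid on each compact cone, and openness and continuity can
  be checked there.\<close>

lemma nbhd_\<phi>:
  assumes l: "l \<in> faces" and y: "y \<in> points l"
  shows "\<phi> l y \<in> nbhd k \<longleftrightarrow> y \<in> tube k l"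
    and "y \<in> tube k l \<Longrightarrow> nbhd_proj k (\<phi> l y) = \<phi> k (tube_proj k l y)"
    and "y \<in> tube k l \<Longrightarrow> nbhd_height k (\<phi> l y) = tube_height k l y"
    and "y \<in> tube k l \<Longrightarrow> q \<in> moves k \<Longrightarrow> nbhd_shift k (\<phi> l y) q = \<phi> l (tube_move k l y q)"
proof -
  have core: "(\<phi> l y \<in> nbhd k \<longleftrightarrow> y \<in> tube k l) \<and> nbhd_proj k (\<phi> l y) = \<phi> k (tube_proj k l y) \<and>
      nbhd_height k (\<phi> l y) = tube_height k l y \<and> nbhd_shift k (\<phi> l y) q = \<phi> l (tube_move k l y q)"
    if "l \<in> faces" "y \<in> core l" for l y
    using \<pi>_\<phi>_core[OF that] lift_\<phi>[OF that] \<phi>_in[OF that(1) subsetD[OF core_subset that(2)]]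
    by (simp add: nbhd_def nbhd_proj_def nbhd_height_def nbhd_shift_def)
  have "(\<phi> l y \<in> nbhd k \<longleftrightarrow> y \<in> tube k l) \<and> (y \<in> tube k l \<longrightarrow> nbhd_proj k (\<phi> l y) = \<phi> k (tube_proj k l y) \<and>
      nbhd_height k (\<phi> l y) = tube_height k l y \<and> (q \<in> moves k \<longrightarrow> nbhd_shift k (\<phi> l y) q = \<phi> l (tube_move k l y q)))"
  proof (cases "y \<in> core l")
    case True
    then show ?thesis using core[OF l] by simp
  next
    case False
    then have "y \<in> rim l" using core_or_rim[OF y] by simp
    then obtain m p x where d: "bd m l" "p \<in> topspace (P m l)" "x \<in> core m" "y = b m l (p, x)"
      using rimE[OF l] by blast
    have m: "m \<in> faces" using bd_faces[OF d(1)] by simp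
    have xm: "x \<in> points m" by (rule subsetD[OF core_subset d(3)])
    have eq: "\<phi> l y = \<phi> m x" using \<phi>_b[OF d(1,2) xm] d(4) by simp
    note tb = tube_b[OF d(1,2) xm, folded d(4)]
    show ?thesis
    proof (intro conjI impI)
      show "\<phi> l y \<in> nbhd k \<longleftrightarrow> y \<in> tube k l" using core[OF m d(3)] eq tb(1) by simp
      assume "y \<in> tube k l"
      then have x: "x \<in> tube k m" using tb(1) by simp
      show "nbhd_proj k (\<phi> l y) = \<phi> k (tube_proj k l y)" using core[OF m d(3)] eq tb(2)[OF x] by simp
      show "nbhd_height k (\<phi> l y) = tube_height k l y" using core[OF m d(3)] eq tb(3)[OF x] by simp
      assume q: "q \<in> moves k"
      show "nbhd_shift k (\<phi> l y) q = \<phi> l (tube_move k l y q)"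
        using core[OF m d(3)] eq tb(4)[OF x q] \<phi>_b[OF d(1,2) tube_move_in[OF x q]] by simp
    qed
  qed
  then show "\<phi> l y \<in> nbhd k \<longleftrightarrow> y \<in> tube k l"
    and "y \<in> tube k l \<Longrightarrow> nbhd_proj k (\<phi> l y) = \<phi> k (tube_proj k l y)"
    and "y \<in> tube k l \<Longrightarrow> nbhd_height k (\<phi> l y) = tube_height k l y"
    and "y \<in> tube k l \<Longrightarrow> q \<in> moves k \<Longrightarrow> nbhd_shift k (\<phi> l y) q = \<phi> l (tube_move k l y q)"
    by blast+
qed

lemma nbhd_subset: "nbhd k \<subseteq> topspace X"
  by (auto simp: nbhd_def)

lemma topspace_nbhd [simp]: "topspace (subtopology X (nbhd k)) = nbhd k"
  using nbhd_subset by auto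

lemma \<phi>_proper_tube:
  assumes "l \<in> faces"
  shows "proper_map (subtopology (disk l) (tube k l)) (subtopology X (nbhd k)) (\<phi> l)"
proof (rule proper_map_restriction[OF \<phi>_proper[OF assms]])
  show "{x \<in> topspace (disk l). \<phi> l x \<in> nbhd k} = tube k l"
    using nbhd_\<phi>(1)[OF assms] tube_subset[of k l] by auto
qed

lemma nbhd_cover: "nbhd k \<subseteq> (\<Union>l\<in>faces. \<phi> l ` tube k l)"
proof
  fix x assume x: "x \<in> nbhd k"
  then have xX: "x \<in> topspace X" and t: "lift x \<in> tube k (\<pi> x)" by (auto simp: nbhd_def)
  have "x = \<phi> (\<pi> x) (lift x)" using lift_in(2)[OF xX] by simp
  then show "x \<in> (\<Union>l\<in>faces. \<phi> l ` tube k l)" using t face_in[OF xX] by blast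
qed

lemma openin_nbhd:
  assumes k: "k \<in> faces"
  shows "openin X (nbhd k)"
proof (rule openin_proper_cover[OF finite_face_poset \<phi>_proper])
  show "topspace X \<subseteq> (\<Union>l\<in>faces. \<phi> l ` topspace (disk l))"
  proof
    fix x assume x: "x \<in> topspace X"
    have "x = \<phi> (\<pi> x) (lift x)" using lift_in(2)[OF x] by simp
    moreover have "lift x \<in> topspace (disk (\<pi> x))" using subsetD[OF core_subset lift_in(1)[OF x]] by simp
    ultimately show "x \<in> (\<Union>l\<in>faces. \<phi> l ` topspace (disk l))" using face_in[OF x] by blast
  qed
  fix l assume l: "l \<in> faces"
  have "{x \<in> topspace (disk l). \<phi> l x \<in> nbhd k} = tube k l"
    using nbhd_\<phi>(1)[OF l] tube_subset[of k l] by auto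
  then show "openin (disk l) {x \<in> topspace (disk l). \<phi> l x \<in> nbhd k}"
    using tame_tube[OF k l] by (simp add: tame_tube_def)
qed (use nbhd_subset in auto)

lemma nbhd_cover': "topspace (subtopology X (nbhd k)) \<subseteq> (\<Union>l\<in>faces. \<phi> l ` topspace (subtopology (disk l) (tube k l)))"
  using nbhd_cover by (simp only: topspace_nbhd topspace_tube)

lemma continuous_map_\<phi>_core: "k \<in> faces \<Longrightarrow> continuous_map (subtopology (disk k) (core k)) (subtopology X (stratum X \<pi> k)) (\<phi> k)"
  using \<phi>_homeo homeomorphic_imp_continuous_map by blast

lemma continuous_map_nbhd_proj:
  assumes k: "k \<in> faces"
  shows "continuous_map (subtopology X (nbhd k)) (subtopology X (stratum X \<pi> k)) (nbhd_proj k)"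
proof (rule continuous_map_proper_cover[OF finite_face_poset \<phi>_proper_tube nbhd_cover'])
  fix l assume l: "l \<in> faces"
  have "continuous_map (subtopology (disk l) (tube k l)) (subtopology (disk k) (core k)) (tube_proj k l)"
    using tame_tube[OF k l] by (simp only: tame_tube_def)
  from continuous_map_compose[OF this continuous_map_\<phi>_core[OF k]]
  show "continuous_map (subtopology (disk l) (tube k l)) (subtopology X (stratum X \<pi> k)) (\<lambda>y. nbhd_proj k (\<phi> l y))"
    by (rule continuous_map_eq) (simp only: topspace_tube o_def nbhd_\<phi>(2)[OF l subsetD[OF tube_subset]])
qed

lemma continuous_map_nbhd_height:
  assumes k: "k \<in> faces"
  shows "continuous_map (subtopology X (nbhd k)) euclideanreal (nbhd_height k)"
proof (rule continuous_map_proper_cover[OF finite_face_poset \<phi>_proper_tube nbhd_cover'])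
  fix l assume l: "l \<in> faces"
  have "continuous_map (subtopology (disk l) (tube k l)) euclideanreal (tube_height k l)"
    using tame_tube[OF k l] by (simp only: tame_tube_def)
  then show "continuous_map (subtopology (disk l) (tube k l)) euclideanreal (\<lambda>y. nbhd_height k (\<phi> l y))"
    by (rule continuous_map_eq) (simp only: topspace_tube nbhd_\<phi>(3)[OF l subsetD[OF tube_subset]])
qed

lemma continuous_map_nbhd_shift:
  assumes k: "k \<in> faces"
  shows "continuous_map (prod_topology (subtopology X (nbhd k)) (moves_top k)) X (\<lambda>y. nbhd_shift k (fst y) (snd y))"
proof (rule continuous_map_proper_cover[OF finite_face_poset,
        where K = "\<lambda>l. prod_topology (subtopology (disk l) (tube k l)) (moves_top k)" and q = "\<lambda>l (x, q). (\<phi> l x, id q)"])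
  fix l assume l: "l \<in> faces"
  let ?D = "prod_topology (subtopology (disk l) (tube k l)) (moves_top k)"
  show "proper_map ?D (prod_topology (subtopology X (nbhd k)) (moves_top k)) (\<lambda>(x, q). (\<phi> l x, id q))"
    unfolding proper_map_prod using \<phi>_proper_tube[OF l] proper_map_id by blast
  have "continuous_map ?D (disk l) (\<lambda>y. tube_move k l (fst y) (snd y))"
    using tame_tube[OF k l] by (simp only: tame_tube_def)
  from continuous_map_compose[OF this \<phi>_cont[OF l]]
  have c: "continuous_map ?D X (\<phi> l \<circ> (\<lambda>y. tube_move k l (fst y) (snd y)))" .
  show "continuous_map ?D X (\<lambda>x. nbhd_shift k (fst ((\<lambda>(x, q). (\<phi> l x, id q)) x)) (snd ((\<lambda>(x, q). (\<phi> l x, id q)) x)))"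
  proof (rule continuous_map_eq[OF c])
    fix y assume "y \<in> topspace ?D"
    then have "y \<in> tube k l \<times> moves k"
      by (simp only: topspace_prod_topology topspace_tube topspace_core topspace_euclidean_subtopology)
    then obtain x q where y: "y = (x, q)" "x \<in> tube k l" "q \<in> moves k" by (rule SigmaE)
    show "(\<phi> l \<circ> (\<lambda>y. tube_move k l (fst y) (snd y))) y =
      nbhd_shift k (fst ((\<lambda>(x, q). (\<phi> l x, id q)) y)) (snd ((\<lambda>(x, q). (\<phi> l x, id q)) y))"
      using nbhd_\<phi>(4)[OF l subsetD[OF tube_subset y(2)] y(2,3)] by (simp add: y(1))
  qed
next
  show "topspace (prod_topology (subtopology X (nbhd k)) (moves_top k)) \<subseteq>
    (\<Union>l\<in>faces. (\<lambda>(x, q). (\<phi> l x, id q)) ` topspace (prod_topology (subtopology (disk l) (tube k l)) (moves_top k)))"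
  proof
    fix y assume "y \<in> topspace (prod_topology (subtopology X (nbhd k)) (moves_top k))"
    then have "y \<in> nbhd k \<times> moves k"
      by (simp only: topspace_prod_topology topspace_nbhd topspace_core topspace_euclidean_subtopology)
    then obtain x q where y: "y = (x, q)" "x \<in> nbhd k" "q \<in> moves k" by (rule SigmaE)
    from subsetD[OF nbhd_cover y(2)] obtain l w where l: "l \<in> faces" and w: "x = \<phi> l w" "w \<in> tube k l" by (elim UN_E imageE)
    show "y \<in> (\<Union>l\<in>faces. (\<lambda>(x, q). (\<phi> l x, id q)) ` topspace (prod_topology (subtopology (disk l) (tube k l)) (moves_top k)))"
    proof (rule UN_I[OF l], rule image_eqI[of _ _ "(w, q)"])
      show "y = (case (w, q) of (x, q) \<Rightarrow> (\<phi> l x, id q))" using y(1) w(1) by simp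
      show "(w, q) \<in> topspace (prod_topology (subtopology (disk l) (tube k l)) (moves_top k))"
        using w(2) y(3) by (simp only: topspace_prod_topology topspace_tube topspace_core topspace_euclidean_subtopology mem_Sigma_iff)
    qed
  qed
qed

lemma continuous_map_nbhd_move:
  assumes k: "k \<in> faces"
  shows "continuous_map (prod_topology (subtopology X (nbhd k)) (prod_topology (subtopology X (stratum X \<pi> k)) (top_of_set {0..})))
    X (\<lambda>y. nbhd_move k (fst y) (snd y))"
proof -
  let ?M = "prod_topology (subtopology X (nbhd k)) (prod_topology (subtopology X (stratum X \<pi> k)) (top_of_set {0::real..}))"
  have 1: "continuous_map ?M (subtopology X (stratum X \<pi> k)) (fst \<circ> snd)"
    by (rule continuous_map_compose[OF continuous_map_snd continuous_map_fst])
  have 2: "continuous_map ?M (top_of_set {0::real..}) (snd \<circ> snd)"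
    by (rule continuous_map_compose[OF continuous_map_snd continuous_map_snd])
  have 3: "continuous_map ?M (subtopology (disk k) (core k)) (lift \<circ> (fst \<circ> snd))"
    by (rule continuous_map_compose[OF 1 continuous_map_lift[OF k]])
  have "continuous_map ?M (prod_topology (subtopology X (nbhd k)) (moves_top k)) (\<lambda>y. (fst y, (lift \<circ> (fst \<circ> snd)) y, (snd \<circ> snd) y))"
    by (rule continuous_map_pairedI[OF continuous_map_fst continuous_map_pairedI[OF 3 2]])
  from continuous_map_compose[OF this continuous_map_nbhd_shift[OF k]]
  show ?thesis by (simp add: o_def nbhd_move_def)
qed

text \<open>Each clause is read off in the cone of the cell containing the point. The compact fibre
  is a finite union of images of compact fibres in the cones.\<close>

theorem conical_tube_nbhd:
  assumes k: "k \<in> faces"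
  shows "conical_tube X \<pi> k (nbhd k) (nbhd_proj k) (nbhd_height k) (nbhd_move k)"
  unfolding conical_tube_def
proof (intro conjI ballI allI impI)
  show "openin X (nbhd k)" by (rule openin_nbhd[OF k])
  show "stratum X \<pi> k \<subseteq> nbhd k"
  proof
    fix x assume x: "x \<in> stratum X \<pi> k"
    then have "x \<in> topspace X" "\<pi> x = k" by (auto simp: stratum_def)
    then show "x \<in> nbhd k" using lift_in(1)[of x] tube_self(1)[OF k] by (simp add: nbhd_def)
  qed
  show "continuous_map (subtopology X (nbhd k)) (subtopology X (stratum X \<pi> k)) (nbhd_proj k)"
    by (rule continuous_map_nbhd_proj[OF k])
  show "continuous_map (subtopology X (nbhd k)) euclideanreal (nbhd_height k)"
    by (rule continuous_map_nbhd_height[OF k])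
  show "continuous_map (prod_topology (subtopology X (nbhd k)) (prod_topology (subtopology X (stratum X \<pi> k)) (top_of_set {0..})))
    X (\<lambda>y. nbhd_move k (fst y) (snd y))"
    by (rule continuous_map_nbhd_move[OF k])
  have lift_k: "lift z \<in> core k" "\<phi> k (lift z) = z" if "z \<in> stratum X \<pi> k" for z
    using that lift_in[of z] by (auto simp: stratum_def)
  fix z assume z: "z \<in> stratum X \<pi> k"
  show "compactin X {x \<in> nbhd k. nbhd_proj k x = z \<and> nbhd_height k x \<le> 1}"
  proof -
    let ?C = "\<lambda>l. {y \<in> tube k l. tube_proj k l y = lift z \<and> tube_height k l y \<le> 1}"
    have "{x \<in> nbhd k. nbhd_proj k x = z \<and> nbhd_height k x \<le> 1} = (\<Union>l\<in>faces. \<phi> l ` ?C l)"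
    proof
      show "{x \<in> nbhd k. nbhd_proj k x = z \<and> nbhd_height k x \<le> 1} \<subseteq> (\<Union>l\<in>faces. \<phi> l ` ?C l)"
      proof
        fix x assume x: "x \<in> {x \<in> nbhd k. nbhd_proj k x = z \<and> nbhd_height k x \<le> 1}"
        then have xX: "x \<in> topspace X" and t: "lift x \<in> tube k (\<pi> x)" by (auto simp: nbhd_def)
        have "\<phi> k (tube_proj k (\<pi> x) (lift x)) = \<phi> k (lift z)" using x lift_k[OF z] by (simp add: nbhd_proj_def)
        then have "tube_proj k (\<pi> x) (lift x) = lift z" by (rule \<phi>_inj[OF k tube_proj_in[OF t] lift_k(1)[OF z]])
        then have "lift x \<in> ?C (\<pi> x)" using t x by (simp add: nbhd_height_def)
        moreover have "x = \<phi> (\<pi> x) (lift x)" using lift_in(2)[OF xX] by simp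
        ultimately show "x \<in> (\<Union>l\<in>faces. \<phi> l ` ?C l)" using face_in[OF xX] by blast
      qed
      show "(\<Union>l\<in>faces. \<phi> l ` ?C l) \<subseteq> {x \<in> nbhd k. nbhd_proj k x = z \<and> nbhd_height k x \<le> 1}"
      proof (rule UN_least, rule image_subsetI)
        fix l y assume l: "l \<in> faces" and y: "y \<in> ?C l"
        then have yt: "y \<in> tube k l" by simp
        note ny = nbhd_\<phi>[OF l subsetD[OF tube_subset yt]]
        show "\<phi> l y \<in> {x \<in> nbhd k. nbhd_proj k x = z \<and> nbhd_height k x \<le> 1}"
          using y ny(1) ny(2,3)[OF yt] lift_k(2)[OF z] by simp
      qed
    qed
    moreover have "compactin X (\<phi> l ` ?C l)" if "l \<in> faces" for l
    proof (rule image_compactin[OF _ \<phi>_cont[OF that]])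
      show "compactin (disk l) (?C l)" using tame_tube[OF k that] lift_k(1)[OF z] by (simp only: tame_tube_def)
    qed
    then have "compactin X (\<Union>l\<in>faces. \<phi> l ` ?C l)" using finite_face_poset by (intro compactin_Union) auto
    ultimately show ?thesis by simp
  qed
next
  fix x assume x: "x \<in> nbhd k"
  then have xX: "x \<in> topspace X" and t: "lift x \<in> tube k (\<pi> x)" by (auto simp: nbhd_def)
  note l = face_in[OF xX] and lx = lift_in[OF xX]
  show "k \<le> \<pi> x" by (rule tube_le[OF t])
  show "0 \<le> nbhd_height k x" unfolding nbhd_height_def by (rule tube_height_nonneg[OF t])
  have props: "tube_move k (\<pi> x) (lift x) (lift z, s) \<in> tube k (\<pi> x) \<and>
     tube_proj k (\<pi> x) (tube_move k (\<pi> x) (lift x) (lift z, s)) = lift z \<and>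
     tube_height k (\<pi> x) (tube_move k (\<pi> x) (lift x) (lift z, s)) = s * tube_height k (\<pi> x) (lift x) \<and>
     (\<forall>z'\<in>core k. \<forall>s'\<ge>0. tube_move k (\<pi> x) (tube_move k (\<pi> x) (lift x) (lift z, s)) (z', s') = tube_move k (\<pi> x) (lift x) (z', s * s')) \<and>
     \<phi> (\<pi> x) (tube_move k (\<pi> x) (lift x) (lift z, 0)) = \<phi> k (lift z) \<and>
     (0 < s \<longrightarrow> tube_move k (\<pi> x) (lift x) (lift z, s) \<in> core (\<pi> x))"
    if "z \<in> stratum X \<pi> k" "0 \<le> s" for z s
  proof -
    have "lift z \<in> core k" using that(1) lift_in(1)[of z] by (auto simp: stratum_def)
    from tube_move_props[OF t this that(2)] lx(1) show ?thesis by blast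
  qed
  show "nbhd_height k x = 0 \<longleftrightarrow> \<pi> x = k"
    using tube_height_0[OF t lx(1)] tube_self(3)[OF k, of "lift x"] lx(1) by (auto simp: nbhd_height_def)
  show "nbhd_proj k x = x" if "\<pi> x = k"
    using tube_self(2)[OF k, of "lift x"] lx that by (simp add: nbhd_proj_def)
  show "nbhd_move k x (nbhd_proj k x, 1) = x"
  proof -
    have "tube_move k (\<pi> x) (lift x) (tube_proj k (\<pi> x) (lift x), 1) = lift x"
      using tube_move_props[OF t tube_proj_in[OF t], of 1] by simp
    then show ?thesis
      using lift_\<phi>[OF k tube_proj_in[OF t]] lx(2) by (simp add: nbhd_move_def nbhd_shift_def nbhd_proj_def)
  qed
  fix z assume z: "z \<in> stratum X \<pi> k"
  have lz: "lift z \<in> core k" "\<phi> k (lift z) = z" using z lift_in[of z] by (auto simp: stratum_def)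
  show "nbhd_move k x (z, 0) = z"
    using props[OF z, of 0] lz by (simp add: nbhd_move_def nbhd_shift_def)
  fix s :: real assume s: "0 \<le> s"
  let ?y = "tube_move k (\<pi> x) (lift x) (lift z, s)"
  have y: "?y \<in> tube k (\<pi> x)" using props[OF z s] by blast
  have eq: "nbhd_move k x (z, s) = \<phi> (\<pi> x) ?y" by (simp add: nbhd_move_def nbhd_shift_def)
  note ny = nbhd_\<phi>[OF l subsetD[OF tube_subset y]]
  show "nbhd_move k x (z, s) \<in> nbhd k" unfolding eq using ny(1) y by blast
  show "nbhd_proj k (nbhd_move k x (z, s)) = z" unfolding eq using ny(2)[OF y] props[OF z s] lz(2) by simp
  show "nbhd_height k (nbhd_move k x (z, s)) = s * nbhd_height k x"
    unfolding eq ny(3)[OF y] using props[OF z s] by (simp add: nbhd_height_def)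
  show "\<pi> (nbhd_move k x (z, s)) = \<pi> x" if "0 < s"
    unfolding eq using props[OF z s] that by (intro \<pi>_\<phi>_core[OF l]) blast
  fix z' and s' :: real assume z': "z' \<in> stratum X \<pi> k" and s': "0 \<le> s'"
  have lz': "lift z' \<in> core k" using z' lift_in(1)[of z'] by (auto simp: stratum_def)
  then have q: "(lift z', s') \<in> moves k" using s' by simp
  show "nbhd_move k (nbhd_move k x (z, s)) (z', s') = nbhd_move k x (z', s * s')"
    unfolding eq unfolding nbhd_move_def fst_conv snd_conv ny(4)[OF y q]
    using props[OF z s] lz' s' by (simp add: nbhd_shift_def)
qed

end

section \<open>Conical charts\<close>

text \<open>\<open>t / (1 - t)\<close> identifies \<open>[0,1)\<close> with the heights
  \<open>[0,\<infinity>)\<close>. The chart moves the slice point \<open>y\<close> over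
  \<open>z\<close> and scales its height from 1 to that value. The inverse records base point and
  height, and moves \<open>x\<close> back over \<open>z0\<close> at height 1; both composites are
  trivial because scales multiply.\<close>

lemma conical_chart:
  fixes X :: "'x topology" and \<pi> :: "'x \<Rightarrow> 'l::order"
  assumes T: "conical_tube X \<pi> k U r h N" and X: "Hausdorff_space X" and z0: "z0 \<in> stratum X \<pi> k"
  defines "Z \<equiv> subtopology X (stratum X \<pi> k)"
  defines "Y \<equiv> subtopology X {x \<in> U. r x = z0 \<and> h x = 1}"
  obtains \<Psi> where "homeomorphic_map (prod_topology Z (open_cone Y)) (subtopology X U) \<Psi>"
    "\<And>z w. z \<in> topspace Z \<Longrightarrow> w \<in> topspace (open_cone Y) \<Longrightarrow> \<pi> (\<Psi> (z, w)) = open_cone_strat k \<pi> w"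
proof -
  let ?S = "stratum X \<pi> k"
  let ?Y = "{x \<in> U. r x = z0 \<and> h x = 1}"
  have opU: "openin X U" and SU: "?S \<subseteq> U"
    and r_cont: "continuous_map (subtopology X U) Z r"
    and h_cont: "continuous_map (subtopology X U) euclideanreal h"
    and N_cont: "continuous_map (prod_topology (subtopology X U) (prod_topology Z (top_of_set {0..}))) X (\<lambda>y. N (fst y) (snd y))"
    and cpt: "compactin X {x \<in> U. r x = z0 \<and> h x \<le> 1}"
    using T z0 unfolding conical_tube_def Z_def by blast+
  have props: "0 \<le> h x" "h x = 0 \<longleftrightarrow> \<pi> x = k" "\<pi> x = k \<Longrightarrow> r x = x" "N x (r x, 1) = x" if "x \<in> U" for x
    using T that unfolding conical_tube_def by blast+
  have N0: "N x (z, 0) = z" if "x \<in> U" "z \<in> ?S" for x z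
    using T that unfolding conical_tube_def by blast
  have Np: "N x (z, s) \<in> U" "r (N x (z, s)) = z" "h (N x (z, s)) = s * h x" if "x \<in> U" "z \<in> ?S" "0 \<le> s" for x z s
    using T that unfolding conical_tube_def by blast+
  have N\<pi>: "\<pi> (N x (z, s)) = \<pi> x" if "x \<in> U" "z \<in> ?S" "0 < s" for x z s
    using T that unfolding conical_tube_def by (meson less_imp_le)
  have NN: "N (N x (z, s)) (z', s') = N x (z', s * s')" if "x \<in> U" "z \<in> ?S" "0 \<le> s" "z' \<in> ?S" "0 \<le> s'" for x z s z' s'
    using T that unfolding conical_tube_def by blast
  have UX: "U \<subseteq> topspace X" using openin_subset[OF opU] .
  have topU: "topspace (subtopology X U) = U" using UX by auto
  have topZ: "topspace Z = ?S" by (auto simp: Z_def stratum_def)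
  have topY: "topspace Y = ?Y" using UX by (auto simp: Y_def)
  have r_in: "r x \<in> ?S" if "x \<in> U" for x
    using continuous_map_image_subset_topspace[OF r_cont] that topU topZ by auto
  have compY: "compact_space Y"
  proof -
    have "closedin (subtopology X U) {x \<in> topspace (subtopology X U). h x \<in> {1}}"
      by (rule closedin_continuous_map_preimage[OF h_cont]) simp
    then have "closedin (subtopology X U) {x \<in> U. h x = 1}" by (simp only: topU singleton_iff)
    moreover have "compactin (subtopology X U) {x \<in> U. r x = z0 \<and> h x \<le> 1}"
      unfolding compactin_subtopology using cpt by blast
    ultimately have "compactin (subtopology X U) ({x \<in> U. h x = 1} \<inter> {x \<in> U. r x = z0 \<and> h x \<le> 1})"
      by (rule closed_Int_compactin)
    moreover have "{x \<in> U. h x = 1} \<inter> {x \<in> U. r x = z0 \<and> h x \<le> 1} = ?Y" by auto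
    ultimately have "compactin (subtopology X U) ?Y" by (simp only:)
    then have "compactin X ?Y" unfolding compactin_subtopology by (rule conjunct1)
    then show ?thesis unfolding Y_def by (rule compact_space_subtopology)
  qed
  have HausY: "Hausdorff_space Y" unfolding Y_def using X by (rule Hausdorff_space_subtopology)
  have topC: "topspace (open_cone Y) = {x \<in> cone_carrier Y. cone_height x < 1}"
    by (auto simp: open_cone_def cone_carrier_def cone_height_def)
  define \<Psi> where "\<Psi> = (\<lambda>v. case snd v of None \<Rightarrow> fst v | Some (t, y) \<Rightarrow> N y (fst v, t / (1 - t)))"
  \<comment> \<open>At height 0 the scale \<open>1 / 0\<close> is 0, but this default is invisible:
    \<open>cone_pt 0\<close> is the apex for every base point.\<close>
  define \<Xi> where "\<Xi> = (\<lambda>x. cone_pt (h x / (1 + h x)) (N x (z0, 1 / h x)))"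
  have \<Psi>_pt: "\<Psi> (z, cone_pt t y) = N y (z, t / (1 - t))" if "z \<in> ?S" "y \<in> ?Y" for z t y
    using that N0 by (auto simp: \<Psi>_def cone_pt_def)
  have coneE: "w = None \<or> (\<exists>t y. w = Some (t, y) \<and> 0 < t \<and> t < 1 \<and> y \<in> ?Y)" if "w \<in> topspace (open_cone Y)" for w
    using that unfolding topC topY[symmetric] by (auto simp: cone_carrier_def)
  have \<Psi>_cont: "continuous_map (prod_topology Z (open_cone Y)) X \<Psi>"
  proof (cases "?Y = {}")
    \<comment> \<open>With an empty slice the open cone is the apex alone, which no cylinder covers;
      the chart is then the projection to \<open>Z\<close>.\<close>
    case True
    have "continuous_map (prod_topology Z (open_cone Y)) X fst"
      using continuous_map_into_fulltopology[OF continuous_map_fst] unfolding Z_def by blast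
    then show ?thesis
    proof (rule continuous_map_eq)
      fix v assume "v \<in> topspace (prod_topology Z (open_cone Y))"
      then have "snd v = None" using coneE[of "snd v"] True unfolding topspace_prod_topology mem_Times_iff by blast
      then show "fst v = \<Psi> v" by (simp add: \<Psi>_def)
    qed
  next
    case False
    let ?I = "top_of_set {0..<1::real}"
    \<comment> \<open>As \<open>Y\<close> is compact, the half-open cylinder maps properly to the
      open cone, and this survives the product with \<open>Z\<close>, compact or not. So continuity
      can be tested in cylinder coordinates.\<close>
    have "proper_map (prod_topology (top_of_set {0..1}) Y) (cone_topology Y) (case_prod cone_pt)"
      by (intro continuous_imp_proper_map Hausdorff_imp_kc_space Hausdorff_space_cone HausY continuous_map_cone_pt)
        (simp add: compact_space_prod_topology compact_space_subtopology compY)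
    moreover have "{v \<in> topspace (prod_topology (top_of_set {0..1}) Y). case_prod cone_pt v \<in> {x. \<forall>t y. x = Some (t, y) \<longrightarrow> t < 1}} = {0..<1} \<times> topspace Y"
      by (auto simp: cone_pt_def split: if_splits)
    ultimately have "proper_map (subtopology (prod_topology (top_of_set {0..1}) Y) ({0..<1} \<times> topspace Y)) (open_cone Y) (case_prod cone_pt)"
      unfolding open_cone_def by (rule proper_map_restriction)
    moreover have "subtopology (prod_topology (top_of_set {0..1::real}) Y) ({0..<1} \<times> topspace Y) = prod_topology ?I Y"
    proof -
      have "{0..1::real} \<inter> {0..<1} = {0..<1}" by auto
      then show ?thesis by (simp add: subtopology_Times subtopology_subtopology)
    qed
    ultimately have pr: "proper_map (prod_topology ?I Y) (open_cone Y) (case_prod cone_pt)" by (simp only:)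
    show ?thesis
    proof (rule continuous_map_proper_cover[where I = "{()}" and K = "\<lambda>_. prod_topology Z (prod_topology ?I Y)"
          and q = "\<lambda>_ (z, v). (id z, case_prod cone_pt v)"])
      show "proper_map (prod_topology Z (prod_topology ?I Y)) (prod_topology Z (open_cone Y)) (\<lambda>(z, v). (id z, case_prod cone_pt v))"
        by (rule proper_map_prod[THEN iffD2, OF disjI2, OF conjI[OF proper_map_id pr]])
      have t: "continuous_map (prod_topology Z (prod_topology ?I Y)) euclideanreal (\<lambda>v. fst (snd v))"
        using continuous_map_into_fulltopology[OF continuous_map_compose[OF continuous_map_snd continuous_map_fst, of Z ?I Y]] by (simp add: o_def)
      have "continuous_map (prod_topology Z (prod_topology ?I Y)) euclideanreal (\<lambda>v. fst (snd v) / (1 - fst (snd v)))"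
        by (intro continuous_map_real_divide continuous_map_diff t continuous_map_const[THEN iffD2] disjI2) auto
      then have t': "continuous_map (prod_topology Z (prod_topology ?I Y)) (top_of_set {0..}) (\<lambda>v. fst (snd v) / (1 - fst (snd v)))"
        by (auto simp: continuous_map_in_subtopology)
      have y: "continuous_map (prod_topology Z (prod_topology ?I Y)) (subtopology X U) (snd \<circ> snd)"
      proof (rule continuous_map_compose[OF continuous_map_snd])
        have "continuous_map (prod_topology ?I Y) Y snd" by (rule continuous_map_snd)
        then have "continuous_map (prod_topology ?I Y) X snd" unfolding Y_def by (rule continuous_map_into_fulltopology)
        then show "continuous_map (prod_topology ?I Y) (subtopology X U) snd"
          unfolding continuous_map_in_subtopology topspace_prod_topology topY by auto
      qed
      have "continuous_map (prod_topology Z (prod_topology ?I Y)) (prod_topology (subtopology X U) (prod_topology Z (top_of_set {0..})))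
         (\<lambda>v. ((snd \<circ> snd) v, fst v, fst (snd v) / (1 - fst (snd v))))"
        by (rule continuous_map_pairedI[OF y continuous_map_pairedI[OF continuous_map_fst t']])
      from continuous_map_compose[OF this N_cont]
      show "continuous_map (prod_topology Z (prod_topology ?I Y)) X (\<lambda>v. \<Psi> ((\<lambda>(z, v). (id z, case_prod cone_pt v)) v))"
        by (rule continuous_map_eq) (auto simp: topZ topY \<Psi>_pt)
      show "topspace (prod_topology Z (open_cone Y)) \<subseteq> (\<Union>i\<in>{()}. (\<lambda>(z, v). (id z, case_prod cone_pt v)) ` topspace (prod_topology Z (prod_topology ?I Y)))"
      proof
        fix v assume v: "v \<in> topspace (prod_topology Z (open_cone Y))"
        obtain z w where vzw: "v = (z, w)" by (cases v)
    have "z \<in> ?S \<and> w \<in> topspace (open_cone Y)"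
      using v unfolding vzw topspace_prod_topology topZ mem_Sigma_iff .
    then have zw: "v = (z, w)" "z \<in> ?S" "w \<in> topspace (open_cone Y)"
      using vzw by blast+
        obtain y0 where y0: "y0 \<in> ?Y" using False by blast
        have "\<exists>t y. t \<in> {0..<1} \<and> y \<in> ?Y \<and> w = cone_pt t y"
          using coneE[OF zw(3)]
        proof
          assume "w = None"
          then show ?thesis using y0 by (intro exI[of _ 0] exI[of _ y0]) (simp add: cone_pt_def)
        next
          assume "\<exists>t y. w = Some (t, y) \<and> 0 < t \<and> t < 1 \<and> y \<in> ?Y"
          then obtain t y where ty: "w = Some (t, y)" "0 < t" "t < 1" "y \<in> ?Y" by blast
          then show ?thesis by (intro exI[of _ t] exI[of _ y]) (simp add: cone_pt_def)
        qed
        then obtain t y where ty: "t \<in> {0..<1}" "y \<in> ?Y" "w = cone_pt t y" by blast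
        have "v = (\<lambda>(z, v). (id z, case_prod cone_pt v)) (z, (t, y))" using zw ty by simp
        moreover have "(z, (t, y)) \<in> topspace (prod_topology Z (prod_topology ?I Y))"
          using zw(2) ty(1,2) topZ topY by simp
        ultimately show "v \<in> (\<Union>i\<in>{()}. (\<lambda>(z, v). (id z, case_prod cone_pt v)) ` topspace (prod_topology Z (prod_topology ?I Y)))"
          by blast
      qed
    qed simp
  qed
  have \<Psi>_in: "\<Psi> v \<in> U" if "v \<in> topspace (prod_topology Z (open_cone Y))" for v
  proof -
    have z: "fst v \<in> ?S" and w: "snd v \<in> topspace (open_cone Y)"
      using that unfolding topspace_prod_topology topZ mem_Times_iff by blast+
    show ?thesis
      using coneE[OF w] z SU Np(1) by (auto simp: \<Psi>_def)
  qed
  have \<Psi>_contU: "continuous_map (prod_topology Z (open_cone Y)) (subtopology X U) \<Psi>"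
    unfolding continuous_map_in_subtopology using \<Psi>_cont \<Psi>_in by blast
  have NY: "N x (z0, 1 / h x) \<in> ?Y" if "x \<in> U" "0 < h x" for x
    using Np[OF that(1) z0, of "1 / h x"] that(2) by simp
  have hpos: "0 < h x" if "x \<in> U" "h x \<noteq> 0" for x using props(1)[OF that(1)] that(2) by simp
  have \<Xi>_0: "\<Xi> x = None" if "h x = 0" for x using that by (simp add: \<Xi>_def cone_pt_def)
  have \<Xi>_pos: "\<Xi> x = Some (h x / (1 + h x), N x (z0, 1 / h x))" if "0 < h x" for x
    using that by (simp add: \<Xi>_def cone_pt_def add_pos_pos)
  have \<Xi>_in: "\<Xi> x \<in> topspace (open_cone Y)" if x: "x \<in> U" for x
  proof (cases "h x = 0")
    case True
    then show ?thesis by (simp add: topC \<Xi>_0)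
  next
    case False
    then have hx: "0 < h x" using hpos[OF x] by simp
    have "N x (z0, 1 / h x) \<in> topspace Y" unfolding topY by (rule NY[OF x hx])
    then show ?thesis unfolding topC \<Xi>_pos[OF hx] using hx by (simp add: Some_in_cone_carrier)
  qed
  have \<Xi>_height: "cone_height (\<Xi> x) = h x / (1 + h x)" for x by (simp add: \<Xi>_def)
  have \<Xi>_cont0: "continuous_map (subtopology X U) (cone_topology Y) \<Xi>"
    unfolding continuous_map_def
  proof (intro conjI allI impI)
    show "\<Xi> \<in> topspace (subtopology X U) \<rightarrow> topspace (cone_topology Y)"
      using \<Xi>_in topU topC by auto
    fix W assume W: "openin (cone_topology Y) W"
    let ?U' = "{x \<in> U. 0 < h x}"
    have "openin (subtopology X U) {x \<in> topspace (subtopology X U). h x \<in> {0<..}}"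
      by (rule openin_continuous_map_preimage[OF h_cont]) simp
    then have opU': "openin (subtopology X U) ?U'" by (simp only: topU greaterThan_iff)
    have U'U: "subtopology (subtopology X U) ?U' = subtopology X ?U'"
    proof -
      have "U \<inter> ?U' = ?U'" by auto
      then show ?thesis by (simp add: subtopology_subtopology)
    qed
    have topU': "topspace (subtopology X ?U') = ?U'" using UX by auto
    have h': "continuous_map (subtopology X ?U') euclideanreal h"
      using continuous_map_from_subtopology[OF h_cont, of ?U'] unfolding U'U .
    have id': "continuous_map (subtopology X ?U') (subtopology X U) (\<lambda>x. x)"
      using UX by (auto simp: continuous_map_in_subtopology intro: continuous_map_from_subtopology)
    have inv: "continuous_map (subtopology X ?U') (top_of_set {0..}) (\<lambda>x. 1 / h x)"
    proof -
      have "continuous_map (subtopology X ?U') euclideanreal (\<lambda>x. 1 / h x)"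
        by (intro continuous_map_real_divide h' continuous_map_const[THEN iffD2] disjI2) auto
      then show ?thesis by (auto simp: continuous_map_in_subtopology)
    qed
    have "continuous_map (subtopology X ?U') (prod_topology (subtopology X U) (prod_topology Z (top_of_set {0..}))) (\<lambda>x. (x, z0, 1 / h x))"
      by (rule continuous_map_pairedI[OF id' continuous_map_pairedI[OF _ inv]]) (simp add: topZ z0)
    from continuous_map_compose[OF this N_cont]
    have "continuous_map (subtopology X ?U') X (\<lambda>x. N x (z0, 1 / h x))" by (simp add: o_def)
    then have n': "continuous_map (subtopology X ?U') Y (\<lambda>x. N x (z0, 1 / h x))"
      unfolding Y_def continuous_map_in_subtopology topU' using NY by blast
    have t': "continuous_map (subtopology X ?U') (top_of_set {0..1}) (\<lambda>x. h x / (1 + h x))"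
    proof -
      have "continuous_map (subtopology X ?U') euclideanreal (\<lambda>x. h x / (1 + h x))"
        by (intro continuous_map_real_divide continuous_map_add h' continuous_map_const[THEN iffD2] disjI2) (auto simp: add_eq_0_iff)
      then show ?thesis by (auto simp: continuous_map_in_subtopology)
    qed
    have "continuous_map (subtopology X ?U') (cone_topology Y) (case_prod cone_pt \<circ> (\<lambda>x. (h x / (1 + h x), N x (z0, 1 / h x))))"
      by (rule continuous_map_compose[OF continuous_map_pairedI[OF t' n'] continuous_map_cone_pt])
    then have c': "continuous_map (subtopology X ?U') (cone_topology Y) \<Xi>"
      by (rule continuous_map_eq) (simp add: \<Xi>_def)
    have "openin (subtopology (subtopology X U) ?U') {x \<in> ?U'. \<Xi> x \<in> W}"
      using openin_continuous_map_preimage[OF c' W] unfolding topU' U'U .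
    then have A: "openin (subtopology X U) {x \<in> ?U'. \<Xi> x \<in> W}"
      using opU' by (rule openin_trans_full)
    show "openin (subtopology X U) {x \<in> topspace (subtopology X U). \<Xi> x \<in> W}"
    proof (cases "None \<in> W")
      case False
      have "0 < h x" if "x \<in> U" "\<Xi> x \<in> W" for x
        using \<Xi>_0[of x] hpos[OF that(1)] that(2) False by (cases "h x = 0") auto
      then have "{x \<in> topspace (subtopology X U). \<Xi> x \<in> W} = {x \<in> ?U'. \<Xi> x \<in> W}"
        unfolding topU by blast
      then show ?thesis using A by simp
    next
      \<comment> \<open>Around the apex only the height has to be controlled: since \<open>Y\<close>
        is compact, \<open>W\<close> contains all points of small height.\<close>
      case True
      obtain \<epsilon> where e: "0 < \<epsilon>" "\<And>x. x \<in> cone_carrier Y \<Longrightarrow> cone_height x < \<epsilon> \<Longrightarrow> x \<in> W"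
        by (rule openin_cone_apex[OF compY W True]) blast
      have hh: "continuous_map (subtopology X U) euclideanreal (\<lambda>x. h x / (1 + h x))"
      proof (intro continuous_map_real_divide continuous_map_add h_cont continuous_map_const[THEN iffD2] disjI2)
        show "1 + h x \<noteq> 0" if "x \<in> topspace (subtopology X U)" for x using props(1)[of x] that topU by auto
      qed auto
      have "openin (subtopology X U) {x \<in> topspace (subtopology X U). h x / (1 + h x) \<in> {..<\<epsilon>}}"
        by (rule openin_continuous_map_preimage[OF hh]) simp
      then have B: "openin (subtopology X U) {x \<in> U. h x / (1 + h x) < \<epsilon>}" by (simp only: topU lessThan_iff)
      have BW: "\<Xi> x \<in> W" if "x \<in> U" "h x / (1 + h x) < \<epsilon>" for x
        using e(2)[of "\<Xi> x"] \<Xi>_in[OF that(1)] that(2) topC \<Xi>_height by auto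
      have "{x \<in> topspace (subtopology X U). \<Xi> x \<in> W} = {x \<in> ?U'. \<Xi> x \<in> W} \<union> {x \<in> U. h x / (1 + h x) < \<epsilon>}"
      proof
        show "{x \<in> topspace (subtopology X U). \<Xi> x \<in> W} \<subseteq> {x \<in> ?U'. \<Xi> x \<in> W} \<union> {x \<in> U. h x / (1 + h x) < \<epsilon>}"
          unfolding topU using hpos e(1) by force
        show "{x \<in> ?U'. \<Xi> x \<in> W} \<union> {x \<in> U. h x / (1 + h x) < \<epsilon>} \<subseteq> {x \<in> topspace (subtopology X U). \<Xi> x \<in> W}"
          unfolding topU using BW by blast
      qed
      then show ?thesis using A B by (simp add: openin_Un)
    qed
  qed
  have \<Xi>_cont: "continuous_map (subtopology X U) (open_cone Y) \<Xi>"
  proof -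
    have "\<Xi> x \<in> {x. \<forall>t y. x = Some (t, y) \<longrightarrow> t < 1}" if "x \<in> U" for x
      using \<Xi>_in[OF that] by (auto simp: topC)
    then show ?thesis
      unfolding open_cone_def continuous_map_in_subtopology topU using \<Xi>_cont0 by blast
  qed
  have maps: "homeomorphic_maps (prod_topology Z (open_cone Y)) (subtopology X U) \<Psi> (\<lambda>x. (r x, \<Xi> x))"
    unfolding homeomorphic_maps_def
  proof (intro conjI ballI)
    show "continuous_map (prod_topology Z (open_cone Y)) (subtopology X U) \<Psi>" by (rule \<Psi>_contU)
    show "continuous_map (subtopology X U) (prod_topology Z (open_cone Y)) (\<lambda>x. (r x, \<Xi> x))"
      by (rule continuous_map_pairedI[OF r_cont \<Xi>_cont])
    fix v assume v: "v \<in> topspace (prod_topology Z (open_cone Y))"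
    obtain z w where vzw: "v = (z, w)" by (cases v)
    have "z \<in> ?S \<and> w \<in> topspace (open_cone Y)"
      using v unfolding vzw topspace_prod_topology topZ mem_Sigma_iff .
    then have zw: "v = (z, w)" "z \<in> ?S" "w \<in> topspace (open_cone Y)"
      using vzw by blast+
    show "(r (\<Psi> v), \<Xi> (\<Psi> v)) = v"
      using coneE[OF zw(3)]
    proof
      assume w: "w = None"
      have zU: "z \<in> U" using zw(2) SU by blast
      have "\<pi> z = k" using zw(2) by (simp add: stratum_def)
      then show ?thesis using props(2,3)[OF zU] w zw(1) by (simp add: \<Psi>_def \<Xi>_0)
    next
      assume "\<exists>t y. w = Some (t, y) \<and> 0 < t \<and> t < 1 \<and> y \<in> ?Y"
      then obtain t y where ty: "w = Some (t, y)" "0 < t" "t < 1" "y \<in> U" "r y = z0" "h y = 1" by blast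
      let ?u = "t / (1 - t)"
      have u: "0 < ?u" using ty(2,3) by simp
      have \<Psi>v: "\<Psi> v = N y (z, ?u)" using zw(1) ty(1) by (simp add: \<Psi>_def)
      note np = Np[OF ty(4) zw(2) less_imp_le[OF u]]
      have hx: "h (\<Psi> v) = ?u" using np(3) ty(6) \<Psi>v by simp
      have "?u / (1 + ?u) = t" using ty(3) by (simp add: field_simps)
      moreover have "N (\<Psi> v) (z0, 1 / ?u) = y"
      proof -
        have "N (\<Psi> v) (z0, 1 / ?u) = N y (z0, ?u * (1 / ?u))"
          unfolding \<Psi>v using u ty(2,3) by (intro NN[OF ty(4) zw(2) _ z0]) simp_all
        also have "?u * (1 / ?u) = 1" using ty(2,3) by simp
        also have "N y (z0, 1) = y" using props(4)[OF ty(4)] ty(5) by simp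
        finally show ?thesis .
      qed
      ultimately have "\<Xi> (\<Psi> v) = w" using \<Xi>_pos[of "\<Psi> v"] u ty(1) unfolding hx by simp
      then show ?thesis using np(2) \<Psi>v zw(1) by simp
    qed
  next
    fix x assume "x \<in> topspace (subtopology X U)"
    then have x: "x \<in> U" using topU by simp
    show "\<Psi> (r x, \<Xi> x) = x"
    proof (cases "h x = 0")
      case True
      then show ?thesis using props(2,3)[OF x] by (simp add: \<Psi>_def \<Xi>_0)
    next
      case False
      then have hx: "0 < h x" using hpos[OF x] by simp
      have "h x / (1 + h x) / (1 - h x / (1 + h x)) = h x" using hx by (simp add: field_simps)
      then have "\<Psi> (r x, \<Xi> x) = N (N x (z0, 1 / h x)) (r x, h x)"
        unfolding \<Xi>_pos[OF hx] by (simp add: \<Psi>_def)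
      also have "\<dots> = N x (r x, 1 / h x * h x)"
        using hx r_in[OF x] by (intro NN[OF x z0]) auto
      also have "\<dots> = x" using hx props(4)[OF x] by simp
      finally show ?thesis .
    qed
  qed
  show thesis
  proof (rule that)
    show "homeomorphic_map (prod_topology Z (open_cone Y)) (subtopology X U) \<Psi>"
      using maps unfolding homeomorphic_map_maps by blast
    fix z w assume z: "z \<in> topspace Z" and w: "w \<in> topspace (open_cone Y)"
    have zS: "z \<in> ?S" using z topZ by simp
    show "\<pi> (\<Psi> (z, w)) = open_cone_strat k \<pi> w"
      using coneE[OF w]
    proof
      assume "w = None"
      then show ?thesis using zS by (simp add: \<Psi>_def stratum_def)
    next
      assume "\<exists>t y. w = Some (t, y) \<and> 0 < t \<and> t < 1 \<and> y \<in> ?Y"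
      then obtain t y where ty: "w = Some (t, y)" "0 < t" "t < 1" "y \<in> U" by blast
      then show ?thesis using N\<pi>[OF ty(4) zS, of "t / (1 - t)"] by (simp add: \<Psi>_def)
    qed
  qed
qed

text \<open>The slice is taken over the given point \<open>x\<close> itself. Its points have height
  1, not 0, so they lie in strata strictly above that of \<open>x\<close>.\<close>

theorem conically_stratified_tubes:
  fixes X :: "'x topology" and \<pi> :: "'x \<Rightarrow> 'l::order"
  assumes X: "Hausdorff_space X" "continuous_map X alexandroff \<pi>"
    and T: "\<And>k. k \<in> face_poset X \<pi> \<Longrightarrow> conical_tube X \<pi> k (U k) (r k) (h k) (N k)"
  shows "conically_stratified X \<pi>"
  unfolding conically_stratified_def
proof
  fix x assume x: "x \<in> topspace X"
  let ?k = "\<pi> x"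
  let ?Z = "subtopology X (stratum X \<pi> ?k)"
  let ?Y = "subtopology X {y \<in> U ?k. r ?k y = x \<and> h ?k y = 1}"
  have k: "?k \<in> face_poset X \<pi>" using x by (auto simp: face_poset_def)
  have xS: "x \<in> stratum X \<pi> ?k" using x by (simp add: stratum_def)
  obtain \<Psi> where \<Psi>: "homeomorphic_map (prod_topology ?Z (open_cone ?Y)) (subtopology X (U ?k)) \<Psi>"
    "\<And>z w. z \<in> topspace ?Z \<Longrightarrow> w \<in> topspace (open_cone ?Y) \<Longrightarrow> \<pi> (\<Psi> (z, w)) = open_cone_strat ?k \<pi> w"
    by (rule conical_chart[OF T[OF k] X(1) xS]) blast
  have opU: "openin X (U ?k)" and SU: "stratum X \<pi> ?k \<subseteq> U ?k" and le: "\<And>y. y \<in> U ?k \<Longrightarrow> ?k \<le> \<pi> y"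
    and h0: "\<And>y. y \<in> U ?k \<Longrightarrow> h ?k y = 0 \<longleftrightarrow> \<pi> y = ?k"
    using T[OF k] unfolding conical_tube_def by blast+
  have UX: "U ?k \<subseteq> topspace X" by (rule openin_subset[OF opU])
  have im: "\<Psi> ` topspace (prod_topology ?Z (open_cone ?Y)) = U ?k"
    using homeomorphic_imp_surjective_map[OF \<Psi>(1)] UX by auto
  show "\<exists>(Y :: 'x topology) \<rho> (Z :: 'x topology) h. continuous_map Y (subtopology alexandroff {l \<in> face_poset X \<pi>. \<pi> x < l}) \<rho> \<and>
        embedding_map (prod_topology Z (open_cone Y)) X h \<and>
        open_map (prod_topology Z (open_cone Y)) X h \<and>
        (\<forall>z\<in>topspace Z. \<forall>w\<in>topspace (open_cone Y). \<pi> (h (z, w)) = open_cone_strat (\<pi> x) \<rho> w) \<and>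
        x \<in> h ` topspace (prod_topology Z (open_cone Y))"
  proof (intro exI conjI)
    show "continuous_map ?Y (subtopology alexandroff {l \<in> face_poset X \<pi>. \<pi> x < l}) \<pi>"
      unfolding continuous_map_in_subtopology
    proof (rule conjI)
      show "continuous_map ?Y alexandroff \<pi>" by (rule continuous_map_from_subtopology[OF X(2)])
      show "\<pi> \<in> topspace ?Y \<rightarrow> {l \<in> face_poset X \<pi>. \<pi> x < l}"
      proof (rule Pi_I)
        fix y assume "y \<in> topspace ?Y"
        then have y: "y \<in> topspace X" "y \<in> U ?k" "h ?k y = 1" by auto
        then have "\<pi> y \<noteq> \<pi> x" using h0[of y] by auto
        then show "\<pi> y \<in> {l \<in> face_poset X \<pi>. \<pi> x < l}" using le[OF y(2)] y(1) by (auto simp: face_poset_def)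
      qed
    qed
    show "embedding_map (prod_topology ?Z (open_cone ?Y)) X \<Psi>"
      unfolding embedding_map_def im by (rule \<Psi>(1))
    show "open_map (prod_topology ?Z (open_cone ?Y)) X \<Psi>"
      unfolding open_map_def
    proof (intro allI impI)
      fix V assume "openin (prod_topology ?Z (open_cone ?Y)) V"
      then have "openin (subtopology X (U ?k)) (\<Psi> ` V)"
        using homeomorphic_imp_open_map[OF \<Psi>(1)] by (simp add: open_map_def)
      then show "openin X (\<Psi> ` V)" using opU by (rule openin_trans_full)
    qed
    show "\<forall>z\<in>topspace ?Z. \<forall>w\<in>topspace (open_cone ?Y). \<pi> (\<Psi> (z, w)) = open_cone_strat (\<pi> x) \<pi> w"
      using \<Psi>(2) by blast
    show "x \<in> \<Psi> ` topspace (prod_topology ?Z (open_cone ?Y))"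
      unfolding im using SU xS by blast
  qed
qed

section \<open>Embedding into Euclidean space\<close>

text \<open>Each coordinate extends by the Tietze theorem, but the extension may leave the disk. It
  is multiplied by a Urysohn function that is 1 on \<open>S\<close> and 0 where the norm has reached
  1.\<close>

lemma absolute_extensor_open_disk:
  "absolute_extensor TYPE('a::{metric_space,second_countable_topology})
     {x :: nat \<Rightarrow> real. (\<forall>i\<ge>n. x i = 0) \<and> (\<Sum>i<n. (x i)\<^sup>2) < 1}" (is "absolute_extensor _ ?D")
  unfolding absolute_extensor_def
proof (intro allI impI)
  fix N S :: "'a set" and f
  assume "closedin (top_of_set N) S \<and> continuous_on S f \<and> f ` S \<subseteq> ?D"
  then have S: "closedin (top_of_set N) S" and f: "continuous_on S f" "\<And>x. x \<in> S \<Longrightarrow> f x \<in> ?D" by auto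
  have "\<exists>g. continuous_on N g \<and> (\<forall>x\<in>S. g x = f x i)" for i
    using Tietze_unbounded[OF continuous_on_product_then_coordinatewise[OF f(1)] S] by metis
  then obtain g where g: "\<And>i. continuous_on N (g i)" "\<And>i x. x \<in> S \<Longrightarrow> g i x = f x i" by metis
  define q where "q x = (\<Sum>i<n. (g i x)\<^sup>2)" for x
  have q: "continuous_on N q" unfolding q_def using g(1) by (intro continuous_intros)
  define B where "B = N \<inter> q -` {1..}"
  have cl: "closedin (top_of_set N) B" unfolding B_def using q by (intro continuous_closedin_preimage) auto
  have disj: "B \<inter> S = {}"
  proof -
    have "q x < 1" if "x \<in> S" for x using f(2)[OF that] g(2)[OF that] by (simp add: q_def)
    then show ?thesis by (force simp: B_def)
  qed
  obtain \<theta> :: "'a \<Rightarrow> real" where \<theta>: "continuous_on N \<theta>" "\<And>x. 0 \<le> \<theta> x \<and> \<theta> x \<le> 1"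
    "\<And>x. x \<in> B \<Longrightarrow> \<theta> x = 0" "\<And>x. x \<in> S \<Longrightarrow> \<theta> x = 1"
    by (rule Urysohn_metric[OF cl S disj]) blast
  define G where "G x = (\<lambda>i. if i < n then \<theta> x * g i x else 0)" for x
  show "\<exists>g. continuous_on N g \<and> g ` N \<subseteq> ?D \<and> (\<forall>x\<in>S. g x = f x)"
  proof (intro exI[of _ G] conjI ballI)
    show "continuous_on N G"
    proof (rule continuous_on_coordinatewise_then_product)
      show "continuous_on N (\<lambda>x. G x i)" for i
        unfolding G_def using \<theta>(1) g(1)[of i] by (cases "i < n") (auto intro!: continuous_on_mult)
    qed
    show "G ` N \<subseteq> ?D"
    proof (rule image_subsetI)
      fix x assume x: "x \<in> N"
      have "(\<Sum>i<n. (G x i)\<^sup>2) = (\<theta> x)\<^sup>2 * q x"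
        by (simp add: G_def q_def power_mult_distrib sum_distrib_left)
      also have "\<dots> < 1"
      proof (cases "1 \<le> q x")
        case True
        then show ?thesis using \<theta>(3)[of x] x by (simp add: B_def)
      next
        case False
        have "(\<theta> x)\<^sup>2 * q x \<le> 1 * q x"
          using \<theta>(2)[of x] by (intro mult_right_mono) (auto simp: power_le_one q_def sum_nonneg)
        then show ?thesis using False by simp
      qed
      finally show "G x \<in> ?D" by (simp add: G_def)
    qed
    show "G x = f x" if "x \<in> S" for x
    proof
      show "G x i = f x i" for i using f(2)[OF that] g(2)[OF that] \<theta>(4)[OF that] by (auto simp: G_def)
    qed
  qed
qed

lemma absolute_extensor_retract:
  assumes A: "absolute_extensor TYPE('a::topological_space) A"
    and u: "continuous_on A u" "u ` A \<subseteq> B" and v: "continuous_on B v" "v ` B \<subseteq> A"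
    and uv: "\<And>x. x \<in> B \<Longrightarrow> u (v x) = x"
  shows "absolute_extensor TYPE('a) B"
  unfolding absolute_extensor_def
proof (intro allI impI)
  fix N S :: "'a set" and f
  assume "closedin (top_of_set N) S \<and> continuous_on S f \<and> f ` S \<subseteq> B"
  then have S: "closedin (top_of_set N) S" and f: "continuous_on S f" "f ` S \<subseteq> B" by auto
  have vf: "continuous_on S (\<lambda>x. v (f x))" by (rule continuous_on_compose2[OF v(1) f])
  have "(\<lambda>x. v (f x)) ` S \<subseteq> A" using f(2) v(2) by blast
  then obtain g where g: "continuous_on N g" "g ` N \<subseteq> A" "\<And>x. x \<in> S \<Longrightarrow> g x = v (f x)"
    by (rule absolute_extensorD[OF A S vf]) blast
  show "\<exists>g. continuous_on N g \<and> g ` N \<subseteq> B \<and> (\<forall>x\<in>S. g x = f x)"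
  proof (intro exI[of _ "\<lambda>x. u (g x)"] conjI ballI)
    show "continuous_on N (\<lambda>x. u (g x))" by (rule continuous_on_compose2[OF u(1) g(1,2)])
    show "(\<lambda>x. u (g x)) ` N \<subseteq> B" using g(2) u(2) by blast
    show "u (g x) = f x" if "x \<in> S" for x
    proof -
      have "f x \<in> B" using f(2) that by blast
      then show ?thesis using g(3)[OF that] uv by simp
    qed
  qed
qed

section \<open>Compactness of \<open>X\<close> and a countable family of functions separating its
  points\<close>

context full_cone_cnsss
begin

lemma compact_X: "compact_space X"
proof -
  have "topspace X = (\<Union>l\<in>faces. \<phi> l ` points l)"
  proof
    show "topspace X \<subseteq> (\<Union>l\<in>faces. \<phi> l ` points l)"
    proof
      fix x assume x: "x \<in> topspace X"
      have "x = \<phi> (\<pi> x) (lift x)" using lift_in(2)[OF x] by simp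
      moreover have "lift x \<in> points (\<pi> x)" by (rule subsetD[OF core_subset lift_in(1)[OF x]])
      ultimately show "x \<in> (\<Union>l\<in>faces. \<phi> l ` points l)" using face_in[OF x] by blast
    qed
    show "(\<Union>l\<in>faces. \<phi> l ` points l) \<subseteq> topspace X" using \<phi>_in by blast
  qed
  moreover have "compactin X (\<Union>l\<in>faces. \<phi> l ` points l)"
  proof (rule compactin_Union)
    show "finite ((\<lambda>l. \<phi> l ` points l) ` faces)" using finite_face_poset by simp
    fix A assume "A \<in> (\<lambda>l. \<phi> l ` points l) ` faces"
    then obtain l where l: "l \<in> faces" "A = \<phi> l ` points l" by blast
    have "compactin (disk l) (points l)" using disk_compact[OF l(1)] by (simp add: compact_space_def)
    then show "compactin X A" unfolding l(2) by (rule image_compactin[OF _ \<phi>_cont[OF l(1)]])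
  qed
  ultimately show ?thesis by (simp add: compact_space_def)
qed

lemma openin_upper:
  assumes "\<And>l m. l \<in> \<Lambda> \<Longrightarrow> m \<in> faces \<Longrightarrow> l \<le> m \<Longrightarrow> m \<in> \<Lambda>"
  shows "openin X {x \<in> topspace X. \<pi> x \<in> \<Lambda>}"
proof -
  have "openin alexandroff {m. \<exists>l\<in>\<Lambda>. l \<le> m}"
    unfolding openin_alexandroff using order_trans by blast
  moreover have "continuous_map X alexandroff \<pi>" using stratified by (simp add: stratification_def)
  ultimately have "openin X {x \<in> topspace X. \<pi> x \<in> {m. \<exists>l\<in>\<Lambda>. l \<le> m}}"
    by (rule openin_continuous_map_preimage[rotated])
  moreover have "{x \<in> topspace X. \<pi> x \<in> {m. \<exists>l\<in>\<Lambda>. l \<le> m}} = {x \<in> topspace X. \<pi> x \<in> \<Lambda>}"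
    using assms face_in by blast
  ultimately show ?thesis by simp
qed

text \<open>Vanishing on the rim lets the function continue by zero over the boundary of the cell,
  and also over the closed set of all points whose stratum is not above \<open>l\<close>. The Tietze
  theorem covers the rest. The zeros outside the upper set are used to tell strata apart.\<close>

lemma extend_from_cell:
  assumes l: "l \<in> faces" and \<kappa>: "continuous_map (disk l) euclideanreal \<kappa>" "\<And>y. y \<in> rim l \<Longrightarrow> \<kappa> y = 0"
  obtains g where "continuous_map X euclideanreal g" "\<And>x. x \<in> stratum X \<pi> l \<Longrightarrow> g x = \<kappa> (lift x)"
    "\<And>x. x \<in> topspace X \<Longrightarrow> \<not> l \<le> \<pi> x \<Longrightarrow> g x = 0"
proof -
  define T1 where "T1 = stratum_closure X \<pi> l"
  define T2 where "T2 = {x \<in> topspace X. \<not> l \<le> \<pi> x}"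
  define g where "g x = (if \<pi> x = l then \<kappa> (lift x) else 0)" for x
  have T1: "closedin X T1" by (simp add: T1_def stratum_closure_def)
  have T1X: "T1 \<subseteq> topspace X" using closedin_subset[OF T1] .
  have T2: "closedin X T2"
  proof -
    have "openin X {x \<in> topspace X. \<pi> x \<in> {m. l \<le> m}}" by (rule openin_upper) auto
    moreover have "T2 = topspace X - {x \<in> topspace X. \<pi> x \<in> {m. l \<le> m}}" by (auto simp: T2_def)
    ultimately show ?thesis by (simp add: closedin_diff)
  qed
  have im: "\<phi> l ` points l = T1"
    using quotient_imp_surjective_map[OF \<phi>_quotient[OF l]] T1X by (auto simp: T1_def)
  have pr: "proper_map (disk l) (subtopology X T1) (\<phi> l)"
    by (rule proper_map_into_subtopology[OF \<phi>_proper[OF l]]) (use im in auto)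
  have c1: "continuous_map (subtopology X T1) euclideanreal g"
  proof (rule continuous_map_proper_cover[where I = "{l}" and K = disk and q = \<phi>])
    fix i assume "i \<in> {l}"
    then have i: "i = l" by simp
    show "proper_map (disk i) (subtopology X T1) (\<phi> i)" unfolding i by (rule pr)
    show "continuous_map (disk i) euclideanreal (\<lambda>x. g (\<phi> i x))"
      unfolding i
    proof (rule continuous_map_eq[OF \<kappa>(1)])
      fix y assume "y \<in> topspace (disk l)"
      then have y: "y \<in> points l" by simp
      show "\<kappa> y = g (\<phi> l y)"
      proof (cases "y \<in> core l")
        case True
        then show ?thesis using \<pi>_\<phi>_core[OF l True] lift_\<phi>[OF l True] by (simp add: g_def)
      next
        case False
        then have "y \<in> rim l" using core_or_rim[OF y] by simp
        then have "\<pi> (\<phi> l y) \<noteq> l" "\<kappa> y = 0" using \<pi>_\<phi>_rim[OF l] \<kappa>(2) by force+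
        then show ?thesis by (simp add: g_def)
      qed
    qed
  qed (use im in auto)
  have c2: "continuous_map (subtopology X T2) euclideanreal g"
    by (rule continuous_map_eq[of _ _ "\<lambda>x. 0"]) (auto simp: g_def T2_def)
  have T12: "closedin X (T1 \<union> T2)" using T1 T2 by (rule closedin_Un)
  have c: "continuous_map (subtopology X (T1 \<union> T2)) euclideanreal g"
  proof (rule continuous_map_proper_cover[where I = "{T1, T2}" and K = "\<lambda>T. subtopology X T" and q = "\<lambda>T x. x"])
    fix T assume T: "T \<in> {T1, T2}"
    have "closedin (subtopology X (T1 \<union> T2)) T"
      using T T1 T2 closedin_closed_subtopology[OF T12] by auto
    from proper_map_closed_inclusion[OF this]
    have "proper_map (subtopology X ((T1 \<union> T2) \<inter> T)) (subtopology X (T1 \<union> T2)) (\<lambda>x. x)"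
      by (simp only: subtopology_subtopology)
    moreover have "(T1 \<union> T2) \<inter> T = T" using T by auto
    ultimately show "proper_map (subtopology X T) (subtopology X (T1 \<union> T2)) (\<lambda>x. x)" by simp
    show "continuous_map (subtopology X T) euclideanreal (\<lambda>x. g x)" using T c1 c2 by auto
  qed auto
  have "normal_space X" using compact_X Hausdorff_X by (intro compact_Hausdorff_or_regular_imp_normal_space) auto
  then obtain h where h: "continuous_map X euclideanreal h" "\<And>x. x \<in> T1 \<union> T2 \<Longrightarrow> h x = g x"
    using Tietze_extension_realinterval[OF _ T12 is_interval_univ _ c] by (metis UNIV_I empty_iff subset_UNIV)
  show thesis
  proof (rule that[OF h(1)])
    fix x assume x: "x \<in> stratum X \<pi> l"
    then have "x \<in> T1"
      unfolding T1_def stratum_closure_def by (rule subsetD[OF closure_of_subset, rotated]) (auto simp: stratum_def)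
    then show "h x = \<kappa> (lift x)" using h(2) x by (simp add: g_def stratum_def)
  next
    fix x assume x: "x \<in> topspace X" "\<not> l \<le> \<pi> x"
    then have "x \<in> T2" "\<pi> x \<noteq> l" by (auto simp: T2_def)
    then show "h x = 0" using h(2) by (simp add: g_def)
  qed
qed

text \<open>For each cell, countably many functions on its cone separate the core and vanish on the
  rim. Extended to \<open>X\<close> they separate points of one stratum, and by their zeros also
  points of different strata. The range is a metric space, as the homotopy arguments
  require.\<close>

theorem Euclidean_embedding:
  fixes \<gamma> :: "nat \<Rightarrow> 's \<Rightarrow> real"
  assumes \<gamma>: "\<And>l i. l \<in> faces \<Longrightarrow> continuous_map (S l) euclideanreal (\<gamma> i)"
    and \<gamma>_sep: "\<And>l y y'. l \<in> faces \<Longrightarrow> y \<in> topspace (S l) \<Longrightarrow> y' \<in> topspace (S l) \<Longrightarrow> (\<And>i. \<gamma> i y = \<gamma> i y') \<Longrightarrow> y = y'"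
  obtains \<psi> :: "'x \<Rightarrow> nat \<Rightarrow> real" where "continuous_map X euclidean \<psi>" "inj_on \<psi> (topspace X)"
proof -
  \<comment> \<open>Function 0 is positive on the core and vanishes on the rim. In the others the
    factor \<open>1 - t\<close> gives the zeros on the rim, and the factor \<open>t\<close> makes
    the dependence on the base disappear at the apex.\<close>
  define \<kappa> :: "nat \<Rightarrow> 's cone_point \<Rightarrow> real" where
    "\<kappa> i x = (case i of 0 \<Rightarrow> 1 - cone_height x
       | Suc i \<Rightarrow> (case x of None \<Rightarrow> 0 | Some (t, y) \<Rightarrow> (1 - t) * t * \<gamma> i y))" for i x
  have \<kappa>_cont: "continuous_map (disk l) euclideanreal (\<kappa> i)" if l: "l \<in> faces" for l i
  proof (cases i)
    case 0
    have "continuous_map (disk l) euclideanreal (\<lambda>x. 1 - cone_height x)"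
      by (intro continuous_map_diff continuous_map_cone_height) simp
    then show ?thesis unfolding 0 by (rule continuous_map_eq) (simp add: \<kappa>_def)
  next
    case (Suc i)
    show ?thesis
      unfolding Suc
    proof (rule continuous_map_from_cone)
      let ?C = "prod_topology (top_of_set {0..1::real}) (S l)"
      have t: "continuous_map ?C euclideanreal fst"
        by (rule continuous_map_into_fulltopology[OF continuous_map_fst])
      have y: "continuous_map ?C euclideanreal (\<lambda>z. \<gamma> i (snd z))"
        using continuous_map_compose[OF continuous_map_snd \<gamma>[OF l]] by (simp add: o_def)
      have "continuous_map ?C euclideanreal (\<lambda>z. (1 - fst z) * fst z * \<gamma> i (snd z))"
        by (intro continuous_map_real_mult continuous_map_diff t y) simp
      then show "continuous_map ?C euclideanreal (\<lambda>z. \<kappa> (Suc i) (case_prod cone_pt z))"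
        by (rule continuous_map_eq) (auto simp: \<kappa>_def cone_pt_def)
    qed (simp add: \<kappa>_def)
  qed
  have \<kappa>_rim: "\<kappa> i y = 0" if "y \<in> rim l" for i y l
    using that by (auto simp: rim_iff \<kappa>_def split: nat.split)
  have \<kappa>_sep: "y = y'" if l: "l \<in> faces" and y: "y \<in> core l" "y' \<in> core l" and eq: "\<And>i. \<kappa> i y = \<kappa> i y'" for l y y'
  proof -
    have h: "cone_height y = cone_height y'" using eq[of 0] by (simp add: \<kappa>_def)
    from y(1) consider "y = None" | t u where "y = Some (t, u)" "0 < t" "t < 1" "u \<in> topspace (S l)"
      unfolding core_iff by blast
    then show ?thesis
    proof cases
      case 1
      then show ?thesis using h y(2) unfolding core_iff by auto
    next
      case 2
      then obtain u' where u': "y' = Some (t, u')" "u' \<in> topspace (S l)" using h y(2) unfolding core_iff by auto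
      have "\<gamma> i u = \<gamma> i u'" for i using eq[of "Suc i"] 2 u' by (simp add: \<kappa>_def)
      then show ?thesis using \<gamma>_sep[OF l 2(4) u'(2)] 2(1) u'(1) by simp
    qed
  qed
  have "\<exists>g. continuous_map X euclideanreal g \<and> (\<forall>x\<in>stratum X \<pi> l. g x = \<kappa> i (lift x)) \<and>
      (\<forall>x\<in>topspace X. \<not> l \<le> \<pi> x \<longrightarrow> g x = 0)" if l: "l \<in> faces" for l i
    by (rule extend_from_cell[OF l \<kappa>_cont[OF l] \<kappa>_rim]) blast+
  then obtain g where g: "\<And>l i. l \<in> faces \<Longrightarrow> continuous_map X euclideanreal (g l i)"
    "\<And>l i x. l \<in> faces \<Longrightarrow> x \<in> stratum X \<pi> l \<Longrightarrow> g l i x = \<kappa> i (lift x)"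
    "\<And>l i x. l \<in> faces \<Longrightarrow> x \<in> topspace X \<Longrightarrow> \<not> l \<le> \<pi> x \<Longrightarrow> g l i x = 0"
    by metis
  obtain idx :: "'l \<Rightarrow> nat" where idx: "inj_on idx faces"
    using finite_imp_inj_to_nat_seg[OF finite_face_poset] by blast
  \<comment> \<open>Pairs of a cell and an index are coded by natural numbers, with 0 as the default
    for codes that name no cell.\<close>
  define \<psi> where "\<psi> x q = (let (a, i) = prod_decode q in if a \<in> idx ` faces then g (inv_into faces idx a) i x else 0)" for x q
  have \<psi>_at: "\<psi> x (prod_encode (idx l, i)) = g l i x" if "l \<in> faces" for x l i
    using that idx by (simp add: \<psi>_def)
  show thesis
  proof (rule that[of \<psi>])
    have "continuous_map X (powertop_real UNIV) \<psi>"
      unfolding continuous_map_componentwise_UNIV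
    proof
      fix q
      obtain a i where q: "prod_decode q = (a, i)" by fastforce
      show "continuous_map X euclideanreal (\<lambda>x. \<psi> x q)"
      proof (cases "a \<in> idx ` faces")
        case True
        then show ?thesis using g(1)[of "inv_into faces idx a" i] inv_into_into[OF True] by (simp add: \<psi>_def q)
      next
        case False
        then show ?thesis by (simp add: \<psi>_def q)
      qed
    qed
    then show "continuous_map X euclidean \<psi>" by (simp add: euclidean_product_topology)
    show "inj_on \<psi> (topspace X)"
    proof (rule inj_onI)
      fix x x' assume x: "x \<in> topspace X" "x' \<in> topspace X" and eq: "\<psi> x = \<psi> x'"
      have geq: "g l i x = g l i x'" if "l \<in> faces" for l i
        using \<psi>_at[OF that] eq by metis
      note l = face_in[OF x(1)] face_in[OF x(2)]
      have s: "x \<in> stratum X \<pi> (\<pi> x)" "x' \<in> stratum X \<pi> (\<pi> x')" using x by (auto simp: stratum_def)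
      have pos: "0 < \<kappa> 0 (lift x)" if "x \<in> topspace X" for x
        using lift_in(1)[OF that] by (auto simp: core_iff \<kappa>_def)
      \<comment> \<open>Otherwise function 0 of the cell of \<open>x\<close> would be positive at
        \<open>x\<close> and zero at \<open>x'\<close>.\<close>
      have "\<pi> x \<le> \<pi> x'"
      proof (rule ccontr)
        assume "\<not> \<pi> x \<le> \<pi> x'"
        then have "g (\<pi> x) 0 x' = 0" by (rule g(3)[OF l(1) x(2)])
        then show False using g(2)[OF l(1) s(1), of 0] geq[OF l(1), of 0] pos[OF x(1)] by simp
      qed
      moreover have "\<pi> x' \<le> \<pi> x"
      proof (rule ccontr)
        assume "\<not> \<pi> x' \<le> \<pi> x"
        then have "g (\<pi> x') 0 x = 0" by (rule g(3)[OF l(2) x(1)])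
        then show False using g(2)[OF l(2) s(2), of 0] geq[OF l(2), of 0] pos[OF x(2)] by simp
      qed
      ultimately have e: "\<pi> x = \<pi> x'" by simp
      have "lift x = lift x'"
      proof (rule \<kappa>_sep[OF l(1) lift_in(1)[OF x(1)]])
        show "lift x' \<in> core (\<pi> x)" using lift_in(1)[OF x(2)] e by simp
        show "\<kappa> i (lift x) = \<kappa> i (lift x')" for i
          using g(2)[OF l(1) s(1), of i] g(2)[OF l(2) s(2), of i] geq[OF l(1), of i] e by simp
      qed
      then show "x = x'" using lift_in(2)[OF x(1)] lift_in(2)[OF x(2)] e by metis
    qed
  qed
qed

end

section \<open>Transport of the tubes to the embedded space, and the conclusion\<close>

text \<open>The transport \<open>T\<close> is the move at scale 1, which changes the base point and
  keeps height and stratum.\<close>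

lemma stratified_tubes_embedded:
  fixes X :: "'x topology" and \<pi> :: "'x \<Rightarrow> 'l::order" and \<psi> :: "'x \<Rightarrow> 'e::metric_space"
  assumes hm: "homeomorphic_maps X (top_of_set E) \<psi> \<xi>"
    and fin: "finite (face_poset X \<pi>)"
    and up: "\<And>\<Lambda>. (\<And>l m. l \<in> \<Lambda> \<Longrightarrow> m \<in> face_poset X \<pi> \<Longrightarrow> l \<le> m \<Longrightarrow> m \<in> \<Lambda>) \<Longrightarrow> openin X {x \<in> topspace X. \<pi> x \<in> \<Lambda>}"
    and T: "\<And>k. k \<in> face_poset X \<pi> \<Longrightarrow> conical_tube X \<pi> k (U k) (r k) (h k) (N k)"
  shows "stratified_tubes E (\<lambda>w. \<pi> (\<xi> w)) (\<lambda>k. \<psi> ` U k) (\<lambda>k w. \<psi> (r k (\<xi> w))) (\<lambda>k y. \<psi> (N k (\<xi> (fst y)) (\<xi> (snd y), 1)))"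
proof -
  let ?\<pi> = "\<lambda>w. \<pi> (\<xi> w)"
  have \<psi>_cont: "continuous_map X (top_of_set E) \<psi>" and \<xi>_cont: "continuous_map (top_of_set E) X \<xi>"
    and \<xi>\<psi>: "\<And>x. x \<in> topspace X \<Longrightarrow> \<xi> (\<psi> x) = x" and \<psi>\<xi>: "\<And>w. w \<in> E \<Longrightarrow> \<psi> (\<xi> w) = w"
    using hm by (auto simp: homeomorphic_maps_def)
  have \<psi>_E: "\<psi> x \<in> E" if "x \<in> topspace X" for x using continuous_map_image_subset_topspace[OF \<psi>_cont] that by auto
  have \<xi>_X: "\<xi> w \<in> topspace X" if "w \<in> E" for w using continuous_map_image_subset_topspace[OF \<xi>_cont] that by auto
  have \<psi>_open: "openin (top_of_set E) (\<psi> ` V)" if "openin X V" for V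
  proof -
    have "open_map X (top_of_set E) \<psi>"
      using hm homeomorphic_imp_open_map homeomorphic_map_maps by blast
    then show ?thesis using that by (simp add: open_map_def)
  qed
  have image_\<pi>: "?\<pi> ` E = face_poset X \<pi>"
  proof
    show "?\<pi> ` E \<subseteq> face_poset X \<pi>" using \<xi>_X by (auto simp: face_poset_def)
    show "face_poset X \<pi> \<subseteq> ?\<pi> ` E"
    proof
      fix l assume "l \<in> face_poset X \<pi>"
      then obtain x where x: "x \<in> topspace X" "l = \<pi> x" by (auto simp: face_poset_def)
      then show "l \<in> ?\<pi> ` E" using \<xi>\<psi>[OF x(1)] \<psi>_E[OF x(1)] by (intro image_eqI[of _ _ "\<psi> x"]) auto
    qed
  qed
  have strat: "E \<inter> ?\<pi> -` {k} = \<psi> ` stratum X \<pi> k" for k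
  proof
    show "E \<inter> ?\<pi> -` {k} \<subseteq> \<psi> ` stratum X \<pi> k"
    proof
      fix w assume w: "w \<in> E \<inter> ?\<pi> -` {k}"
      then show "w \<in> \<psi> ` stratum X \<pi> k"
        using \<xi>_X[of w] \<psi>\<xi>[of w] by (intro image_eqI[of _ _ "\<xi> w"]) (auto simp: stratum_def)
    qed
    show "\<psi> ` stratum X \<pi> k \<subseteq> E \<inter> ?\<pi> -` {k}" using \<psi>_E \<xi>\<psi> by (auto simp: stratum_def)
  qed
  have \<xi>_sub: "continuous_map (top_of_set (\<psi> ` V)) (subtopology X V) \<xi>" if V: "V \<subseteq> topspace X" for V
  proof -
    have "\<psi> ` V \<subseteq> E" using \<psi>_E V by blast
    then have "top_of_set (\<psi> ` V) = subtopology (top_of_set E) (\<psi> ` V)" by (simp add: subtopology_subtopology Int_absorb1)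
    moreover have "\<xi> ` \<psi> ` V \<subseteq> V"
    proof (clarify)
      fix x assume "x \<in> V"
      then show "\<xi> (\<psi> x) \<in> V" using \<xi>\<psi> V by (metis subsetD)
    qed
    ultimately show ?thesis
      using continuous_map_from_subtopology[OF \<xi>_cont, of "\<psi> ` V"] by (auto simp: continuous_map_in_subtopology)
  qed
  have \<psi>_eu: "continuous_map X euclidean \<psi>" using \<psi>_cont by (rule continuous_map_into_fulltopology)
  have SX: "stratum X \<pi> k \<subseteq> topspace X" for k by (auto simp: stratum_def)
  show ?thesis
  proof
    show "finite (?\<pi> ` E)" using fin image_\<pi> by simp
    show "openin (top_of_set E) (E \<inter> ?\<pi> -` \<Lambda>)"
      if "\<Lambda> \<subseteq> ?\<pi> ` E" "\<And>l m. l \<in> \<Lambda> \<Longrightarrow> m \<in> ?\<pi> ` E \<Longrightarrow> l \<le> m \<Longrightarrow> m \<in> \<Lambda>" for \<Lambda>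
    proof -
      have "openin X {x \<in> topspace X. \<pi> x \<in> \<Lambda>}" by (rule up) (use that(2) image_\<pi> in blast)
      from openin_continuous_map_preimage[OF \<xi>_cont this]
      have "openin (top_of_set E) {w \<in> E. \<xi> w \<in> topspace X \<and> \<pi> (\<xi> w) \<in> \<Lambda>}" by simp
      moreover have "{w \<in> E. \<xi> w \<in> topspace X \<and> \<pi> (\<xi> w) \<in> \<Lambda>} = E \<inter> ?\<pi> -` \<Lambda>" using \<xi>_X by auto
      ultimately show ?thesis by simp
    qed
    show "x \<in> \<psi> ` U (?\<pi> x)" if x: "x \<in> E" for x
    proof -
      have k: "?\<pi> x \<in> face_poset X \<pi>" using image_\<pi> x by blast
      have "\<xi> x \<in> stratum X \<pi> (?\<pi> x)" using \<xi>_X[OF x] by (simp add: stratum_def)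
      then have "\<xi> x \<in> U (?\<pi> x)" using T[OF k] unfolding conical_tube_def by blast
      then show ?thesis using \<psi>\<xi>[OF x] by (intro image_eqI[of _ _ "\<xi> x"]) auto
    qed
    fix k assume "k \<in> ?\<pi> ` E"
    then have k: "k \<in> face_poset X \<pi>" using image_\<pi> by simp
    let ?S = "stratum X \<pi> k"
    have opU: "openin X (U k)" and SU: "?S \<subseteq> U k"
      and r_cont: "continuous_map (subtopology X (U k)) (subtopology X ?S) (r k)"
      and N_cont: "continuous_map (prod_topology (subtopology X (U k)) (prod_topology (subtopology X ?S) (top_of_set {0..}))) X (\<lambda>y. N k (fst y) (snd y))"
      using T[OF k] unfolding conical_tube_def by blast+
    have props: "h k x = 0 \<longleftrightarrow> \<pi> x = k" "\<pi> x = k \<Longrightarrow> r k x = x" "N k x (r k x, 1) = x" if "x \<in> U k" for x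
      using T[OF k] that unfolding conical_tube_def by blast+
    have Np: "N k x (z, 1) \<in> U k" "r k (N k x (z, 1)) = z" "\<pi> (N k x (z, 1)) = \<pi> x" if "x \<in> U k" "z \<in> ?S" for x z
    proof -
      have *: "\<forall>s\<ge>0. N k x (z, s) \<in> U k \<and> r k (N k x (z, s)) = z \<and> h k (N k x (z, s)) = s * h k x \<and> (0 < s \<longrightarrow> \<pi> (N k x (z, s)) = \<pi> x)"
        using T[OF k] that unfolding conical_tube_def by blast
      then show "N k x (z, 1) \<in> U k" "r k (N k x (z, 1)) = z" "\<pi> (N k x (z, 1)) = \<pi> x" by simp_all
    qed
    have UX: "U k \<subseteq> topspace X" by (rule openin_subset[OF opU])
    have r_in: "r k x \<in> ?S" if "x \<in> U k" for x
      using continuous_map_image_subset_topspace[OF r_cont] that UX by auto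
    show "openin (top_of_set E) (\<psi> ` U k)" by (rule \<psi>_open[OF opU])
    have "continuous_map (top_of_set (\<psi> ` U k)) euclidean (\<psi> \<circ> (r k \<circ> \<xi>))"
      by (rule continuous_map_compose[OF continuous_map_compose[OF \<xi>_sub[OF UX] continuous_map_into_fulltopology[OF r_cont]] \<psi>_eu])
    then show "continuous_on (\<psi> ` U k) (\<lambda>w. \<psi> (r k (\<xi> w)))" by (simp add: o_def)
    have "continuous_map (prod_topology (top_of_set (\<psi> ` U k)) (top_of_set (\<psi> ` ?S))) euclidean (\<lambda>y. \<psi> (N k (\<xi> (fst y)) (\<xi> (snd y), 1)))"
    proof -
      let ?P = "prod_topology (top_of_set (\<psi> ` U k)) (top_of_set (\<psi> ` ?S))"
      have 1: "continuous_map ?P (subtopology X (U k)) (\<xi> \<circ> fst)"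
        by (rule continuous_map_compose[OF continuous_map_fst \<xi>_sub[OF UX]])
      have 2: "continuous_map ?P (subtopology X ?S) (\<xi> \<circ> snd)"
        by (rule continuous_map_compose[OF continuous_map_snd \<xi>_sub[OF SX]])
      have 3: "continuous_map ?P (top_of_set {0::real..}) (\<lambda>y. 1)" by simp
      have "continuous_map ?P (prod_topology (subtopology X (U k)) (prod_topology (subtopology X ?S) (top_of_set {0::real..}))) (\<lambda>y. ((\<xi> \<circ> fst) y, (\<xi> \<circ> snd) y, 1))"
        by (rule continuous_map_pairedI[OF 1 continuous_map_pairedI[OF 2 3]])
      from continuous_map_compose[OF continuous_map_compose[OF this N_cont] \<psi>_eu]
      show ?thesis by (simp add: o_def)
    qed
    then show "continuous_on (\<psi> ` U k \<times> (E \<inter> ?\<pi> -` {k})) (\<lambda>y. \<psi> (N k (\<xi> (fst y)) (\<xi> (snd y), 1)))"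
      unfolding strat by simp
    fix x assume x: "x \<in> \<psi> ` U k"
    then obtain x' where x': "x' \<in> U k" "x = \<psi> x'" by blast
    have \<xi>x: "\<xi> x = x'" using \<xi>\<psi> x' UX by blast
    show "\<psi> (r k (\<xi> x)) \<in> E \<inter> ?\<pi> -` {k}" unfolding strat \<xi>x using r_in[OF x'(1)] by blast
    have "\<xi> (\<psi> (r k x')) = r k x'" using \<xi>\<psi> r_in[OF x'(1)] SX by blast
    then show "\<psi> (N k (\<xi> (fst (x, \<psi> (r k (\<xi> x))))) (\<xi> (snd (x, \<psi> (r k (\<xi> x)))), 1)) = x"
      using props(3)[OF x'(1)] \<xi>x x'(2) by simp
    fix z assume "z \<in> E \<inter> ?\<pi> -` {k}"
    then obtain z' where z': "z' \<in> ?S" "z = \<psi> z'" unfolding strat by blast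
    have \<xi>z: "\<xi> z = z'" using \<xi>\<psi> z' SX by blast
    have "N k x' (z', 1) \<in> topspace X" using Np(1)[OF x'(1) z'(1)] UX by blast
    then show "\<psi> (N k (\<xi> (fst (x, z))) (\<xi> (snd (x, z)), 1)) \<in> E \<and> ?\<pi> (\<psi> (N k (\<xi> (fst (x, z))) (\<xi> (snd (x, z)), 1))) = ?\<pi> x"
      using \<psi>_E \<xi>\<psi> \<xi>x \<xi>z Np(3)[OF x'(1) z'(1)] by simp
  next
    fix k x z assume x: "x \<in> E \<inter> ?\<pi> -` {k}" and z: "z \<in> E \<inter> ?\<pi> -` {k}"
    have k: "k \<in> face_poset X \<pi>" using x image_\<pi> by blast
    have s: "\<xi> x \<in> stratum X \<pi> k" "\<xi> z \<in> stratum X \<pi> k" using x z \<xi>_X by (auto simp: stratum_def)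
    have u: "\<xi> x \<in> U k" using s(1) T[OF k] unfolding conical_tube_def by blast
    have *: "\<forall>s\<ge>0. N k (\<xi> x) (\<xi> z, s) \<in> U k \<and> r k (N k (\<xi> x) (\<xi> z, s)) = \<xi> z \<and> h k (N k (\<xi> x) (\<xi> z, s)) = s * h k (\<xi> x) \<and> (0 < s \<longrightarrow> \<pi> (N k (\<xi> x) (\<xi> z, s)) = \<pi> (\<xi> x))"
      using T[OF k] u s(2) unfolding conical_tube_def by blast
    then have 1: "N k (\<xi> x) (\<xi> z, 1) \<in> U k" "r k (N k (\<xi> x) (\<xi> z, 1)) = \<xi> z" "\<pi> (N k (\<xi> x) (\<xi> z, 1)) = k"
      using x by simp_all
    \<comment> \<open>The moved point lies in the stratum \<open>k\<close>, where the projection is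
      the identity, and its projection is \<open>\<xi> z\<close>; so it equals
      \<open>\<xi> z\<close>.\<close>
    have "r k (N k (\<xi> x) (\<xi> z, 1)) = N k (\<xi> x) (\<xi> z, 1)"
      using T[OF k] 1(1,3) unfolding conical_tube_def by blast
    then show "\<psi> (N k (\<xi> (fst (x, z))) (\<xi> (snd (x, z)), 1)) = z"
      using 1(2) \<psi>\<xi> z by simp
  qed
qed

lemma subtopology_Euclidean_space:
  "subtopology (Euclidean_space n) A = top_of_set {x. (\<forall>i\<ge>n. x i = 0) \<and> x \<in> A}"
proof -
  have "{y. \<forall>i\<ge>n. y i = 0} \<inter> A = {x. (\<forall>i\<ge>n. x i = 0) \<and> x \<in> A}" by auto
  then show ?thesis
    by (simp add: Euclidean_space_def subtopology_subtopology euclidean_product_topology)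
qed

text \<open>The sphere is closed in the cube of all sequences with entries in \<open>[-1,1]\<close>,
  which is compact by the Tychonoff theorem.\<close>

lemma compact_space_unit_sphere: "compact_space (unit_sphere n)"
proof -
  let ?A = "{x :: nat \<Rightarrow> real. (\<forall>i\<ge>n. x i = 0) \<and> (\<Sum>i<n. (x i)\<^sup>2) = 1}"
  have coord: "continuous_on UNIV (\<lambda>x :: nat \<Rightarrow> real. x i)" for i
    by (rule continuous_on_product_then_coordinatewise[OF continuous_on_id])
  have "closed ((\<Inter>i\<in>{n..}. {x :: nat \<Rightarrow> real. x i = 0}) \<inter> {x. (\<Sum>i<n. (x i)\<^sup>2) = 1})"
    by (intro closed_Int closed_INT ballI closed_Collect_eq continuous_intros coord)
  moreover have "(\<Inter>i\<in>{n..}. {x :: nat \<Rightarrow> real. x i = 0}) \<inter> {x. (\<Sum>i<n. (x i)\<^sup>2) = 1} = ?A" by auto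
  ultimately have cl: "closedin (powertop_real UNIV) ?A" by (simp add: euclidean_product_topology)
  have "?A \<subseteq> UNIV \<rightarrow>\<^sub>E {-1..1}"
  proof
    fix x assume x: "x \<in> ?A"
    have "x i \<in> {-1..1}" for i
    proof (cases "i < n")
      case True
      then have "(x i)\<^sup>2 \<le> (\<Sum>i<n. (x i)\<^sup>2)" by (intro member_le_sum) auto
      then have "\<bar>x i\<bar> \<le> 1" using x by (simp add: abs_square_le_1)
      then show ?thesis by auto
    qed (use x in auto)
    then show "x \<in> UNIV \<rightarrow>\<^sub>E {-1..1}" by auto
  qed
  moreover have "compactin (powertop_real UNIV) (UNIV \<rightarrow>\<^sub>E {-1..1})" by (simp add: compactin_PiE)
  ultimately have "compactin (powertop_real UNIV) ?A" using cl closed_compactin by blast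
  then show ?thesis
    unfolding unit_sphere_def subtopology_Euclidean_space
    by (simp add: compact_space_subtopology euclidean_product_topology)
qed

theorem corollary1p7:
  fixes X :: "'x topology"
    and n :: "'l::order \<Rightarrow> nat"
    and \<Phi> :: "'l \<Rightarrow> (nat \<Rightarrow> real) \<Rightarrow> 'x"
    and \<pi> :: "'x \<Rightarrow> 'l"
    and \<pi>S :: "'l \<Rightarrow> (nat \<Rightarrow> real) \<Rightarrow> 'm::order"
    and P :: "'l \<Rightarrow> 'l \<Rightarrow> 'p topology"
  assumes "finite_CW_complex X I n \<Phi>"
    and "CW_cnsss_structure X I n \<Phi> \<pi> \<pi>S P b c"
  shows "conically_stratified X \<pi> \<and> quasi_category (Exit X \<pi>)"
proof -
  have CW: "CW_complex X I n \<Phi>" "finite I" using assms(1) by (auto simp: finite_CW_complex_def)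
  have I: "I = face_poset X \<pi>" and cells: "\<And>l. l \<in> I \<Longrightarrow> stratum X \<pi> l = open_cell n \<Phi> l"
    and cn: "cnsss X \<pi> (\<lambda>l. unit_sphere (n l)) \<pi>S (\<lambda>l. cone_carrier (unit_sphere (n l)))
       (\<lambda>l. \<Phi> l \<circ> cone_to_disk) P b c"
    using assms(2) unfolding CW_cnsss_structure_def by blast+
  have Hausdorff: "Hausdorff_space X" using CW(1) by (simp add: CW_complex_def)
  have sphere: "Hausdorff_space (unit_sphere m)" for m
    unfolding unit_sphere_def subtopology_Euclidean_space by (rule Hausdorff_space_subtopology) simp
  interpret full_cone_cnsss X \<pi> "\<lambda>l. unit_sphere (n l)" \<pi>S "\<lambda>l. \<Phi> l \<circ> cone_to_disk" P b c
    by (intro full_cone_cnsss.intro full_cone_cnsss_axioms.intro cn)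
      (use CW(2) I Hausdorff sphere compact_space_unit_sphere in auto)
  have \<pi>_cont: "continuous_map X alexandroff \<pi>" using stratified by (simp add: stratification_def)
  have con: "conically_stratified X \<pi>"
    by (rule conically_stratified_tubes[OF Hausdorff \<pi>_cont conical_tube_nbhd])
  have coord: "continuous_map (unit_sphere m) euclideanreal (\<lambda>y. y i)" for m i
    unfolding unit_sphere_def subtopology_Euclidean_space continuous_map_iff_continuous
    by (rule continuous_on_product_then_coordinatewise[OF continuous_on_id])
  have sep: "y = y'" if "\<And>i. y i = y' i" for y y' :: "nat \<Rightarrow> real" using that by (rule ext)
  obtain \<psi> :: "'x \<Rightarrow> nat \<Rightarrow> real" where \<psi>: "continuous_map X euclidean \<psi>" "inj_on \<psi> (topspace X)"
    by (rule Euclidean_embedding[of "\<lambda>i y. y i", OF coord sep]) blast+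
  define E where "E = \<psi> ` topspace X"
  have "homeomorphic_map X (top_of_set E) \<psi>"
  proof (rule continuous_imp_homeomorphic_map)
    show "continuous_map X (top_of_set E) \<psi>" using \<psi>(1) by (auto simp: continuous_map_in_subtopology E_def)
    show "Hausdorff_space (top_of_set E)" by (rule Hausdorff_space_subtopology) simp
  qed (use compact_X \<psi>(2) in \<open>auto simp: E_def\<close>)
  then obtain \<xi> where hm: "homeomorphic_maps X (top_of_set E) \<psi> \<xi>"
    unfolding homeomorphic_map_maps by blast
  interpret T: stratified_tubes E "\<lambda>w. \<pi> (\<xi> w)" "\<lambda>k. \<psi> ` nbhd k" "\<lambda>k w. \<psi> (nbhd_proj k (\<xi> w))"
    "\<lambda>k y. \<psi> (nbhd_move k (\<xi> (fst y)) (\<xi> (snd y), 1))"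
    by (rule stratified_tubes_embedded[OF hm finite_face_poset openin_upper conical_tube_nbhd])
  have \<psi>E: "continuous_map X (top_of_set E) \<psi>" and \<xi>_cont: "continuous_map (top_of_set E) X \<xi>"
    and \<xi>\<psi>: "\<And>x. x \<in> topspace X \<Longrightarrow> \<xi> (\<psi> x) = x" and \<psi>\<xi>: "\<And>w. w \<in> E \<Longrightarrow> \<psi> (\<xi> w) = w"
    using hm by (auto simp: homeomorphic_maps_def)
  have \<xi>_in: "\<xi> w \<in> topspace X" if "w \<in> E" for w
    using continuous_map_image_subset_topspace[OF \<xi>_cont] that by auto
  \<comment> \<open>Here the cells being disks matters: the characteristic map identifies the
    stratum with an open disk, which is an absolute extensor for the type of simplex points times
    time.\<close>
  have extensor: "absolute_extensor TYPE((nat \<Rightarrow> real) \<times> real) (E \<inter> (\<lambda>w. \<pi> (\<xi> w)) -` {k})"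
    if "k \<in> (\<lambda>w. \<pi> (\<xi> w)) ` E" for k
  proof -
    have k: "k \<in> I" using that \<xi>_in I by (auto simp: face_poset_def)
    let ?D = "{x :: nat \<Rightarrow> real. (\<forall>i\<ge>n k. x i = 0) \<and> (\<Sum>i<n k. (x i)\<^sup>2) < 1}"
    let ?S = "E \<inter> (\<lambda>w. \<pi> (\<xi> w)) -` {k}"
    have D: "unit_open_disk (n k) = top_of_set ?D"
      unfolding unit_open_disk_def subtopology_Euclidean_space by simp
    have "homeomorphic_map (unit_open_disk (n k)) (subtopology X (open_cell n \<Phi> k)) (\<Phi> k)"
      using CW(1) k by (simp add: CW_complex_def)
    then obtain g where g: "homeomorphic_maps (top_of_set ?D) (subtopology X (stratum X \<pi> k)) (\<Phi> k) g"
      unfolding D cells[OF k] homeomorphic_map_maps by blast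
    have topS: "topspace (subtopology X (stratum X \<pi> k)) = stratum X \<pi> k" by (auto simp: stratum_def)
    have \<Phi>_cont: "continuous_map (top_of_set ?D) (subtopology X (stratum X \<pi> k)) (\<Phi> k)"
      and g_cont: "continuous_map (subtopology X (stratum X \<pi> k)) (top_of_set ?D) g"
      and \<Phi>g: "\<And>x. x \<in> stratum X \<pi> k \<Longrightarrow> \<Phi> k (g x) = x"
      using g unfolding homeomorphic_maps_def topS by blast+
    have \<xi>S: "continuous_map (top_of_set ?S) (subtopology X (stratum X \<pi> k)) \<xi>"
    proof -
      have "top_of_set ?S = subtopology (top_of_set E) ?S" by (simp add: subtopology_subtopology)
      then show ?thesis
        using continuous_map_from_subtopology[OF \<xi>_cont, of ?S] \<xi>_in
        by (auto simp: continuous_map_in_subtopology stratum_def)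
    qed
    have "continuous_map (top_of_set ?D) euclidean (\<psi> \<circ> \<Phi> k)"
      by (rule continuous_map_compose[OF continuous_map_into_fulltopology[OF \<Phi>_cont] \<psi>(1)])
    then have u: "continuous_on ?D (\<lambda>x. \<psi> (\<Phi> k x))" unfolding continuous_map_iff_continuous o_def .
    have uim: "(\<lambda>x. \<psi> (\<Phi> k x)) ` ?D \<subseteq> ?S"
    proof (rule image_subsetI)
      fix x assume "x \<in> ?D"
      then have "\<Phi> k x \<in> stratum X \<pi> k"
        using continuous_map_image_subset_topspace[OF \<Phi>_cont] unfolding topS by auto
      then have "\<Phi> k x \<in> topspace X" "\<pi> (\<Phi> k x) = k" by (simp_all add: stratum_def)
      then show "\<psi> (\<Phi> k x) \<in> ?S" using \<xi>\<psi> by (auto simp: E_def)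
    qed
    have "continuous_map (top_of_set ?S) euclidean (g \<circ> \<xi>)"
      by (rule continuous_map_compose[OF \<xi>S continuous_map_into_fulltopology[OF g_cont]])
    then have v: "continuous_on ?S (\<lambda>w. g (\<xi> w))" unfolding continuous_map_iff_continuous o_def .
    have \<xi>_stratum: "\<xi> w \<in> stratum X \<pi> k" if "w \<in> ?S" for w using \<xi>_in that by (auto simp: stratum_def)
    have "g ` stratum X \<pi> k \<subseteq> ?D"
      using continuous_map_image_subset_topspace[OF g_cont] unfolding topS topspace_euclidean_subtopology .
    then have vim: "(\<lambda>w. g (\<xi> w)) ` ?S \<subseteq> ?D" using \<xi>_stratum by blast
    show ?thesis
    proof (rule absolute_extensor_retract[OF absolute_extensor_open_disk u uim v vim])
      fix w assume w: "w \<in> ?S"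
      then show "\<psi> (\<Phi> k (g (\<xi> w))) = w" using \<Phi>g[OF \<xi>_stratum[OF w]] \<psi>\<xi> by simp
    qed
  qed
  have "quasi_category (Exit X \<pi>)"
  proof (rule quasi_category_ExitI)
    fix m j f and A :: "nat \<Rightarrow> 'l"
    assume j: "0 < j" "j < m" and f: "continuous_map (top_of_set (horn m j)) X f"
      and fA: "\<And>t. t \<in> horn m j \<Longrightarrow> \<pi> (f t) = A (simplex_strat m t)"
    have f_in: "f t \<in> topspace X" if "t \<in> horn m j" for t
      using continuous_map_image_subset_topspace[OF f] that by auto
    have "continuous_map (top_of_set (horn m j)) euclidean (\<psi> \<circ> f)"
      by (rule continuous_map_compose[OF f \<psi>(1)])
    then have c: "continuous_on (horn m j) (\<lambda>t. \<psi> (f t))" unfolding continuous_map_iff_continuous o_def .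
    have fE: "\<psi> (f t) \<in> E" if "t \<in> horn m j" for t using f_in[OF that] by (simp add: E_def)
    have fA': "\<pi> (\<xi> (\<psi> (f t))) = A (simplex_strat m t)" if "t \<in> horn m j" for t
      using fA[OF that] \<xi>\<psi>[OF f_in[OF that]] by simp
    obtain G where G: "continuous_on (standard_simplex m) G" "\<And>t. t \<in> horn m j \<Longrightarrow> G t = \<psi> (f t)"
      "\<And>t. t \<in> standard_simplex m \<Longrightarrow> G t \<in> E \<and> \<pi> (\<xi> (G t)) = A (simplex_strat m t)"
      by (rule T.inner_horn_filler[OF j c fE fA' extensor]) blast+
    have "continuous_map (top_of_set (standard_simplex m)) (top_of_set E) G"
      using G(1,3) by auto
    from continuous_map_compose[OF this \<xi>_cont]
    have "continuous_map (top_of_set (standard_simplex m)) X (\<lambda>t. \<xi> (G t))" by (simp add: o_def)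
    then show "\<exists>G. continuous_map (top_of_set (standard_simplex m)) X G \<and> (\<forall>t\<in>horn m j. G t = f t) \<and>
        (\<forall>t\<in>standard_simplex m. \<pi> (G t) = A (simplex_strat m t))"
      using G(2,3) \<xi>\<psi> f_in by (intro exI[of _ "\<lambda>t. \<xi> (G t)"]) auto
  qed
  with con show ?thesis by blast
qed

end
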